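(* Under the standing hypotheses (H1)–(H6) below, suppose $\tau$ is in the limit-circle case at both endpoints. Then a linear relation $S$ is a self-adjoint restriction of $T_{\max}$ if and only if there are $v,w\in T_{\max}$, linearly independent modulo $T_{\min}$, with $$W_a^b(v,v^\ast)=W_a^b(w,w^\ast)=W_a^b(v,w^\ast)=0$$ such that $S=\{f\in T_{\max}\,:\,W_a^b(f,v^\ast)=W_a^b(f,w^\ast)=0\}$.
   Context: Let $-\infty\le a<b\le\infty$ and $\varrho,\varsigma,\chi$ locally finite Borel measures on $(a,b)$ with: (H1) $\varrho$ positive; (H2) $\chi$ real-valued; (H3) $\varsigma$ real-valued with $\operatorname{supp}\varsigma=(a,b)$; (H4) $\varsigma(\{x\})\chi(\{x\})=\varsigma(\{x\})\varrho(\{x\})=0$ for all $x$; (H5) for every gap $(\alpha,\beta)$ of $\operatorname{supp}\varrho$ (open interval in the complement with $\alpha,\beta\in\operatorname{supp}\varrho$) and every $f\in\mathfrak{D}_\tau$ with $f(\alpha-)=f(\beta+)=0$ one has $f=0$ on $(\alpha,\beta)$; (H6) $\operatorname{supp}\varrho$ has more than one point. Notation: $\int_c^x h\,d\mu=\int_{[c,x)}h\,d\mu$ ($x>c$), $0$ ($x=c$), $-\int_{[x,c)}h\,d\mu$ ($x<c$); $AC_{loc}((a,b);\mu)$: functions $f(x)=f(c)+\int_c^x h\,d\mu$, $h=\frac{df}{d\mu}\in L^1_{loc}$. $\mathfrak{D}_\tau$: $f\in AC_{loc}((a,b);\varsigma)$ for which there is $F\in AC_{loc}((a,b);\varrho)$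 with $F=-\frac{df}{d\varsigma}+\int_c^{\cdot}f\,d\chi$ $|\varsigma|$-a.e.; $\tau f:=\frac{dF}{d\varrho}$, $f^{[1]}:=\int_c^{\cdot}f\,d\chi-F$, $W(f,g)=fg^{[1]}-f^{[1]}g$. In $L^2((a,b);\varrho)$: $T_{\max}=\{(f,\tau f): f\in\mathfrak{D}_\tau,\ f,\tau f\in L^2\}$, elements identified with functions in $\mathfrak{D}_\tau$; $f^\ast$ is complex conjugation; $T_0=\{f\in T_{\max}:\operatorname{supp}f\text{ compact in }(a,b)\}$, $T_{\min}=\overline{T_0}$. For $f,g\in T_{\max}$ the limits $W(f,g)(a),W(f,g)(b)$ exist and $W_a^b(f,g)=W(f,g)(b)-W(f,g)(a)$. $\tau$ is l.c. at an endpoint if for all $z\in\mathbb{C}$ all solutions of $\tau u=zu$ are square-integrable with respect to $\varrho$ near that endpoint. A self-adjoint restriction of $T_{\max}$ is a linear relation $S\subseteq T_{\max}$ with $S=S^\ast$. *)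

theory Defs
  imports "HOL-Analysis.Analysis"
begin

type_synonym cfun = "real \<Rightarrow> complex"

definition ivl :: "ereal \<Rightarrow> ereal \<Rightarrow> real set" where
  "ivl a b = {x. a < ereal x \<and> ereal x < b}"

definition pos_lf_measure :: "ereal \<Rightarrow> ereal \<Rightarrow> real measure \<Rightarrow> bool" where
  "pos_lf_measure a b \<mu> \<longleftrightarrow> sets \<mu> = sets borel \<and> emeasure \<mu> (UNIV - ivl a b) = 0 \<and>
     (\<forall>K. compact K \<and> K \<subseteq> ivl a b \<longrightarrow> emeasure \<mu> K < \<infinity>)"

definition signed_lf_measure :: "ereal \<Rightarrow> ereal \<Rightarrow> real measure \<Rightarrow> real measure \<Rightarrow> bool" where
  "signed_lf_measure a b \<mu>p \<mu>n \<longleftrightarrow> pos_lf_measure a b \<mu>p \<and> pos_lf_measure a b \<mu>n \<and>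
     (\<exists>A \<in> sets borel. emeasure \<mu>p A = 0 \<and> emeasure \<mu>n (UNIV - A) = 0)"

definition spt :: "real measure \<Rightarrow> real measure \<Rightarrow> real \<Rightarrow> real" where
  "spt \<mu>p \<mu>n x = measure \<mu>p {x} - measure \<mu>n {x}"

definition pint :: "real measure \<Rightarrow> real \<Rightarrow> real \<Rightarrow> cfun \<Rightarrow> complex" where
  "pint \<mu> c x h = (if c < x then (LINT t:{c..<x}|\<mu>. h t)
                   else if x = c then 0 else - (LINT t:{x..<c}|\<mu>. h t))"

definition sint :: "real measure \<Rightarrow> real measure \<Rightarrow> real \<Rightarrow> real \<Rightarrow> cfun \<Rightarrow> complex" where
  "sint \<mu>p \<mu>n c x h = pint \<mu>p c x h - pint \<mu>n c x h"

definition loc_int :: "ereal \<Rightarrow> ereal \<Rightarrow> real measure \<Rightarrow> real measure \<Rightarrow> cfun \<Rightarrow> bool" where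
  "loc_int a b \<mu>p \<mu>n h \<longleftrightarrow> (\<forall>\<alpha> \<beta>. \<alpha> \<in> ivl a b \<and> \<beta> \<in> ivl a b \<longrightarrow>
       set_integrable \<mu>p {\<alpha>..\<beta>} h \<and> set_integrable \<mu>n {\<alpha>..\<beta>} h)"

definition ac_deriv :: "ereal \<Rightarrow> ereal \<Rightarrow> real \<Rightarrow> real measure \<Rightarrow> real measure \<Rightarrow> cfun \<Rightarrow> cfun \<Rightarrow> bool" where
  "ac_deriv a b c \<mu>p \<mu>n f h \<longleftrightarrow> loc_int a b \<mu>p \<mu>n h \<and>
     (\<forall>x \<in> ivl a b. f x = f c + sint \<mu>p \<mu>n c x h)"

(* tau_rel ... f F g : f in D_tau, F is the function of the definition of D_tau
   (normalised to 0 outside (a,b)), and g = dF/drho = tau f *)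
definition tau_rel :: "ereal \<Rightarrow> ereal \<Rightarrow> real \<Rightarrow> real measure \<Rightarrow> real measure \<Rightarrow> real measure
      \<Rightarrow> real measure \<Rightarrow> real measure \<Rightarrow> cfun \<Rightarrow> cfun \<Rightarrow> cfun \<Rightarrow> bool" where
  "tau_rel a b c \<rho> \<sigma>p \<sigma>n \<chi>p \<chi>n f F g \<longleftrightarrow>
     (\<exists>h. ac_deriv a b c \<sigma>p \<sigma>n f h \<and>
          ac_deriv a b c \<rho> (null_measure \<rho>) F g \<and>
          (AE x in \<sigma>p. x \<in> ivl a b \<longrightarrow> F x = - h x + sint \<chi>p \<chi>n c x f) \<and>
          (AE x in \<sigma>n. x \<in> ivl a b \<longrightarrow> F x = - h x + sint \<chi>p \<chi>n c x f)) \<and>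
     (\<forall>x. x \<notin> ivl a b \<longrightarrow> F x = 0)"

definition Dtau :: "ereal \<Rightarrow> ereal \<Rightarrow> real \<Rightarrow> real measure \<Rightarrow> real measure \<Rightarrow> real measure
      \<Rightarrow> real measure \<Rightarrow> real measure \<Rightarrow> cfun set" where
  "Dtau a b c \<rho> \<sigma>p \<sigma>n \<chi>p \<chi>n = {f. \<exists>F g. tau_rel a b c \<rho> \<sigma>p \<sigma>n \<chi>p \<chi>n f F g}"

definition qderiv :: "ereal \<Rightarrow> ereal \<Rightarrow> real \<Rightarrow> real measure \<Rightarrow> real measure \<Rightarrow> real measure
      \<Rightarrow> real measure \<Rightarrow> real measure \<Rightarrow> cfun \<Rightarrow> cfun" where
  "qderiv a b c \<rho> \<sigma>p \<sigma>n \<chi>p \<chi>n f = (\<lambda>x. sint \<chi>p \<chi>n c x f -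
      (THE F. \<exists>g. tau_rel a b c \<rho> \<sigma>p \<sigma>n \<chi>p \<chi>n f F g) x)"

definition wronski :: "ereal \<Rightarrow> ereal \<Rightarrow> real \<Rightarrow> real measure \<Rightarrow> real measure \<Rightarrow> real measure
      \<Rightarrow> real measure \<Rightarrow> real measure \<Rightarrow> cfun \<Rightarrow> cfun \<Rightarrow> cfun" where
  "wronski a b c \<rho> \<sigma>p \<sigma>n \<chi>p \<chi>n f g = (\<lambda>x.
      f x * qderiv a b c \<rho> \<sigma>p \<sigma>n \<chi>p \<chi>n g x - qderiv a b c \<rho> \<sigma>p \<sigma>n \<chi>p \<chi>n f x * g x)"

definition at_left_end :: "ereal \<Rightarrow> real filter" where
  "at_left_end a = (if a = -\<infinity> then at_bot else at_right (real_of_ereal a))"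

definition at_right_end :: "ereal \<Rightarrow> real filter" where
  "at_right_end b = (if b = \<infinity> then at_top else at_left (real_of_ereal b))"

definition Wab :: "ereal \<Rightarrow> ereal \<Rightarrow> real \<Rightarrow> real measure \<Rightarrow> real measure \<Rightarrow> real measure
      \<Rightarrow> real measure \<Rightarrow> real measure \<Rightarrow> cfun \<Rightarrow> cfun \<Rightarrow> complex" where
  "Wab a b c \<rho> \<sigma>p \<sigma>n \<chi>p \<chi>n f g =
     Lim (at_right_end b) (wronski a b c \<rho> \<sigma>p \<sigma>n \<chi>p \<chi>n f g)
   - Lim (at_left_end a) (wronski a b c \<rho> \<sigma>p \<sigma>n \<chi>p \<chi>n f g)"

definition L2 :: "real measure \<Rightarrow> cfun \<Rightarrow> bool" where
  "L2 \<rho> f \<longleftrightarrow> f \<in> borel_measurable \<rho> \<and> integrable \<rho> (\<lambda>x. (norm (f x))\<^sup>2)"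

definition inner_L2 :: "real measure \<Rightarrow> cfun \<Rightarrow> cfun \<Rightarrow> complex" where
  "inner_L2 \<rho> f g = (LINT x|\<rho>. f x * cnj (g x))"

(* Linear relations in L^2(rho) are represented by sets of pairs of representatives.
   sat R: all pairs of L^2 representatives of the classes of pairs in R. *)
definition sat :: "real measure \<Rightarrow> (cfun \<times> cfun) set \<Rightarrow> (cfun \<times> cfun) set" where
  "sat \<rho> R = {(f, g). L2 \<rho> f \<and> L2 \<rho> g \<and>
      (\<exists>(f', g') \<in> R. AE x in \<rho>. f x = f' x \<and> g x = g' x)}"

definition adjoint :: "real measure \<Rightarrow> (cfun \<times> cfun) set \<Rightarrow> (cfun \<times> cfun) set" where
  "adjoint \<rho> R = {(f, g). L2 \<rho> f \<and> L2 \<rho> g \<and>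
      (\<forall>(u, v) \<in> R. inner_L2 \<rho> g u = inner_L2 \<rho> f v)}"

(* T_max, as pairs (f, tau f) with f in D_tau (the function itself) *)
definition Tmax :: "ereal \<Rightarrow> ereal \<Rightarrow> real \<Rightarrow> real measure \<Rightarrow> real measure \<Rightarrow> real measure
      \<Rightarrow> real measure \<Rightarrow> real measure \<Rightarrow> (cfun \<times> cfun) set" where
  "Tmax a b c \<rho> \<sigma>p \<sigma>n \<chi>p \<chi>n = {(f, g). (\<exists>F. tau_rel a b c \<rho> \<sigma>p \<sigma>n \<chi>p \<chi>n f F g)
       \<and> L2 \<rho> f \<and> L2 \<rho> g}"

definition T0 :: "ereal \<Rightarrow> ereal \<Rightarrow> real \<Rightarrow> real measure \<Rightarrow> real measure \<Rightarrow> real measure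
      \<Rightarrow> real measure \<Rightarrow> real measure \<Rightarrow> (cfun \<times> cfun) set" where
  "T0 a b c \<rho> \<sigma>p \<sigma>n \<chi>p \<chi>n = {(f, g) \<in> Tmax a b c \<rho> \<sigma>p \<sigma>n \<chi>p \<chi>n.
       \<exists>K. compact K \<and> K \<subseteq> ivl a b \<and> (\<forall>x \<in> ivl a b - K. f x = 0)}"

definition Tmin :: "ereal \<Rightarrow> ereal \<Rightarrow> real \<Rightarrow> real measure \<Rightarrow> real measure \<Rightarrow> real measure
      \<Rightarrow> real measure \<Rightarrow> real measure \<Rightarrow> (cfun \<times> cfun) set" where
  "Tmin a b c \<rho> \<sigma>p \<sigma>n \<chi>p \<chi>n = {(f, g). L2 \<rho> f \<and> L2 \<rho> g \<and>
       (\<exists>s. (\<forall>n. s n \<in> T0 a b c \<rho> \<sigma>p \<sigma>n \<chi>p \<chi>n) \<and>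
            ((\<lambda>n. LINT x|\<rho>. (norm (fst (s n) x - f x))\<^sup>2) \<longlonglongrightarrow> 0) \<and>
            ((\<lambda>n. LINT x|\<rho>. (norm (snd (s n) x - g x))\<^sup>2) \<longlonglongrightarrow> 0))}"

definition msupp :: "ereal \<Rightarrow> ereal \<Rightarrow> real measure \<Rightarrow> real set" where
  "msupp a b \<mu> = {x \<in> ivl a b. \<forall>e>0. emeasure \<mu> (ball x e) > 0}"

definition ssupp :: "ereal \<Rightarrow> ereal \<Rightarrow> real measure \<Rightarrow> real measure \<Rightarrow> real set" where
  "ssupp a b \<mu>p \<mu>n = {x \<in> ivl a b. \<forall>e>0. emeasure \<mu>p (ball x e) + emeasure \<mu>n (ball x e) > 0}"

definition standing_hyps :: "ereal \<Rightarrow> ereal \<Rightarrow> real \<Rightarrow> real measure \<Rightarrow> real measure \<Rightarrow> real measure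
      \<Rightarrow> real measure \<Rightarrow> real measure \<Rightarrow> bool" where
  "standing_hyps a b c \<rho> \<sigma>p \<sigma>n \<chi>p \<chi>n \<longleftrightarrow>
     a < b \<and> c \<in> ivl a b \<and>
     pos_lf_measure a b \<rho> \<and>
     signed_lf_measure a b \<chi>p \<chi>n \<and>
     signed_lf_measure a b \<sigma>p \<sigma>n \<and> ssupp a b \<sigma>p \<sigma>n = ivl a b \<and>
     (\<forall>x. spt \<sigma>p \<sigma>n x * spt \<chi>p \<chi>n x = 0 \<and> spt \<sigma>p \<sigma>n x * measure \<rho> {x} = 0) \<and>
     (\<forall>\<alpha> \<beta> f. \<alpha> \<in> msupp a b \<rho> \<and> \<beta> \<in> msupp a b \<rho> \<and> \<alpha> < \<beta> \<and>
        {\<alpha><..<\<beta>} \<inter> msupp a b \<rho> = {} \<and> f \<in> Dtau a b c \<rho> \<sigma>p \<sigma>n \<chi>p \<chi>n \<and>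
        (f \<longlongrightarrow> 0) (at_left \<alpha>) \<and> (f \<longlongrightarrow> 0) (at_right \<beta>) \<longrightarrow>
        (\<forall>x \<in> {\<alpha><..<\<beta>}. f x = 0)) \<and>
     (\<exists>x y. x \<in> msupp a b \<rho> \<and> y \<in> msupp a b \<rho> \<and> x \<noteq> y)"

definition lc_left :: "ereal \<Rightarrow> ereal \<Rightarrow> real \<Rightarrow> real measure \<Rightarrow> real measure \<Rightarrow> real measure
      \<Rightarrow> real measure \<Rightarrow> real measure \<Rightarrow> bool" where
  "lc_left a b c \<rho> \<sigma>p \<sigma>n \<chi>p \<chi>n \<longleftrightarrow> (\<forall>z::complex. \<forall>u F g.
      tau_rel a b c \<rho> \<sigma>p \<sigma>n \<chi>p \<chi>n u F g \<and> (AE x in \<rho>. g x = z * u x) \<longrightarrow>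
      (\<exists>\<alpha> \<in> ivl a b. set_integrable \<rho> {x. a < ereal x \<and> x \<le> \<alpha>} (\<lambda>x. (norm (u x))\<^sup>2)))"

definition lc_right :: "ereal \<Rightarrow> ereal \<Rightarrow> real \<Rightarrow> real measure \<Rightarrow> real measure \<Rightarrow> real measure
      \<Rightarrow> real measure \<Rightarrow> real measure \<Rightarrow> bool" where
  "lc_right a b c \<rho> \<sigma>p \<sigma>n \<chi>p \<chi>n \<longleftrightarrow> (\<forall>z::complex. \<forall>u F g.
      tau_rel a b c \<rho> \<sigma>p \<sigma>n \<chi>p \<chi>n u F g \<and> (AE x in \<rho>. g x = z * u x) \<longrightarrow>
      (\<exists>\<beta> \<in> ivl a b. set_integrable \<rho> {x. \<beta> \<le> x \<and> ereal x < b} (\<lambda>x. (norm (u x))\<^sup>2)))"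

definition self_adjoint_restriction :: "ereal \<Rightarrow> ereal \<Rightarrow> real \<Rightarrow> real measure \<Rightarrow> real measure
      \<Rightarrow> real measure \<Rightarrow> real measure \<Rightarrow> real measure \<Rightarrow> (cfun \<times> cfun) set \<Rightarrow> bool" where
  "self_adjoint_restriction a b c \<rho> \<sigma>p \<sigma>n \<chi>p \<chi>n S \<longleftrightarrow>
     S \<subseteq> sat \<rho> (Tmax a b c \<rho> \<sigma>p \<sigma>n \<chi>p \<chi>n) \<and> adjoint \<rho> S = S"

end

theory Submission
  imports Defs
begin

text \<open>
  All five measures are absolutely continuous with respect to their sum \<open>m\<close>. With the densities \<open>s\<close>, \<open>q\<close>, \<open>r\<close> of
  \<open>\<sigma>\<close>, \<open>\<chi>\<close>, \<open>\<rho>\<close>, the equation \<open>\<tau>f = g\<close> becomes the first order system \<open>df = s f\<^sup>[\<^sup>1\<^sup>] dm\<close>,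
  \<open>df\<^sup>[\<^sup>1\<^sup>] = (q f - r g) dm\<close>, whose jump corrections in the product rule cancel in the Wronskian by (H4). Let \<open>u1\<close>, \<open>u2\<close>
  be real solutions of \<open>\<tau>u = 0\<close> with Wronskian 1. In the limit-circle case they lie in \<open>L\<^sup>2(\<rho>)\<close>, so variation of constants
  describes \<open>T\<^sub>m\<^sub>a\<^sub>x\<close> explicitly, and every \<open>f\<close> in it has four boundary values, the limits of its Wronskians with \<open>u1\<close>
  and \<open>u2\<close> at both endpoints. By Lagrange's identity \<open>W\<^sub>a\<^sup>b(f, g\<^sup>*)\<close> is a nondegenerate skew-Hermitian form of
  signature (2,2) in these values.

  (H5) and (H6) enter once: they make \<open>u1\<close>, \<open>u2\<close> linearly independent in \<open>L\<^sup>2(\<rho>)\<close>. Hence there are compactly supported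
  functions dual to \<open>u1\<close>, \<open>u2\<close>, with which one sees that all boundary values occur, that vanishing boundary values
  characterise \<open>T\<^sub>m\<^sub>i\<^sub>n\<close>, and that the adjoint of \<open>T\<^sub>0\<close> is contained in \<open>T\<^sub>m\<^sub>a\<^sub>x\<close>. Self-adjoint restrictions thus correspond to
  the subspaces of \<open>\<complex>\<^sup>4\<close> which equal their own orthogonal complement for the boundary form; these are exactly the spans
  of two linearly independent, mutually orthogonal isotropic vectors.
\<close>

text \<open>Integrals over \<open>{x..<y}\<close> make every function left-continuous, and at an
  atom of \<open>m\<close> the homogeneous system acts by the identity plus off-diagonal entries
  \<open>s t * measure m {t}\<close> and \<open>q t * measure m {t}\<close>. By (H4) this matrix has
  determinant 1, but the Picard series only runs forward from its starting point. Solving to the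
  left is therefore never done directly: solutions started further left have constant Wronskian 1,
  and Cramer's rule recovers arbitrary data at any later point.

  A second difficulty is that boundary values belong to functions, while self-adjointness concerns
  classes modulo null sets. Boundary values are attached only to pairs whose first component is a
  function in the domain of \<tau>; \<open>sat\<close> and the adjoint carry the result to other
  representatives. They are compared in limits only through Lagrange's identity, whose left side is
  continuous in the norm. Approximation by compactly supported elements happens on the side of
  \<open>g\<close>: truncate, restore orthogonality to \<open>u1\<close>, \<open>u2\<close> by a
  correction of fixed compact support, and return to \<open>f\<close> by a bounded solution
  operator.\<close>

section \<open>Absolutely continuous functions with respect to a measure\<close>

locale borel_sigma_finite = sigma_finite_measure m for m :: "real measure" +
  assumes sets_m [simp, measurable_cong]: "sets m = sets borel"
begin

lemma space_m [simp]: "space m = UNIV"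
  using sets_m by (metis sets_eq_imp_space_eq space_borel)

lemma pair_sf: "pair_sigma_finite m m"
  by (simp add: pair_sigma_finite.intro sigma_finite_measure_axioms)

lemma emeasure_singleton_finite: "emeasure m {t} < \<infinity>"
proof -
  obtain A :: "nat \<Rightarrow> real set" where A: "range A \<subseteq> sets m" "(\<Union>i. A i) = space m" "\<And>i. emeasure m (A i) \<noteq> \<infinity>"
    using sigma_finite by blast
  then have "t \<in> (\<Union>i. A i)" by simp
  then obtain i where "t \<in> A i" by blast
  with A(1) have "emeasure m {t} \<le> emeasure m (A i)" by (intro emeasure_mono) auto
  then show ?thesis using A(3)[of i] by (auto simp: less_top top_unique)
qed

text \<open>Fubini for \<open>\<phi> s * \<psi> t\<close> with the plane cut into s < t, t < s and
  the diagonal. The strict inequalities match the primitives over \<open>{..<t}\<close>, and the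
  diagonal carries exactly the atoms of \<open>m\<close>.\<close>

lemma
  fixes \<phi> \<psi> :: "real \<Rightarrow> 'a::{real_normed_field,banach,second_countable_topology}"
  assumes \<phi>: "integrable m \<phi>" and \<psi>: "integrable m \<psi>"
  shows integrable_mult_primitive: "integrable m (\<lambda>t. \<psi> t * (LINT s:{..<t}|m. \<phi> s))"
    and integrable_mult_atoms: "integrable m (\<lambda>t. \<phi> t * \<psi> t * of_real (measure m {t}))"
    and integral_product_split: "(\<integral>t. \<phi> t \<partial>m) * (\<integral>t. \<psi> t \<partial>m) =
      (\<integral>t. \<psi> t * (LINT s:{..<t}|m. \<phi> s) \<partial>m) + (\<integral>t. \<phi> t * (LINT s:{..<t}|m. \<psi> s) \<partial>m)
      + (\<integral>t. \<phi> t * \<psi> t * of_real (measure m {t}) \<partial>m)"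
proof -
  interpret P: pair_sigma_finite m m by (rule pair_sf)
  note [measurable] = borel_measurable_integrable[OF \<phi>] borel_measurable_integrable[OF \<psi>]
  define H where "H = (\<lambda>(s,t). \<phi> s * \<psi> t)"
  have intH: "integrable (m \<Otimes>\<^sub>M m) H"
    unfolding H_def
  proof (rule P.Fubini_integrable)
    show "integrable m (\<lambda>x. LINT y|m. norm (case (x, y) of (s, t) \<Rightarrow> \<phi> s * \<psi> t))"
      using \<phi> by (simp add: norm_mult)
    show "AE x in m. integrable m (\<lambda>y. case (x, y) of (s, t) \<Rightarrow> \<phi> s * \<psi> t)"
      using \<psi> by simp
  qed measurable
  have HP: "integral\<^sup>L (m \<Otimes>\<^sub>M m) H = (\<integral>t. \<phi> t \<partial>m) * (\<integral>t. \<psi> t \<partial>m)"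
    using P.integral_fst[of "\<lambda>s t. \<phi> s * \<psi> t"] intH by (simp add: H_def)
  define L where "L = {(s::real,t::real). s < t}"
  define G where "G = {(s::real,t::real). t < s}"
  define D where "D = {(s::real,t::real). s = t}"
  have [measurable]: "L \<in> sets (m \<Otimes>\<^sub>M m)" "G \<in> sets (m \<Otimes>\<^sub>M m)" "D \<in> sets (m \<Otimes>\<^sub>M m)"
    unfolding L_def G_def D_def
    unfolding sets_pair_measure_cong[OF sets_m sets_m] borel_prod case_prod_unfold
    by (intro borel_open borel_closed open_Collect_less closed_Collect_eq continuous_intros)+
  have iL: "integrable (m \<Otimes>\<^sub>M m) (\<lambda>z. indicator L z *\<^sub>R H z)"
    and iG: "integrable (m \<Otimes>\<^sub>M m) (\<lambda>z. indicator G z *\<^sub>R H z)"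
    and iD: "integrable (m \<Otimes>\<^sub>M m) (\<lambda>z. indicator D z *\<^sub>R H z)"
    by (rule integrable_mult_indicator[OF _ intH], measurable)+
  have eq: "H z = indicator L z *\<^sub>R H z + indicator G z *\<^sub>R H z + indicator D z *\<^sub>R H z" for z
    by (cases z) (auto simp: L_def G_def D_def indicator_def)
  have tot: "integral\<^sup>L (m \<Otimes>\<^sub>M m) H = integral\<^sup>L (m \<Otimes>\<^sub>M m) (\<lambda>z. indicator L z *\<^sub>R H z)
     + integral\<^sup>L (m \<Otimes>\<^sub>M m) (\<lambda>z. indicator G z *\<^sub>R H z) + integral\<^sup>L (m \<Otimes>\<^sub>M m) (\<lambda>z. indicator D z *\<^sub>R H z)"
    using iL iG iD Bochner_Integration.integral_cong[OF refl eq, of "m \<Otimes>\<^sub>M m"] by simp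
  have inL: "(LINT s|m. indicator L (s,t) *\<^sub>R H (s,t)) = \<psi> t * (LINT s:{..<t}|m. \<phi> s)" for t
  proof -
    have "(LINT s|m. indicator L (s,t) *\<^sub>R H (s,t)) = (LINT s|m. \<psi> t * (indicator {..<t} s *\<^sub>R \<phi> s))"
      by (rule Bochner_Integration.integral_cong) (auto simp: L_def H_def indicator_def)
    then show ?thesis by (simp add: set_lebesgue_integral_def del: mult_scaleR_right)
  qed
  have inG: "(LINT t|m. indicator G (s,t) *\<^sub>R H (s,t)) = \<phi> s * (LINT t:{..<s}|m. \<psi> t)" for s
  proof -
    have "(LINT t|m. indicator G (s,t) *\<^sub>R H (s,t)) = (LINT t|m. \<phi> s * (indicator {..<s} t *\<^sub>R \<psi> t))"
      by (rule Bochner_Integration.integral_cong) (auto simp: G_def H_def indicator_def)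
    then show ?thesis by (simp add: set_lebesgue_integral_def del: mult_scaleR_right)
  qed
  have inD: "(LINT s|m. indicator D (s,t) *\<^sub>R H (s,t)) = \<phi> t * \<psi> t * of_real (measure m {t})" for t
  proof -
    have "(LINT s|m. indicator D (s,t) *\<^sub>R H (s,t)) = (LINT s|m. \<phi> t * \<psi> t * of_real (indicator {t} s))"
      by (rule Bochner_Integration.integral_cong) (auto simp: D_def H_def indicator_def)
    also have "\<dots> = \<phi> t * \<psi> t * (LINT s|m. of_real (indicator {t} s))" by simp
    also have "(LINT s|m. (of_real (indicator {t} s) :: 'a)) = of_real (LINT s|m. indicator {t} s)"
      by (rule integral_of_real) (rule integrable_real_indicator[OF _ emeasure_singleton_finite], simp)
    finally show ?thesis by simp
  qed
  have c: "(\<lambda>(s, t). indicator X (s, t) *\<^sub>R H (s, t)) = (\<lambda>z. indicator X z *\<^sub>R H z)" for X :: "(real \<times> real) set"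
    by auto
  note iL' = iL[folded c] and iG' = iG[folded c] and iD' = iD[folded c]
  show "integrable m (\<lambda>t. \<psi> t * (LINT s:{..<t}|m. \<phi> s))"
    using P.integrable_snd[OF iL'] unfolding inL .
  show "integrable m (\<lambda>t. \<phi> t * \<psi> t * of_real (measure m {t}))"
    using P.integrable_snd[OF iD'] unfolding inD .
  show "(\<integral>t. \<phi> t \<partial>m) * (\<integral>t. \<psi> t \<partial>m) =
      (\<integral>t. \<psi> t * (LINT s:{..<t}|m. \<phi> s) \<partial>m) + (\<integral>t. \<phi> t * (LINT s:{..<t}|m. \<psi> s) \<partial>m)
      + (\<integral>t. \<phi> t * \<psi> t * of_real (measure m {t}) \<partial>m)"
    using P.integral_snd[OF iL'] P.integral_snd[OF iD'] P.integral_fst[OF iG']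
    unfolding inL inG inD c HP[symmetric] tot by simp
qed

end

lemma open_real_neighbours:
  fixes x :: real
  assumes "open S" "x \<in> S" shows "\<exists>e>0. x - e \<in> S \<and> x + e \<in> S"
proof -
  obtain e where e: "e > 0" "cball x e \<subseteq> S" using assms open_contains_cball by blast
  then have "x - e \<in> S" "x + e \<in> S" by (auto simp: dist_real_def subset_iff)
  then show ?thesis using e(1) by blast
qed

text \<open>The two-point form has no base point and no sign convention, so restricting to
  subintervals and gluing are immediate. The half-open interval reproduces the convention of
  \<open>pint\<close> and makes \<open>f\<close> left-continuous.\<close>

definition ac_on :: "real measure \<Rightarrow> real set \<Rightarrow> (real \<Rightarrow> 'a::{real_normed_field,banach,second_countable_topology})
    \<Rightarrow> (real \<Rightarrow> 'a) \<Rightarrow> bool" where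
  "ac_on m J f \<phi> \<longleftrightarrow> is_interval J \<and> (\<forall>x\<in>J. \<forall>y\<in>J. x \<le> y \<longrightarrow>
      set_integrable m {x..<y} \<phi> \<and> f y = f x + (LINT t:{x..<y}|m. \<phi> t))"

lemma ac_onI:
  assumes "is_interval J"
    and "\<And>x y. x \<in> J \<Longrightarrow> y \<in> J \<Longrightarrow> x \<le> y \<Longrightarrow> set_integrable m {x..<y} \<phi>"
    and "\<And>x y. x \<in> J \<Longrightarrow> y \<in> J \<Longrightarrow> x \<le> y \<Longrightarrow> f y = f x + (LINT t:{x..<y}|m. \<phi> t)"
  shows "ac_on m J f \<phi>"
  unfolding ac_on_def using assms by blast

lemma ac_on_is_interval: "ac_on m J f \<phi> \<Longrightarrow> is_interval J"
  unfolding ac_on_def by blast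

lemma ac_on_integrable: "ac_on m J f \<phi> \<Longrightarrow> x \<in> J \<Longrightarrow> y \<in> J \<Longrightarrow> set_integrable m {x..<y} \<phi>"
  by (cases "x \<le> y") (simp_all add: ac_on_def set_integrable_def)

lemma ac_on_eq: "ac_on m J f \<phi> \<Longrightarrow> x \<in> J \<Longrightarrow> y \<in> J \<Longrightarrow> x \<le> y \<Longrightarrow> f y = f x + (LINT t:{x..<y}|m. \<phi> t)"
  unfolding ac_on_def by blast

lemma ac_on_interval: "ac_on m J f \<phi> \<Longrightarrow> x \<in> J \<Longrightarrow> y \<in> J \<Longrightarrow> x \<le> t \<Longrightarrow> t \<le> y \<Longrightarrow> t \<in> J"
  unfolding ac_on_def is_interval_1 by blast

lemma ac_on_subset: "ac_on m J f \<phi> \<Longrightarrow> J' \<subseteq> J \<Longrightarrow> is_interval J' \<Longrightarrow> ac_on m J' f \<phi>"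
  unfolding ac_on_def by blast

lemma ac_on_cong:
  assumes f: "ac_on m J f \<phi>" and g: "\<And>x. x \<in> J \<Longrightarrow> f x = g x" and \<psi>: "\<And>x. x \<in> J \<Longrightarrow> \<phi> x = \<psi> x"
  shows "ac_on m J g \<psi>"
proof (rule ac_onI)
  show "is_interval J" by (rule ac_on_is_interval[OF f])
  fix x y assume xy: "x \<in> J" "y \<in> J" "x \<le> y"
  have \<psi>': "\<phi> t = \<psi> t" if "t \<in> {x..<y}" for t
    using ac_on_interval[OF f xy(1,2), of t] that \<psi> by auto
  show "set_integrable m {x..<y} \<psi>"
    by (rule set_integrable_cong[OF refl refl, THEN iffD1, OF _ ac_on_integrable[OF f xy(1,2)]]) (rule \<psi>')
  have "(LINT t:{x..<y}|m. \<psi> t) = (LINT t:{x..<y}|m. \<phi> t)"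
    unfolding set_lebesgue_integral_def
    by (rule Bochner_Integration.integral_cong) (use \<psi>' in \<open>auto simp: indicator_def\<close>)
  then show "g y = g x + (LINT t:{x..<y}|m. \<psi> t)"
    using ac_on_eq[OF f xy] xy by (simp add: g)
qed

lemma ac_on_const: "is_interval J \<Longrightarrow> ac_on m J (\<lambda>_. k) (\<lambda>_. 0)"
  by (simp add: ac_on_def set_integrable_def)

lemma ac_on_add:
  assumes f: "ac_on m J f \<phi>" and g: "ac_on m J g \<psi>"
  shows "ac_on m J (\<lambda>x. f x + g x) (\<lambda>x. \<phi> x + \<psi> x)"
proof (rule ac_onI[OF ac_on_is_interval[OF f]])
  fix x y assume xy: "x \<in> J" "y \<in> J" "x \<le> y"
  note i = ac_on_integrable[OF f xy(1,2)] ac_on_integrable[OF g xy(1,2)]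
  show "set_integrable m {x..<y} (\<lambda>x. \<phi> x + \<psi> x)" using i by simp
  show "f y + g y = f x + g x + (LINT t:{x..<y}|m. \<phi> t + \<psi> t)"
    using i ac_on_eq[OF f xy] ac_on_eq[OF g xy] by (simp add: set_integral_add(2))
qed

lemma ac_on_cmult:
  assumes f: "ac_on m J f \<phi>"
  shows "ac_on m J (\<lambda>x. k * f x) (\<lambda>x. k * \<phi> x)"
proof (rule ac_onI[OF ac_on_is_interval[OF f]])
  fix x y assume xy: "x \<in> J" "y \<in> J" "x \<le> y"
  show "set_integrable m {x..<y} (\<lambda>x. k * \<phi> x)" using ac_on_integrable[OF f xy(1,2)] by simp
  show "k * f y = k * f x + (LINT t:{x..<y}|m. k * \<phi> t)"
    using ac_on_eq[OF f xy] by (simp add: algebra_simps)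
qed

lemma ac_on_diff:
  assumes "ac_on m J f \<phi>" "ac_on m J g \<psi>"
  shows "ac_on m J (\<lambda>x. f x - g x) (\<lambda>x. \<phi> x - \<psi> x)"
  using ac_on_add[OF assms(1) ac_on_cmult[OF assms(2), of "-1"]] by simp

lemma ac_on_cnj:
  assumes f: "ac_on m J f \<phi>" shows "ac_on m J (\<lambda>x. cnj (f x)) (\<lambda>x. cnj (\<phi> x))"
proof (rule ac_onI[OF ac_on_is_interval[OF f]])
  fix x y assume xy: "x \<in> J" "y \<in> J" "x \<le> y"
  have *: "indicator A t *\<^sub>R cnj (\<phi> t) = cnj (indicator A t *\<^sub>R \<phi> t)" for A :: "real set" and t
    by simp
  show "set_integrable m {x..<y} (\<lambda>x. cnj (\<phi> x))"
    using ac_on_integrable[OF f xy(1,2)] unfolding set_integrable_def * by (rule integrable_cnj)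
  show "cnj (f y) = cnj (f x) + (LINT t:{x..<y}|m. cnj (\<phi> t))"
    using ac_on_eq[OF f xy] unfolding set_lebesgue_integral_def * Bochner_Integration.integral_cnj by simp
qed

context borel_sigma_finite
begin

text \<open>Integration by parts, from the splitting of the plane applied to the densities cut off
  to \<open>{x..<y}\<close>. The jumps of \<open>f\<close> and \<open>g\<close> at an atom
  \<open>t\<close> are \<open>\<phi> t * measure m {t}\<close> and
  \<open>\<psi> t * measure m {t}\<close>; the last summand is the density of the product of the
  two.\<close>

lemma ac_on_mult:
  assumes f: "ac_on m J f \<phi>" and g: "ac_on m J g \<psi>"
  shows "ac_on m J (\<lambda>x. f x * g x) (\<lambda>t. f t * \<psi> t + g t * \<phi> t + \<phi> t * \<psi> t * of_real (measure m {t}))"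
proof (rule ac_onI[OF ac_on_is_interval[OF f]])
  fix x y assume xy: "x \<in> J" "y \<in> J" "x \<le> y"
  define \<phi>0 where "\<phi>0 = (\<lambda>t. indicator {x..<y} t *\<^sub>R \<phi> t)"
  define \<psi>0 where "\<psi>0 = (\<lambda>t. indicator {x..<y} t *\<^sub>R \<psi> t)"
  have i: "integrable m \<phi>0" "integrable m \<psi>0"
    using ac_on_integrable[OF f] ac_on_integrable[OF g] xy by (auto simp: \<phi>0_def \<psi>0_def set_integrable_def)
  have prim: "h t = h x + (LINT s:{..<t}|m. indicator {x..<y} s *\<^sub>R \<eta> s)"
    if "t \<in> {x..y}" "ac_on m J h \<eta>" for t and h \<eta> :: "real \<Rightarrow> 'a"
  proof -
    have "(LINT s:{..<t}|m. indicator {x..<y} s *\<^sub>R \<eta> s) = (LINT s:{x..<t}|m. \<eta> s)"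
      unfolding set_lebesgue_integral_def
      by (rule Bochner_Integration.integral_cong) (use that in \<open>auto simp: indicator_def\<close>)
    then show ?thesis using ac_on_eq[OF that(2), of x t] ac_on_interval[OF that(2) xy(1,2), of t] that xy by auto
  qed
  have ft: "f t = f x + (LINT s:{..<t}|m. \<phi>0 s)" and gt: "g t = g x + (LINT s:{..<t}|m. \<psi>0 s)"
    if "t \<in> {x..y}" for t
    using prim[OF that f] prim[OF that g] by (simp_all add: \<phi>0_def \<psi>0_def)
  have fy: "f y = f x + (LINT s|m. \<phi>0 s)" and gy: "g y = g x + (LINT s|m. \<psi>0 s)"
    using ac_on_eq[OF f xy] ac_on_eq[OF g xy] by (simp_all add: \<phi>0_def \<psi>0_def set_lebesgue_integral_def)
  define R where "R = (\<lambda>t. f x * \<psi>0 t + g x * \<phi>0 t + \<psi>0 t * (LINT s:{..<t}|m. \<phi>0 s)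
     + \<phi>0 t * (LINT s:{..<t}|m. \<psi>0 s) + \<phi>0 t * \<psi>0 t * of_real (measure m {t}))"
  have R: "indicator {x..<y} t *\<^sub>R (f t * \<psi> t + g t * \<phi> t + \<phi> t * \<psi> t * of_real (measure m {t})) = R t" for t
    using ft[of t] gt[of t] by (cases "t \<in> {x..<y}") (auto simp: R_def \<phi>0_def \<psi>0_def algebra_simps)
  have iR: "integrable m R"
    unfolding R_def by (intro Bochner_Integration.integrable_add integrable_mult_right
        integrable_mult_primitive integrable_mult_atoms i)
  show "set_integrable m {x..<y} (\<lambda>t. f t * \<psi> t + g t * \<phi> t + \<phi> t * \<psi> t * of_real (measure m {t}))"
    using iR by (simp add: set_integrable_def R)
  have "f y * g y = f x * g x + f x * (LINT s|m. \<psi>0 s) + g x * (LINT s|m. \<phi>0 s) + (LINT s|m. \<phi>0 s) * (LINT s|m. \<psi>0 s)"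
    by (simp add: fy gy algebra_simps)
  also have "\<dots> = f x * g x + (LINT t|m. R t)"
    unfolding R_def integral_product_split[OF i]
    using i integrable_mult_primitive[OF i] integrable_mult_primitive[OF i(2,1)] integrable_mult_atoms[OF i] by simp
  finally show "f y * g y = f x * g x + (LINT t:{x..<y}|m. f t * \<psi> t + g t * \<phi> t + \<phi> t * \<psi> t * of_real (measure m {t}))"
    by (simp add: set_lebesgue_integral_def R)
qed

lemma ac_on_mult_no_common_atoms:
  assumes "ac_on m J f \<phi>" "ac_on m J g \<psi>" and "\<And>t. t \<in> J \<Longrightarrow> \<phi> t * \<psi> t * of_real (measure m {t}) = 0"
  shows "ac_on m J (\<lambda>x. f x * g x) (\<lambda>t. f t * \<psi> t + g t * \<phi> t)"
  by (rule ac_on_cong[OF ac_on_mult[OF assms(1,2)]]) (use assms(3) in auto)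

end

section \<open>One-sided limits, bounds and measurability of absolutely continuous functions\<close>

lemma tendsto_set_integral_vanish:
  fixes \<phi> :: "'b \<Rightarrow> 'a::{banach,second_countable_topology}"
  assumes \<phi>: "set_integrable m A \<phi>" and B: "\<And>n. B n \<in> sets m" "\<And>n. B n \<subseteq> A"
    and ev: "AE t in m. t \<in> A \<longrightarrow> (\<forall>\<^sub>F n in sequentially. t \<notin> B n)"
  shows "(\<lambda>n. LINT t:B n|m. \<phi> t) \<longlonglongrightarrow> 0"
proof -
  define \<psi> where "\<psi> = (\<lambda>t. indicator A t *\<^sub>R \<phi> t)"
  have i: "integrable m \<psi>" using \<phi> by (simp add: \<psi>_def set_integrable_def)
  note [measurable] = borel_measurable_integrable[OF i] B(1)
  have "(\<lambda>n. LINT t|m. indicator (B n) t *\<^sub>R \<psi> t) \<longlonglongrightarrow> (LINT t|m. 0)"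
  proof (rule integral_dominated_convergence[where w="\<lambda>t. norm (\<psi> t)"])
    show "AE t in m. (\<lambda>n. indicator (B n) t *\<^sub>R \<psi> t) \<longlonglongrightarrow> 0"
      using ev
    proof eventually_elim
      case (elim t)
      show ?case
      proof (rule tendsto_eventually, cases "t \<in> A")
        case True
        with elim have "\<forall>\<^sub>F n in sequentially. t \<notin> B n" by blast
        then show "\<forall>\<^sub>F n in sequentially. indicator (B n) t *\<^sub>R \<psi> t = 0" by eventually_elim auto
      qed (simp add: \<psi>_def)
    qed
  qed (use i in \<open>auto simp: indicator_def\<close>)
  moreover have "(LINT t:B n|m. \<phi> t) = (LINT t|m. indicator (B n) t *\<^sub>R \<psi> t)" for n
    unfolding set_lebesgue_integral_def
    by (rule Bochner_Integration.integral_cong) (use B(2)[of n] in \<open>auto simp: \<psi>_def indicator_def\<close>)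
  ultimately show ?thesis by simp
qed

lemma set_integral_norm_mono:
  fixes \<phi> :: "'b \<Rightarrow> 'a::{banach,second_countable_topology}"
  assumes \<phi>: "set_integrable m B \<phi>" and A: "A \<in> sets m" "A \<subseteq> B"
  shows "norm (LINT t:A|m. \<phi> t) \<le> (LINT t:B|m. norm (\<phi> t))"
proof -
  have i: "set_integrable m A \<phi>" by (rule set_integrable_subset[OF \<phi> A])
  have "norm (LINT t:A|m. \<phi> t) \<le> (LINT t:A|m. norm (\<phi> t))" by (rule set_integral_norm_bound[OF i])
  also have "\<dots> \<le> (LINT t:B|m. norm (\<phi> t))"
    unfolding set_lebesgue_integral_def
    by (rule integral_mono[OF set_integrable_norm[OF i, unfolded set_integrable_def] set_integrable_norm[OF \<phi>, unfolded set_integrable_def]])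
       (use A(2) in \<open>auto simp: indicator_def\<close>)
  finally show ?thesis .
qed

lemma set_integral_vanish_left:
  fixes \<phi> :: "real \<Rightarrow> 'a::{banach,second_countable_topology}"
  assumes "set_integrable m {x..<y} \<phi>" "sets m = sets borel" "x < y"
  shows "((\<lambda>t. LINT s:{t..<y}|m. \<phi> s) \<longlongrightarrow> 0) (at_left y)"
proof (rule tendsto_at_left_sequentially[OF assms(3)])
  fix S assume S: "\<And>n. S n < y" "\<And>n. x < S n" "incseq S" "S \<longlonglongrightarrow> y"
  show "(\<lambda>n. LINT s:{S n..<y}|m. \<phi> s) \<longlonglongrightarrow> 0"
  proof (rule tendsto_set_integral_vanish[OF assms(1)])
    have "\<forall>\<^sub>F n in sequentially. t \<notin> {S n..<y}" if "t \<in> {x..<y}" for t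
      using order_tendstoD(1)[OF S(4), of t] that by (auto elim: eventually_mono)
    then show "AE t in m. t \<in> {x..<y} \<longrightarrow> (\<forall>\<^sub>F n in sequentially. t \<notin> {S n..<y})" by blast
    show "{S n..<y} \<subseteq> {x..<y}" for n using S(2)[of n] by auto
  qed (simp add: assms(2))
qed

text \<open>The interval is open at \<open>x\<close>, in contrast to the left-hand version: the atom
  at \<open>x\<close> does not disappear in the limit and becomes the jump in
  \<open>ac_on_right_limit\<close>.\<close>

lemma set_integral_vanish_right:
  fixes \<phi> :: "real \<Rightarrow> 'a::{banach,second_countable_topology}"
  assumes "set_integrable m {x..<y} \<phi>" "sets m = sets borel" "x < y"
  shows "((\<lambda>t. LINT s:{x<..<t}|m. \<phi> s) \<longlongrightarrow> 0) (at_right x)"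
proof (rule tendsto_at_right_sequentially[OF assms(3)])
  fix S assume S: "\<And>n. x < S n" "\<And>n. S n < y" "decseq S" "S \<longlonglongrightarrow> x"
  show "(\<lambda>n. LINT s:{x<..<S n}|m. \<phi> s) \<longlonglongrightarrow> 0"
  proof (rule tendsto_set_integral_vanish[OF assms(1)])
    have "\<forall>\<^sub>F n in sequentially. t \<notin> {x<..<S n}" if "x < t" for t
      using order_tendstoD(2)[OF S(4) that] by (auto elim: eventually_mono)
    then show "AE t in m. t \<in> {x..<y} \<longrightarrow> (\<forall>\<^sub>F n in sequentially. t \<notin> {x<..<S n})"
      by (intro AE_I2) force
    show "{x<..<S n} \<subseteq> {x..<y}" for n using S(2)[of n] by auto
  qed (simp add: assms(2))
qed

lemma ac_on_left_continuous:
  assumes f: "ac_on m J f \<phi>" and "sets m = sets borel" and xy: "x \<in> J" "y \<in> J" "x < y"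
  shows "(f \<longlongrightarrow> f y) (at_left y)"
proof -
  have "\<forall>\<^sub>F t in at_left y. f y - (LINT s:{t..<y}|m. \<phi> s) = f t"
  proof (rule eventually_at_leftI[OF _ xy(3)])
    fix t assume t: "t \<in> {x<..<y}"
    then show "f y - (LINT s:{t..<y}|m. \<phi> s) = f t"
      using ac_on_eq[OF f, of t y] ac_on_interval[OF f xy(1,2), of t] xy by auto
  qed
  moreover have "((\<lambda>t. f y - (LINT s:{t..<y}|m. \<phi> s)) \<longlongrightarrow> f y - 0) (at_left y)"
    by (intro tendsto_intros set_integral_vanish_left[OF ac_on_integrable[OF f xy(1,2)]] assms)
  ultimately show ?thesis by (simp add: tendsto_cong)
qed

lemma ac_on_bound:
  assumes f: "ac_on m J f \<phi>" and m: "sets m = sets borel" and xy: "x \<in> J" "y \<in> J" and t: "t \<in> {x..y}"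
  shows "norm (f t) \<le> norm (f x) + (LINT s:{x..<y}|m. norm (\<phi> s))"
proof -
  have tJ: "t \<in> J" using ac_on_interval[OF f xy, of t] t by auto
  have ft: "f t = f x + (LINT s:{x..<t}|m. \<phi> s)" using ac_on_eq[OF f xy(1) tJ] t by auto
  have "norm (LINT s:{x..<t}|m. \<phi> s) \<le> (LINT s:{x..<y}|m. norm (\<phi> s))"
    by (rule set_integral_norm_mono[OF ac_on_integrable[OF f xy]]) (use t m in auto)
  then show ?thesis unfolding ft using norm_triangle_ineq by (smt (verit))
qed

context borel_sigma_finite
begin

text \<open>Needed because (H5) prescribes a limit from the right at the upper end of a gap, where a
  left-continuous function may jump.\<close>

lemma ac_on_right_limit:
  assumes f: "ac_on m J f \<phi>" and xy: "x \<in> J" "y \<in> J" "x < y"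
  shows "(f \<longlongrightarrow> f x + \<phi> x * of_real (measure m {x})) (at_right x)"
proof -
  have at: "(LINT t:{x}|m. \<phi> t) = \<phi> x * of_real (measure m {x})"
  proof -
    have "(LINT t:{x}|m. \<phi> t) = (LINT t|m. indicator {x} t *\<^sub>R \<phi> x)"
      unfolding set_lebesgue_integral_def by (intro Bochner_Integration.integral_cong) (auto simp: indicator_def)
    also have "\<dots> = (LINT t|m. indicator {x} t) *\<^sub>R \<phi> x"
      by (rule integral_scaleR_left) (rule integrable_real_indicator[OF _ emeasure_singleton_finite], simp)
    finally show ?thesis by (simp add: scaleR_conv_of_real mult.commute)
  qed
  have "\<forall>\<^sub>F t in at_right x. f x + \<phi> x * of_real (measure m {x}) + (LINT s:{x<..<t}|m. \<phi> s) = f t"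
  proof (rule eventually_at_rightI[OF _ xy(3)])
    fix t assume t: "t \<in> {x<..<y}"
    then have tJ: "t \<in> J" using ac_on_interval[OF f xy(1,2), of t] by auto
    have e: "{x..<t} = {x} \<union> {x<..<t}" using t by auto
    note i = ac_on_integrable[OF f xy(1) tJ]
    have "(LINT s:{x..<t}|m. \<phi> s) = (LINT s:{x}|m. \<phi> s) + (LINT s:{x<..<t}|m. \<phi> s)"
      unfolding e by (rule set_integral_Un)
        (use i t in \<open>auto intro!: set_integrable_subset[OF i]\<close>)
    then show "f x + \<phi> x * of_real (measure m {x}) + (LINT s:{x<..<t}|m. \<phi> s) = f t"
      using ac_on_eq[OF f xy(1) tJ] t at by simp
  qed
  moreover have "((\<lambda>t. f x + \<phi> x * of_real (measure m {x}) + (LINT s:{x<..<t}|m. \<phi> s))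
      \<longlongrightarrow> f x + \<phi> x * of_real (measure m {x}) + 0) (at_right x)"
    by (intro tendsto_intros set_integral_vanish_right[OF ac_on_integrable[OF f xy(1,2)]] sets_m xy(3))
  ultimately show ?thesis by (simp add: tendsto_cong)
qed

lemma emeasure_density_singleton:
  assumes "d \<in> borel_measurable borel"
  shows "emeasure (density m (\<lambda>x. ennreal (d x))) {t} = ennreal (d t) * emeasure m {t}"
proof -
  have "emeasure (density m (\<lambda>x. ennreal (d x))) {t} = (\<integral>\<^sup>+x. ennreal (d x) * indicator {t} x \<partial>m)"
    by (rule emeasure_density) (use assms in auto)
  also have "\<dots> = (\<integral>\<^sup>+x. ennreal (d t) * indicator {t} x \<partial>m)"
    by (rule nn_integral_cong) (auto simp: indicator_def)
  finally show ?thesis by (simp add: nn_integral_cmult_indicator)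
qed

lemma primitive_measurable:
  fixes \<phi> :: "real \<Rightarrow> 'a::{banach,second_countable_topology}"
  assumes "integrable m \<phi>"
  shows "(\<lambda>t. LINT s:{..<t}|m. \<phi> s) \<in> borel_measurable borel"
proof -
  have [measurable]: "\<phi> \<in> borel_measurable m" using assms by auto
  have "(\<lambda>t. LINT s|m. (case (t, s) of (t, s) \<Rightarrow> indicator {u. snd u < fst u} (t, s) *\<^sub>R \<phi> s)) \<in> borel_measurable borel"
    by (rule borel_measurable_lebesgue_integral) measurable
  moreover have "(indicator {u. snd u < fst u} (t, s) :: real) = indicator {..<t} s" for t s :: real
    by (auto simp: indicator_def)
  ultimately show ?thesis by (simp add: set_lebesgue_integral_def)
qed

text \<open>The cut-off is essential, since nothing is known about \<open>f\<close> outside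
  \<open>J\<close>.\<close>

lemma ac_on_measurable:
  assumes f: "ac_on m J f \<phi>" and xy: "x \<in> J" "y \<in> J"
  shows "(\<lambda>t. indicator {x..<y} t *\<^sub>R f t) \<in> borel_measurable borel"
proof -
  define \<phi>0 where "\<phi>0 = (\<lambda>t. indicator {x..<y} t *\<^sub>R \<phi> t)"
  have i: "integrable m \<phi>0" using ac_on_integrable[OF f xy] by (simp add: \<phi>0_def set_integrable_def)
  note [measurable] = primitive_measurable[OF i]
  have "indicator {x..<y} t *\<^sub>R f t = indicator {x..<y} t *\<^sub>R (f x + (LINT s:{..<t}|m. \<phi>0 s))" for t
  proof (cases "t \<in> {x..<y}")
    case True
    have "(LINT s:{..<t}|m. \<phi>0 s) = (LINT s:{x..<t}|m. \<phi> s)"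
      unfolding set_lebesgue_integral_def \<phi>0_def
      by (rule Bochner_Integration.integral_cong) (use True in \<open>auto simp: indicator_def\<close>)
    then show ?thesis using ac_on_eq[OF f xy(1), of t] ac_on_interval[OF f xy, of t] True by auto
  qed auto
  then have "(\<lambda>t. indicator {x..<y} t *\<^sub>R f t) = (\<lambda>t. indicator {x..<y} t *\<^sub>R (f x + (LINT s:{..<t}|m. \<phi>0 s)))" by auto
  also have "\<dots> \<in> borel_measurable borel" by measurable
  finally show ?thesis .
qed

text \<open>On \<open>{x..<y}\<close> the function \<open>f\<close> is bounded by its value at
  \<open>x\<close> plus its variation. The measure \<open>M\<close> may differ from
  \<open>m\<close>, so the lemma also serves integrals against \<rho>, \<sigma> and \<chi>.\<close>

lemma set_integrable_mult_ac_on: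
  assumes f: "ac_on m J f \<phi>" and xy: "x \<in> J" "y \<in> J" and k: "set_integrable M {x..<y} k"
    and M: "sets M = sets borel"
  shows "set_integrable M {x..<y} (\<lambda>t. f t * k t)"
proof -
  note [measurable] = ac_on_measurable[OF f xy] borel_measurable_integrable[OF k[unfolded set_integrable_def]]
  note [measurable_cong] = M
  define C where "C = norm (f x) + (LINT s:{x..<y}|m. norm (\<phi> s))"
  have "set_integrable M {x..<y} (\<lambda>t. C *\<^sub>R k t)" using k by simp
  then show ?thesis
  proof (rule set_integrable_bound)
    have "(\<lambda>t. indicator {x..<y} t *\<^sub>R (f t * k t)) = (\<lambda>t. (indicator {x..<y} t *\<^sub>R f t) * (indicator {x..<y} t *\<^sub>R k t))"
      by (auto simp: indicator_def)
    also have "\<dots> \<in> borel_measurable M" by (intro borel_measurable_times) measurable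
    finally show "set_borel_measurable M {x..<y} (\<lambda>t. f t * k t)"
      unfolding set_borel_measurable_def .
    have "norm (f t) \<le> \<bar>C\<bar>" if "t \<in> {x..<y}" for t
      using ac_on_bound[OF f sets_m xy, of t] that by (auto simp: C_def)
    then show "AE t in M. t \<in> {x..<y} \<longrightarrow> norm (f t * k t) \<le> norm (C *\<^sub>R k t)"
      by (auto simp: norm_mult intro!: mult_right_mono)
  qed
qed

lemma ac_on_primitive:
  assumes J: "is_interval J" "\<alpha> \<in> J" "J \<subseteq> {\<alpha>..}"
    and i: "\<And>x. x \<in> J \<Longrightarrow> set_integrable m {\<alpha>..<x} \<phi>"
  shows "ac_on m J (\<lambda>x. k + (LINT t:{\<alpha>..<x}|m. \<phi> t)) \<phi>"
proof (rule ac_onI[OF J(1)])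
  fix x y assume xy: "x \<in> J" "y \<in> J" "x \<le> y"
  have ax: "\<alpha> \<le> x" using J xy by auto
  show i': "set_integrable m {x..<y} \<phi>" by (rule set_integrable_subset[OF i[OF xy(2)]]) (use ax in auto)
  have e: "{\<alpha>..<y} = {\<alpha>..<x} \<union> {x..<y}" using ax xy by auto
  show "k + (LINT t:{\<alpha>..<y}|m. \<phi> t) = k + (LINT t:{\<alpha>..<x}|m. \<phi> t) + (LINT t:{x..<y}|m. \<phi> t)"
    unfolding e by (subst set_integral_Un) (use i[OF xy(1)] i' in auto)
qed

end

lemma set_integrable_of_real: "set_integrable m A f \<Longrightarrow> set_integrable m A (\<lambda>t. complex_of_real (f t))"
  unfolding set_integrable_def by (drule integrable_of_real[where 'a=complex]) (simp add: scaleR_conv_of_real)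

section \<open>First order systems with measure coefficients\<close>

text \<open>\<open>sq_atom\<close> and \<open>sr_atom\<close> are (H4) for densities. The first
  makes the transfer matrix across each atom unimodular; together they remove the jump terms from
  the derivative of a Wronskian.\<close>

locale measure_system = borel_sigma_finite m for m +
  fixes I :: "real set" and s q r :: "real \<Rightarrow> real"
  assumes I: "is_interval I"
    and meas [measurable]: "s \<in> borel_measurable borel" "q \<in> borel_measurable borel" "r \<in> borel_measurable borel"
    and loc_s: "\<And>x y. x \<in> I \<Longrightarrow> y \<in> I \<Longrightarrow> set_integrable m {x..<y} s"
    and loc_q: "\<And>x y. x \<in> I \<Longrightarrow> y \<in> I \<Longrightarrow> set_integrable m {x..<y} q"
    and r_nonneg: "\<And>x. 0 \<le> r x"
    and sq_atom: "\<And>t. t \<in> I \<Longrightarrow> s t * q t * measure m {t} = 0"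
    and sr_atom: "\<And>t. t \<in> I \<Longrightarrow> s t * r t * measure m {t} = 0"
begin

text \<open>The quasi-derivative \<open>f1\<close> is a separate argument, so that linear
  combinations, conjugates and restrictions need no uniqueness; \<open>quasi_unique\<close> later
  shows that \<open>f\<close> determines it when \<sigma> has full support.\<close>

definition solves :: "real set \<Rightarrow> cfun \<Rightarrow> cfun \<Rightarrow> cfun \<Rightarrow> bool" where
  "solves J f f1 g \<longleftrightarrow> ac_on m J f (\<lambda>t. of_real (s t) * f1 t) \<and>
     ac_on m J f1 (\<lambda>t. of_real (q t) * f t - of_real (r t) * g t)"

lemma solvesD1: "solves J f f1 g \<Longrightarrow> ac_on m J f (\<lambda>t. of_real (s t) * f1 t)"
  and solvesD2: "solves J f f1 g \<Longrightarrow> ac_on m J f1 (\<lambda>t. of_real (q t) * f t - of_real (r t) * g t)"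
  by (simp_all add: solves_def)

lemma solves_subset: "solves J f f1 g \<Longrightarrow> J' \<subseteq> J \<Longrightarrow> is_interval J' \<Longrightarrow> solves J' f f1 g"
  unfolding solves_def by (blast intro: ac_on_subset)

lemma solves_cong:
  assumes f: "solves J f f1 g" and "\<And>x. x \<in> J \<Longrightarrow> f x = h x" "\<And>x. x \<in> J \<Longrightarrow> f1 x = h1 x"
    "\<And>x. x \<in> J \<Longrightarrow> g x = k x"
  shows "solves J h h1 k"
  unfolding solves_def
  by (intro conjI ac_on_cong[OF solvesD1[OF f]] ac_on_cong[OF solvesD2[OF f]])
     (use assms(2-) in auto)

lemma solves_comb:
  assumes f: "solves J f f1 g" and h: "solves J h h1 k"
  shows "solves J (\<lambda>x. \<alpha> * f x + \<beta> * h x) (\<lambda>x. \<alpha> * f1 x + \<beta> * h1 x) (\<lambda>x. \<alpha> * g x + \<beta> * k x)"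
  unfolding solves_def
proof
  show "ac_on m J (\<lambda>x. \<alpha> * f x + \<beta> * h x) (\<lambda>t. of_real (s t) * (\<alpha> * f1 t + \<beta> * h1 t))"
    by (rule ac_on_cong[OF ac_on_add[OF ac_on_cmult[OF solvesD1[OF f], of \<alpha>] ac_on_cmult[OF solvesD1[OF h], of \<beta>]]])
       (auto simp: algebra_simps)
  show "ac_on m J (\<lambda>x. \<alpha> * f1 x + \<beta> * h1 x)
     (\<lambda>t. of_real (q t) * (\<alpha> * f t + \<beta> * h t) - of_real (r t) * (\<alpha> * g t + \<beta> * k t))"
    by (rule ac_on_cong[OF ac_on_add[OF ac_on_cmult[OF solvesD2[OF f], of \<alpha>] ac_on_cmult[OF solvesD2[OF h], of \<beta>]]])
       (auto simp: algebra_simps)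
qed

lemma solves_cnj:
  assumes f: "solves J f f1 g"
  shows "solves J (\<lambda>x. cnj (f x)) (\<lambda>x. cnj (f1 x)) (\<lambda>x. cnj (g x))"
  unfolding solves_def
  by (intro conjI ac_on_cong[OF ac_on_cnj[OF solvesD1[OF f]]] ac_on_cong[OF ac_on_cnj[OF solvesD2[OF f]]]) simp_all

text \<open>Each jump term pairs \<open>s\<close> with \<open>q\<close> or with \<open>r\<close> and
  vanishes. Of the remaining terms, those with \<open>s * f1 * h1\<close> and
  \<open>q * f * h\<close> cancel between the two products.\<close>

lemma solves_wronskian:
  assumes "J \<subseteq> I" and f: "solves J f f1 g" and h: "solves J h h1 k"
  shows "ac_on m J (\<lambda>x. f x * h1 x - f1 x * h x) (\<lambda>t. of_real (r t) * (h t * g t - f t * k t))"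
proof -
  note f' = solvesD1[OF f] solvesD2[OF f] and h' = solvesD1[OF h] solvesD2[OF h]
  have at: "s t = 0 \<or> measure m {t} = 0 \<or> q t = 0 \<and> r t = 0" if "t \<in> J" for t
    using sq_atom[of t] sr_atom[of t] that assms(1) by auto
  have "ac_on m J (\<lambda>x. f x * h1 x) (\<lambda>t. f t * (of_real (q t) * h t - of_real (r t) * k t) + h1 t * (of_real (s t) * f1 t))"
    by (rule ac_on_mult_no_common_atoms[OF f'(1) h'(2)]) (use at in fastforce)
  moreover have "ac_on m J (\<lambda>x. f1 x * h x) (\<lambda>t. f1 t * (of_real (s t) * h1 t) + h t * (of_real (q t) * f t - of_real (r t) * g t))"
    by (rule ac_on_mult_no_common_atoms[OF f'(2) h'(1)]) (use at in fastforce)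
  ultimately show ?thesis
    by (rule ac_on_cong[OF ac_on_diff]) (auto simp: algebra_simps)
qed

lemma wronskian_const:
  assumes "J \<subseteq> I" and f: "solves J f f1 (\<lambda>_. 0)" and h: "solves J h h1 (\<lambda>_. 0)" and xy: "x \<in> J" "y \<in> J"
  shows "f x * h1 x - f1 x * h x = f y * h1 y - f1 y * h y"
proof -
  have *: "f y * h1 y - f1 y * h y = f x * h1 x - f1 x * h x" if "x \<in> J" "y \<in> J" "x \<le> y" for x y
    using ac_on_eq[OF solves_wronskian[OF assms(1) f h] that] by simp
  show ?thesis using *[OF xy] *[OF xy(2,1)] by (cases "x \<le> y") auto
qed

section \<open>Picard iteration to the right of a starting point\<close>

context
  fixes \<alpha> :: real and y0 y1 :: complex
begin

primrec picard :: "nat \<Rightarrow> cfun \<times> cfun" where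
  "picard 0 = ((\<lambda>_. y0), (\<lambda>_. y1))"
| "picard (Suc n) = ((\<lambda>x. LINT t:{\<alpha>..<x}|m. of_real (s t) * snd (picard n) t),
                     (\<lambda>x. LINT t:{\<alpha>..<x}|m. of_real (q t) * fst (picard n) t))"

text \<open>An iterated integral of \<open>\<bar>s\<bar> + \<bar>q\<bar>\<close> over strictly
  ordered tuples in \<open>{\<alpha>..<x}\<close>. Without atoms it would equal
  \<open>majorant 1 x ^ n / fact n\<close>; with atoms this is only an upper bound, as the diagonals
  are missing.\<close>

primrec majorant :: "nat \<Rightarrow> real \<Rightarrow> real" where
  "majorant 0 = (\<lambda>_. 1)"
| "majorant (Suc n) = (\<lambda>x. LINT t:{\<alpha>..<x}|m. (\<bar>s t\<bar> + \<bar>q t\<bar>) * majorant n t)"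

context
  assumes \<alpha>: "\<alpha> \<in> I"
begin

definition "ray = I \<inter> {\<alpha>..}"

lemma ray: "is_interval ray" "\<alpha> \<in> ray" "ray \<subseteq> {\<alpha>..}" "ray \<subseteq> I"
  using I \<alpha> by (auto simp: ray_def is_interval_Int is_interval_ci)

lemma ac_primitive0:
  fixes \<phi> :: "real \<Rightarrow> 'a::{real_normed_field,banach,second_countable_topology}"
  assumes "\<And>x. x \<in> ray \<Longrightarrow> set_integrable m {\<alpha>..<x} \<phi>"
  shows "ac_on m ray (\<lambda>x. (LINT t:{\<alpha>..<x}|m. \<phi> t)) \<phi>"
  using ac_on_primitive[OF ray(1-3) assms, where k=0] by simp

lemma loc_sq: "x \<in> ray \<Longrightarrow> set_integrable m {\<alpha>..<x} (\<lambda>t. \<bar>s t\<bar> + \<bar>q t\<bar>)"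
  using loc_s[of \<alpha> x] loc_q[of \<alpha> x] \<alpha> ray by (intro set_integral_add set_integrable_abs) auto

lemma ac_majorant: "ac_on m ray (majorant (Suc n)) (\<lambda>t. (\<bar>s t\<bar> + \<bar>q t\<bar>) * majorant n t)"
proof (induction n)
  case 0
  show ?case unfolding majorant.simps by (rule ac_primitive0) (use loc_sq in simp)
next
  case (Suc n)
  show ?case
    unfolding majorant.simps(2)[of "Suc n"]
    by (rule ac_primitive0) (use set_integrable_mult_ac_on[OF Suc ray(2) _ loc_sq sets_m] in \<open>simp add: mult.commute del: majorant.simps\<close>)
qed

lemma int_majorant: "x \<in> ray \<Longrightarrow> set_integrable m {\<alpha>..<x} (\<lambda>t. (\<bar>s t\<bar> + \<bar>q t\<bar>) * majorant n t)"
  by (rule ac_on_integrable[OF ac_majorant ray(2)])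

lemma majorant_nonneg: "0 \<le> majorant n x"
  by (induction n arbitrary: x) (auto simp: set_lebesgue_integral_def intro!: Bochner_Integration.integral_nonneg)

text \<open>Integrating the product rule for \<open>I\<^sub>1 I\<^sub>n\<close> and dropping the nonnegative jump terms yields the
  factorial decay that makes the Picard series converge, in spite of the atoms of the measure.\<close>
lemma majorant_mult: "x \<in> ray \<Longrightarrow> (real n + 1) * majorant (Suc n) x \<le> majorant 1 x * majorant n x"
proof (induction n arbitrary: x)
  case 0 show ?case by simp
next
  case (Suc n)
  define k where "k = (\<lambda>t. \<bar>s t\<bar> + \<bar>q t\<bar>)"
  define R where "R = (\<lambda>t. majorant (Suc 0) t * (k t * majorant n t) + majorant (Suc n) t * (k t * majorant 0 t)
     + (k t * majorant 0 t) * (k t * majorant n t) * of_real (measure m {t}))"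
  have ac: "ac_on m ray (\<lambda>x. majorant (Suc 0) x * majorant (Suc n) x) R"
    unfolding R_def k_def by (rule ac_on_mult[OF ac_majorant ac_majorant])
  have z: "majorant (Suc 0) \<alpha> = 0" by (simp add: set_lebesgue_integral_def)
  have k: "0 \<le> k t" for t by (simp add: k_def)
  have "(real (Suc n) + 1) * majorant (Suc (Suc n)) x = (LINT t:{\<alpha>..<x}|m. (real n + 2) * (k t * majorant (Suc n) t))"
    unfolding majorant.simps(2)[of "Suc n"] by (simp del: majorant.simps add: k_def add.commute)
  also have "\<dots> \<le> (LINT t:{\<alpha>..<x}|m. R t)"
  proof (rule set_integral_mono)
    show "set_integrable m {\<alpha>..<x} (\<lambda>t. (real n + 2) * (k t * majorant (Suc n) t))"
      unfolding k_def by (intro set_integrable_mult_right int_majorant Suc.prems)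
    show "set_integrable m {\<alpha>..<x} R" by (rule ac_on_integrable[OF ac ray(2) Suc.prems])
    fix t assume t: "t \<in> {\<alpha>..<x}"
    then have "t \<in> ray" using ac_on_interval[OF ac ray(2) Suc.prems, of t] by auto
    \<comment> \<open>Here n + 2 is split as 1 + (n + 1): one copy of
      \<open>k t * majorant (Suc n) t\<close> is the second summand of \<open>R\<close>, because
      \<open>majorant 0\<close> is 1, and the induction hypothesis absorbs the other n + 1 copies
      into the first summand.\<close>
    from mult_left_mono[OF Suc.IH[OF this] k[of t]]
    have "k t * ((real n + 1) * majorant (Suc n) t) \<le> k t * (majorant 1 t * majorant n t)" .
    moreover have "0 \<le> (k t * majorant 0 t) * (k t * majorant n t) * measure m {t}"
      using k[of t] majorant_nonneg[of n t] by simp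
    ultimately show "(real n + 2) * (k t * majorant (Suc n) t) \<le> R t"
      by (simp add: R_def algebra_simps del: majorant.simps(2))
  qed
  also have "\<dots> = majorant (Suc 0) x * majorant (Suc n) x"
    using ac_on_eq[OF ac ray(2) Suc.prems] ray(3) Suc.prems z by (auto simp del: majorant.simps)
  finally show ?case by simp
qed

lemma majorant_le: "x \<in> ray \<Longrightarrow> majorant n x \<le> majorant 1 x ^ n / fact n"
proof (induction n)
  case 0 show ?case by simp
next
  case (Suc n)
  have "majorant (Suc n) x \<le> majorant 1 x * majorant n x / (real n + 1)"
    using majorant_mult[OF Suc.prems, of n] by (simp add: field_simps del: majorant.simps)
  also have "\<dots> \<le> majorant 1 x * (majorant 1 x ^ n / fact n) / (real n + 1)"
    using Suc majorant_nonneg[of 1 x] by (intro divide_right_mono mult_left_mono) (auto simp del: majorant.simps)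
  also have "\<dots> = majorant 1 x ^ Suc n / fact (Suc n)" by (simp add: field_simps)
  finally show ?case .
qed

lemma summable_majorant: "x \<in> ray \<Longrightarrow> summable (\<lambda>n. majorant n x)"
  by (rule summable_comparison_test'[OF summable_exp[of "majorant 1 x"]])
     (use majorant_nonneg majorant_le in \<open>auto simp: field_simps simp del: majorant.simps\<close>)

lemma ac_picard:
  "ac_on m ray (fst (picard (Suc n))) (\<lambda>t. of_real (s t) * snd (picard n) t) \<and>
   ac_on m ray (snd (picard (Suc n))) (\<lambda>t. of_real (q t) * fst (picard n) t)"
proof (induction n)
  case 0
  show ?case unfolding picard.simps fst_conv snd_conv
    by (intro conjI ac_primitive0 set_integrable_mult_left set_integrable_of_real loc_s loc_q)
       (use ray(4) \<alpha> in auto)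
next
  case (Suc n)
  have i: "x \<in> ray \<Longrightarrow> set_integrable m {\<alpha>..<x} (\<lambda>t. complex_of_real (s t))"
    "x \<in> ray \<Longrightarrow> set_integrable m {\<alpha>..<x} (\<lambda>t. complex_of_real (q t))" for x
    using loc_s[of \<alpha>] loc_q[of \<alpha>] ray(4) \<alpha> by (auto intro!: set_integrable_of_real)
  show ?case
    unfolding picard.simps(2)[of "Suc n"] fst_conv snd_conv
    using set_integrable_mult_ac_on[OF conjunct1[OF Suc] ray(2) _ i(2) sets_m]
      set_integrable_mult_ac_on[OF conjunct2[OF Suc] ray(2) _ i(1) sets_m]
    by (auto intro!: ac_primitive0 simp: mult.commute simp del: picard.simps)
qed

lemma norm_picard:
  "x \<in> ray \<Longrightarrow> norm (fst (picard n) x) \<le> (norm y0 + norm y1) * majorant n x \<and>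
    norm (snd (picard n) x) \<le> (norm y0 + norm y1) * majorant n x"
proof (induction n arbitrary: x)
  case 0 show ?case by simp
next
  case (Suc n)
  define C where "C = norm y0 + norm y1"
  have C: "0 \<le> C" by (simp add: C_def)
  have *: "norm (LINT t:{\<alpha>..<x}|m. of_real (p t) * h t) \<le> C * majorant (Suc n) x"
    if i: "set_integrable m {\<alpha>..<x} (\<lambda>t. of_real (p t) * h t)" and h: "\<And>t. t \<in> ray \<Longrightarrow> norm (h t) \<le> C * majorant n t"
      and p: "\<And>t. \<bar>p t\<bar> \<le> \<bar>s t\<bar> + \<bar>q t\<bar>" for p :: "real \<Rightarrow> real" and h :: cfun
  proof -
    have "norm (LINT t:{\<alpha>..<x}|m. of_real (p t) * h t) \<le> (LINT t:{\<alpha>..<x}|m. norm (of_real (p t) * h t))"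
      by (rule set_integral_norm_bound[OF i])
    also have "\<dots> \<le> (LINT t:{\<alpha>..<x}|m. C * ((\<bar>s t\<bar> + \<bar>q t\<bar>) * majorant n t))"
    proof (rule set_integral_mono)
      show "set_integrable m {\<alpha>..<x} (\<lambda>t. norm (of_real (p t) * h t))" by (rule set_integrable_norm[OF i])
      show "set_integrable m {\<alpha>..<x} (\<lambda>t. C * ((\<bar>s t\<bar> + \<bar>q t\<bar>) * majorant n t))"
        by (intro set_integrable_mult_right int_majorant Suc.prems)
      fix t assume "t \<in> {\<alpha>..<x}"
      then have "t \<in> ray" using ac_on_interval[OF ac_majorant ray(2) Suc.prems, of t] by auto
      then have "\<bar>p t\<bar> * norm (h t) \<le> (\<bar>s t\<bar> + \<bar>q t\<bar>) * (C * majorant n t)"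
        using h p by (intro mult_mono) auto
      then show "norm (of_real (p t) * h t) \<le> C * ((\<bar>s t\<bar> + \<bar>q t\<bar>) * majorant n t)"
        by (simp add: norm_mult algebra_simps)
    qed
    finally show ?thesis by simp
  qed
  have i: "set_integrable m {\<alpha>..<x} (\<lambda>t. of_real (s t) * snd (picard n) t)"
    "set_integrable m {\<alpha>..<x} (\<lambda>t. of_real (q t) * fst (picard n) t)"
    using ac_on_integrable[OF conjunct1[OF ac_picard] ray(2) Suc.prems]
      ac_on_integrable[OF conjunct2[OF ac_picard] ray(2) Suc.prems] by auto
  show ?case
    unfolding picard.simps fst_conv snd_conv C_def[symmetric]
    using *[OF i(1)] *[OF i(2)] Suc.IH[folded C_def] by (auto simp del: majorant.simps)
qed

lemma forward_solution:
  "\<exists>u v. solves ray u v (\<lambda>_. 0) \<and> u \<alpha> = y0 \<and> v \<alpha> = y1"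
proof -
  define C where "C = norm y0 + norm y1"
  define u where "u = (\<lambda>x. \<Sum>n. fst (picard n) x)"
  define v where "v = (\<lambda>x. \<Sum>n. snd (picard n) x)"
  have sum: "summable (\<lambda>n. norm (fst (picard n) x))" "summable (\<lambda>n. norm (snd (picard n) x))" if "x \<in> ray" for x
    by (rule summable_comparison_test'[OF summable_mult[OF summable_majorant[OF that], of C], of 0];
        use norm_picard[OF that] in \<open>auto simp: C_def\<close>)+
  \<comment> \<open>Both components satisfy the same fixed point identity: \<open>p\<close> is
    \<open>s\<close> or \<open>q\<close>, and \<open>w\<close> and \<open>h\<close> are the iterates
    of this and of the other component. Sum and integral may be exchanged because the integrals of
    the norms are at most \<open>C * majorant (Suc n) x\<close>, which is summable.\<close>
  have key: "set_integrable m {\<alpha>..<x} (\<lambda>t. of_real (p t) * (\<Sum>n. h n t)) \<and>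
      (\<Sum>n. w n x) = w 0 x + (LINT t:{\<alpha>..<x}|m. of_real (p t) * (\<Sum>n. h n t))"
    if x: "x \<in> ray" and i: "\<And>n. set_integrable m {\<alpha>..<x} (\<lambda>t. of_real (p t) * h n t)"
      and h: "\<And>n t. t \<in> ray \<Longrightarrow> norm (h n t) \<le> C * majorant n t"
      and p: "\<And>t. \<bar>p t\<bar> \<le> \<bar>s t\<bar> + \<bar>q t\<bar>" and sw: "summable (\<lambda>n. norm (w n x))"
      and w: "\<And>n. w (Suc n) x = (LINT t:{\<alpha>..<x}|m. of_real (p t) * h n t)"
    for p :: "real \<Rightarrow> real" and h w :: "nat \<Rightarrow> cfun" and x
  proof -
    define H where "H = (\<lambda>n t. indicator {\<alpha>..<x} t *\<^sub>R (of_real (p t) * h n t))"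
    have tJ: "t \<in> ray" if "t \<in> {\<alpha>..<x}" for t
      using ac_on_interval[OF ac_majorant ray(2) x, of t] that by auto
    have sh: "summable (\<lambda>n. norm (h n t))" if "t \<in> ray" for t
      by (rule summable_comparison_test'[OF summable_mult[OF summable_majorant[OF that], of C], of 0])
         (use h[OF that] in auto)
    have HS: "summable (\<lambda>n. norm (H n t))" for t
      using sh[OF tJ, of t] by (cases "t \<in> {\<alpha>..<x}") (auto simp: H_def norm_mult intro: summable_mult)
    have HE: "(\<Sum>n. H n t) = indicator {\<alpha>..<x} t *\<^sub>R (of_real (p t) * (\<Sum>n. h n t))" for t
      using summable_norm_cancel[OF sh[OF tJ, of t]]
      by (cases "t \<in> {\<alpha>..<x}") (auto simp: H_def suminf_mult)
    have Hi: "integrable m (H n)" for n using i[of n] by (simp add: H_def set_integrable_def)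
    have Hb: "(LINT t|m. norm (H n t)) \<le> C * majorant (Suc n) x" for n
    proof -
      have "(LINT t|m. norm (H n t)) \<le> (LINT t:{\<alpha>..<x}|m. C * ((\<bar>s t\<bar> + \<bar>q t\<bar>) * majorant n t))"
        unfolding set_lebesgue_integral_def
      proof (rule integral_mono)
        show "integrable m (\<lambda>t. norm (H n t))" using Hi by auto
        show "integrable m (\<lambda>t. indicator {\<alpha>..<x} t *\<^sub>R (C * ((\<bar>s t\<bar> + \<bar>q t\<bar>) * majorant n t)))"
          using set_integrable_mult_right[OF int_majorant[OF x]] by (auto simp: set_integrable_def)
        fix t
        have "\<bar>p t\<bar> * norm (h n t) \<le> (\<bar>s t\<bar> + \<bar>q t\<bar>) * (C * majorant n t)" if "t \<in> {\<alpha>..<x}"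
          using h[OF tJ[OF that]] p by (intro mult_mono) auto
        then show "norm (H n t) \<le> indicator {\<alpha>..<x} t *\<^sub>R (C * ((\<bar>s t\<bar> + \<bar>q t\<bar>) * majorant n t))"
          by (cases "t \<in> {\<alpha>..<x}") (auto simp: H_def norm_mult algebra_simps)
      qed
      then show ?thesis by simp
    qed
    have S: "summable (\<lambda>n. LINT t|m. norm (H n t))"
    proof (rule summable_comparison_test'[where N=0])
      show "summable (\<lambda>n. C * majorant (Suc n) x)"
        using summable_majorant[OF x] by (intro summable_mult) (rule summable_Suc_iff[THEN iffD2])
      show "norm (LINT t|m. norm (H n t)) \<le> C * majorant (Suc n) x" for n
        using Hb[of n] by simp
    qed
    have iS: "integrable m (\<lambda>t. \<Sum>n. H n t)" by (rule integrable_suminf[OF Hi _ S]) (use HS in auto)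
    have "(\<lambda>n. LINT t|m. H n t) sums (LINT t|m. (\<Sum>n. H n t))"
      by (rule sums_integral[OF Hi _ S]) (use HS in auto)
    moreover have ws: "w (Suc n) x = (LINT t|m. H n t)" for n
      by (simp add: w set_lebesgue_integral_def H_def)
    ultimately have "(\<Sum>n. w (Suc n) x) = (LINT t|m. (\<Sum>n. H n t))"
      by (simp add: ws sums_iff del: mult_scaleR_right)
    moreover have "(\<Sum>n. w n x) = w 0 x + (\<Sum>n. w (Suc n) x)"
      using suminf_split_head[OF summable_norm_cancel[OF sw]] by simp
    ultimately show ?thesis using iS by (simp add: HE set_integrable_def set_lebesgue_integral_def)
  qed
  have pi: "set_integrable m {\<alpha>..<x} (\<lambda>t. of_real (s t) * snd (picard n) t)"
    "set_integrable m {\<alpha>..<x} (\<lambda>t. of_real (q t) * fst (picard n) t)" if "x \<in> ray" for n x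
    using ac_on_integrable[OF conjunct1[OF ac_picard] ray(2) that]
      ac_on_integrable[OF conjunct2[OF ac_picard] ray(2) that] by auto
  have U: "set_integrable m {\<alpha>..<x} (\<lambda>t. of_real (s t) * v t)" "u x = y0 + (LINT t:{\<alpha>..<x}|m. of_real (s t) * v t)"
    if "x \<in> ray" for x
    using key[OF that, of s "\<lambda>n. snd (picard n)" "\<lambda>n. fst (picard n)"] pi[OF that] sum[OF that] norm_picard[folded C_def]
    by (simp_all add: u_def v_def)
  have V: "set_integrable m {\<alpha>..<x} (\<lambda>t. of_real (q t) * u t)" "v x = y1 + (LINT t:{\<alpha>..<x}|m. of_real (q t) * u t)"
    if "x \<in> ray" for x
    using key[OF that, of q "\<lambda>n. fst (picard n)" "\<lambda>n. snd (picard n)"] pi[OF that] sum[OF that] norm_picard[folded C_def]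
    by (simp_all add: u_def v_def)
  have "ac_on m ray u (\<lambda>t. of_real (s t) * v t)"
    by (rule ac_on_cong[OF ac_on_primitive[OF ray(1-3) U(1), where k=y0]]) (use U(2) in auto)
  moreover have "ac_on m ray v (\<lambda>t. of_real (q t) * u t)"
    by (rule ac_on_cong[OF ac_on_primitive[OF ray(1-3) V(1), where k=y1]]) (use V(2) in auto)
  moreover have "u \<alpha> = y0" "v \<alpha> = y1" using U(2)[OF ray(2)] V(2)[OF ray(2)] by (auto simp: set_lebesgue_integral_def)
  ultimately show ?thesis by (auto simp: solves_def)
qed

end

end

end

section \<open>Global solutions and uniqueness\<close>

context measure_system
begin

text \<open>The initial data (1,0) and (0,1) give Wronskian 1 at \<alpha>, and constancy carries it
  to all of \<open>J\<close>. This invertibility at every later point takes the place of solving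
  backwards.\<close>

lemma forward_fundamental_system:
  assumes "\<alpha> \<in> I" "J \<subseteq> I" "is_interval J" "J \<subseteq> {\<alpha>..}"
  shows "\<exists>u u1 w w1. solves J u u1 (\<lambda>_. 0) \<and> solves J w w1 (\<lambda>_. 0) \<and> (\<forall>x\<in>J. u x * w1 x - u1 x * w x = 1)"
proof -
  note J = ray[OF assms(1)]
  obtain u u1 where u: "solves (ray \<alpha>) u u1 (\<lambda>_. 0)" "u \<alpha> = 1" "u1 \<alpha> = 0"
    using forward_solution[OF assms(1)] by metis
  obtain w w1 where w: "solves (ray \<alpha>) w w1 (\<lambda>_. 0)" "w \<alpha> = 0" "w1 \<alpha> = 1"
    using forward_solution[OF assms(1)] by metis
  have sub: "J \<subseteq> ray \<alpha>" using assms by (auto simp: ray_def[OF assms(1)])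
  have "u x * w1 x - u1 x * w x = 1" if "x \<in> J" for x
    using wronskian_const[OF J(4) u(1) w(1), of x \<alpha>] sub that J(2) u w by auto
  then show ?thesis
    using solves_subset[OF u(1) sub assms(3)] solves_subset[OF w(1) sub assms(3)] by blast
qed

text \<open>The Wronskians of \<open>f\<close> with a fundamental system are constant and vanish at
  \<open>y\<close>; since the fundamental system has Wronskian 1, they determine \<open>f x\<close>
  and \<open>f1 x\<close> by Cramer's rule. The argument does not care on which side of
  \<open>y\<close> the point \<open>x\<close> lies.\<close>

lemma solves_zero:
  assumes f: "solves J f f1 (\<lambda>_. 0)" and J: "J \<subseteq> I" "is_interval J" and y: "y \<in> J" "f y = 0" "f1 y = 0"
    and x: "x \<in> J"
  shows "f x = 0" "f1 x = 0"
proof -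
  \<comment> \<open>Fundamental systems are available only to the right of their starting point, so
    it is placed at the smaller of the two points.\<close>
  define K where "K = J \<inter> {min x y..}"
  have K: "K \<subseteq> I" "is_interval K" "x \<in> K" "y \<in> K" "K \<subseteq> J" "K \<subseteq> {min x y..}"
    using J x y by (auto simp: K_def is_interval_Int is_interval_ci)
  have "min x y \<in> I" using J x y by (auto simp: min_def)
  from forward_fundamental_system[OF this K(1,2,6)]
  obtain u u1 w w1 where u: "solves K u u1 (\<lambda>_. 0)" and w: "solves K w w1 (\<lambda>_. 0)"
    and W: "u x * w1 x - u1 x * w x = 1" using K(3) by blast
  have f': "solves K f f1 (\<lambda>_. 0)" by (rule solves_subset[OF f K(5,2)])
  have 1: "f x * u1 x - f1 x * u x = 0" using wronskian_const[OF K(1) f' u K(3,4)] y by simp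
  have 2: "f x * w1 x - f1 x * w x = 0" using wronskian_const[OF K(1) f' w K(3,4)] y by simp
  have "f x = (f x * w1 x - f1 x * w x) * u x - (f x * u1 x - f1 x * u x) * w x"
    using arg_cong[OF W, of "\<lambda>z. f x * z"] by (simp add: algebra_simps)
  then show "f x = 0" using 1 2 by simp
  have "f1 x = (f x * w1 x - f1 x * w x) * u1 x - (f x * u1 x - f1 x * u x) * w1 x"
    using arg_cong[OF W, of "\<lambda>z. f1 x * z"] by (simp add: algebra_simps)
  then show "f1 x = 0" using 1 2 by simp
qed

lemma solves_unique:
  assumes f: "solves J f f1 g" and h: "solves J h h1 g" and J: "J \<subseteq> I" "is_interval J"
    and y: "y \<in> J" "f y = h y" "f1 y = h1 y" and x: "x \<in> J"
  shows "f x = h x" "f1 x = h1 x"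
  using solves_zero[OF _ J y(1) _ _ x, of "\<lambda>x. 1 * f x + (-1) * h x" "\<lambda>x. 1 * f1 x + (-1) * h1 x"]
    solves_comb[OF f h, of 1 "-1"] y by auto

text \<open>The construction starts at \<alpha> but the data are prescribed at \<open>y\<close>; the
  coefficients \<open>A\<close> and \<open>B\<close> solve the resulting linear system, whose
  determinant is the Wronskian 1.\<close>

lemma solution_on_ray:
  assumes "\<alpha> \<in> I" "y \<in> I" "\<alpha> \<le> y"
  shows "\<exists>f f1. solves (I \<inter> {\<alpha>..}) f f1 (\<lambda>_. 0) \<and> f y = p \<and> f1 y = p1"
proof -
  have K: "I \<inter> {\<alpha>..} \<subseteq> I" "is_interval (I \<inter> {\<alpha>..})" "I \<inter> {\<alpha>..} \<subseteq> {\<alpha>..}"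
    using I by (auto simp: is_interval_Int is_interval_ci)
  obtain u u1 w w1 where u: "solves (I \<inter> {\<alpha>..}) u u1 (\<lambda>_. 0)" and w: "solves (I \<inter> {\<alpha>..}) w w1 (\<lambda>_. 0)"
    and W: "u y * w1 y - u1 y * w y = 1"
    using forward_fundamental_system[OF assms(1) K] assms by force
  define A B where "A = p * w1 y - p1 * w y" and "B = p1 * u y - p * u1 y"
  have "A * u y + B * w y = p" "A * u1 y + B * w1 y = p1"
    using arg_cong[OF W, of "\<lambda>z. p * z"] arg_cong[OF W, of "\<lambda>z. p1 * z"]
    by (simp_all add: A_def B_def algebra_simps)
  with solves_comb[OF u w, of A B] show ?thesis by (auto intro!: exI)
qed

text \<open>The interval \<open>I\<close> need not have a smallest point from which to start.
  Solutions on the rays \<open>I \<inter> {\<alpha>..}\<close> with the same data at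
  \<open>c\<close> agree where they overlap, by uniqueness, and are glued.\<close>

lemma exists_solution:
  assumes c: "c \<in> I"
  shows "\<exists>f f1. solves I f f1 (\<lambda>_. 0) \<and> f c = p \<and> f1 c = p1"
proof -
  have "\<forall>\<alpha>\<in>I. \<alpha> \<le> c \<longrightarrow> (\<exists>f f1. solves (I \<inter> {\<alpha>..}) f f1 (\<lambda>_. 0) \<and> f c = p \<and> f1 c = p1)"
    using solution_on_ray[OF _ c] by blast
  then obtain F F1 where F: "\<And>\<alpha>. \<alpha> \<in> I \<Longrightarrow> \<alpha> \<le> c \<Longrightarrow> solves (I \<inter> {\<alpha>..}) (F \<alpha>) (F1 \<alpha>) (\<lambda>_. 0) \<and> F \<alpha> c = p \<and> F1 \<alpha> c = p1"
    by metis
  \<comment> \<open>The ray that starts at \<open>min x c\<close> contains both the point of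
    evaluation and the point \<open>c\<close> where the data are fixed.\<close>
  define f f1 where "f = (\<lambda>x. F (min x c) x)" and "f1 = (\<lambda>x. F1 (min x c) x)"
  have eq: "F \<alpha> x = f x" "F1 \<alpha> x = f1 x" if \<alpha>: "\<alpha> \<in> I" "\<alpha> \<le> c" and x: "x \<in> I" "\<alpha> \<le> x" for \<alpha> x
  proof -
    define K where "K = I \<inter> {min x c..}"
    have mI: "min x c \<in> I" using x c by (auto simp: min_def)
    have K: "K \<subseteq> I" "is_interval K" "c \<in> K" "x \<in> K" "K \<subseteq> I \<inter> {\<alpha>..}"
      using I x \<alpha> c by (auto simp: K_def is_interval_Int is_interval_ci)
    have "solves K (F \<alpha>) (F1 \<alpha>) (\<lambda>_. 0)" using F[OF \<alpha>] K solves_subset by blast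
    moreover have "solves K (F (min x c)) (F1 (min x c)) (\<lambda>_. 0)" using F[OF mI] by (simp add: K_def)
    ultimately show "F \<alpha> x = f x" "F1 \<alpha> x = f1 x"
      using solves_unique[of K "F \<alpha>" "F1 \<alpha>" "\<lambda>_. 0" "F (min x c)" "F1 (min x c)" c x] F[OF \<alpha>] F[OF mI] K
      by (auto simp: f_def f1_def)
  qed
  have loc: "solves (I \<inter> {\<alpha>..}) f f1 (\<lambda>_. 0)" if "\<alpha> \<in> I" "\<alpha> \<le> c" for \<alpha>
    by (rule solves_cong[OF conjunct1[OF F[OF that]]]) (use eq[OF that] in auto)
  have glue: "ac_on m I h \<phi>" if "\<And>\<alpha>. \<alpha> \<in> I \<Longrightarrow> \<alpha> \<le> c \<Longrightarrow> ac_on m (I \<inter> {\<alpha>..}) h \<phi>" for h \<phi> :: cfun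
  proof (rule ac_onI[OF I])
    fix x y assume xy: "x \<in> I" "y \<in> I" "x \<le> y"
    have mI: "min x c \<in> I" "min x c \<le> c" using xy c by (auto simp: min_def)
    show "set_integrable m {x..<y} \<phi>" by (rule ac_on_integrable[OF that[OF mI]]) (use xy in auto)
    show "h y = h x + (LINT t:{x..<y}|m. \<phi> t)" by (rule ac_on_eq[OF that[OF mI]]) (use xy in auto)
  qed
  have "solves I f f1 (\<lambda>_. 0)"
    unfolding solves_def by (intro conjI glue) (use loc solvesD1 in blast, use loc solvesD2 in blast)
  moreover have "f c = p" "f1 c = p1" using F[OF c] by (auto simp: f_def f1_def)
  ultimately show ?thesis by blast
qed

lemma real_solution:
  assumes f: "solves I f f1 (\<lambda>_. 0)" and c: "c \<in> I" "cnj (f c) = f c" "cnj (f1 c) = f1 c" and x: "x \<in> I"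
  shows "cnj (f x) = f x" "cnj (f1 x) = f1 x"
  using solves_unique[of I "\<lambda>x. cnj (f x)" "\<lambda>x. cnj (f1 x)" "\<lambda>_. 0" f f1 c x] solves_cnj[OF f] f c x I by auto

end

context borel_sigma_finite
begin

text \<open>Half-open intervals form an intersection-stable generator of the Borel sets, so the
  vanishing of integrals extends to every Borel set; \<open>tot\<close> is what the step for
  complements requires.\<close>

lemma AE_zero_if_integrals_zero:
  fixes \<phi> :: cfun
  assumes \<phi>: "integrable m \<phi>" and tot: "(LINT t|m. \<phi> t) = 0"
    and int: "\<And>u v. (LINT t:{u..<v}|m. \<phi> t) = 0"
  shows "AE t in m. \<phi> t = 0"
proof (rule density_zero[OF \<phi>])
  fix A assume "A \<in> sets m"
  then have A: "A \<in> sigma_sets UNIV (range (\<lambda>(a, b). {a ..< b::real}))"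
    by (simp add: borel_eq_atLeastLessThan)
  have st: "Int_stable (range (\<lambda>(a, b). {a ..< b::real}))"
    by (auto simp: Int_stable_def)
  have P: "range (\<lambda>(a, b). {a ..< b::real}) \<subseteq> Pow UNIV" by auto
  from A show "(LINT t:A|m. \<phi> t) = 0"
  proof (induction rule: sigma_sets_induct_disjoint[OF st P, consumes 1, case_names basic empty compl union])
    case (basic A)
    then show ?case using int by auto
  next
    case empty
    then show ?case by (simp add: set_lebesgue_integral_def)
  next
    case (compl A)
    have [measurable]: "A \<in> sets borel" using compl(1) by (simp add: borel_eq_atLeastLessThan)
    have "(LINT t:UNIV - A|m. \<phi> t) = (LINT t|m. \<phi> t - indicator A t *\<^sub>R \<phi> t)"
      unfolding set_lebesgue_integral_def by (rule Bochner_Integration.integral_cong) (auto simp: indicator_def)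
    also have "\<dots> = 0" using compl(2) tot \<phi>
      by (subst Bochner_Integration.integral_diff) (auto simp: set_lebesgue_integral_def intro!: integrable_mult_indicator)
    finally show ?case .
  next
    case (union A)
    have [measurable]: "A i \<in> sets borel" for i using union(2) by (auto simp: borel_eq_atLeastLessThan)
    have "(LINT t:(\<Union>i. A i)|m. \<phi> t) = (\<Sum>i. LINT t:A i|m. \<phi> t)"
      by (rule lebesgue_integral_countable_add)
         (use union(1) \<phi> in \<open>auto simp: disjoint_family_on_def set_integrable_def intro!: integrable_mult_indicator\<close>)
    then show ?case using union(3) by simp
  qed
qed

lemma ac_on_zero_deriv:
  fixes f \<phi> :: cfun
  assumes f: "ac_on m J f \<phi>" and xy: "x \<in> J" "y \<in> J" "x \<le> y" and z: "\<And>t. x \<le> t \<Longrightarrow> t \<le> y \<Longrightarrow> f t = 0"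
  shows "AE t in m. t \<in> {x..<y} \<longrightarrow> \<phi> t = 0"
proof -
  define \<phi>0 where "\<phi>0 = (\<lambda>t. indicator {x..<y} t *\<^sub>R \<phi> t)"
  have i: "integrable m \<phi>0" using ac_on_integrable[OF f xy(1,2)] by (simp add: \<phi>0_def set_integrable_def)
  have *: "(LINT t:{u..<v}|m. \<phi>0 t) = 0" for u v
  proof (cases "max u x \<le> min v y")
    case True
    have "(LINT t:{u..<v}|m. \<phi>0 t) = (LINT t:{max u x..<min v y}|m. \<phi> t)"
      unfolding set_lebesgue_integral_def \<phi>0_def
      by (rule Bochner_Integration.integral_cong) (auto simp: indicator_def)
    moreover have "max u x \<in> J" "min v y \<in> J"
      using ac_on_interval[OF f xy(1,2)] True xy by (auto simp: max_def min_def split: if_splits)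
    ultimately show ?thesis
      using ac_on_eq[OF f, of "max u x" "min v y"] z[of "max u x"] z[of "min v y"] True xy by auto
  next
    case False
    have "(LINT t:{u..<v}|m. \<phi>0 t) = (LINT t|m. 0)"
      unfolding set_lebesgue_integral_def \<phi>0_def
      by (rule Bochner_Integration.integral_cong) (use False in \<open>auto simp: indicator_def\<close>)
    then show ?thesis by simp
  qed
  have tot: "(LINT t|m. \<phi>0 t) = (LINT t:{x..<y}|m. \<phi>0 t)"
    unfolding set_lebesgue_integral_def \<phi>0_def
    by (rule Bochner_Integration.integral_cong) (auto simp: indicator_def)
  have "AE t in m. \<phi>0 t = 0"
    by (rule AE_zero_if_integrals_zero[OF i _ *]) (simp add: tot *)
  then show ?thesis by eventually_elim (auto simp: \<phi>0_def)
qed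

end

text \<open>\<open>s_full\<close> says in terms of the density that the support of \<sigma> is the
  whole interval.\<close>

locale full_measure_system = measure_system +
  assumes I_open: "open I"
    and s_full: "\<And>x y. x \<in> I \<Longrightarrow> y \<in> I \<Longrightarrow> x < y \<Longrightarrow> \<not> (AE t in m. t \<in> {x<..<y} \<longrightarrow> s t = 0)"
begin

text \<open>If \<open>f t\<close> were nonzero, left continuity would keep \<open>f\<close> away
  from zero on an interval ending at \<open>t\<close>; there \<open>s\<close> would vanish almost
  everywhere, against \<open>s_full\<close>.\<close>

lemma s_mult_zero:
  fixes f \<phi> :: cfun
  assumes f: "ac_on m J f \<phi>" and J: "J \<subseteq> I" and xy: "x \<in> J" "y \<in> J"
    and z: "AE t in m. t \<in> {x<..<y} \<longrightarrow> of_real (s t) * f t = 0" and t: "t \<in> {x<..<y}"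
  shows "f t = 0"
proof (rule ccontr)
  assume n: "f t \<noteq> 0"
  have tJ: "t \<in> J" using ac_on_interval[OF f xy, of t] t by auto
  have "(f \<longlongrightarrow> f t) (at_left t)" by (rule ac_on_left_continuous[OF f sets_m xy(1) tJ]) (use t in auto)
  then have "\<forall>\<^sub>F u in at_left t. f u \<noteq> 0" using n by (rule tendsto_imp_eventually_ne)
  then obtain b where b: "b < t" "\<And>u. b < u \<Longrightarrow> u < t \<Longrightarrow> f u \<noteq> 0"
    using eventually_at_left[of x t] t by auto
  define b' where "b' = max b x"
  have b': "b' < t" "x \<le> b'" "b \<le> b'" using b t by (auto simp: b'_def)
  have "b' \<in> J" using ac_on_interval[OF f xy, of b'] b' t by auto
  then have "\<not> (AE u in m. u \<in> {b'<..<t} \<longrightarrow> s u = 0)" using s_full[of b' t] b' J tJ by auto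
  moreover have "AE u in m. u \<in> {b'<..<t} \<longrightarrow> s u = 0"
    using z by eventually_elim (use b b' t in auto)
  ultimately show False by blast
qed

lemma solves_zero_quasi:
  assumes f: "solves J f f1 g" and J: "J \<subseteq> I" and xy: "x \<in> J" "y \<in> J"
    and z: "\<And>t. x < t \<Longrightarrow> t < y \<Longrightarrow> f t = 0" and t: "t \<in> {x<..<y}"
  shows "f1 t = 0"
proof -
  \<comment> \<open>\<open>f\<close> vanishes only on the open interval, whereas
    \<open>ac_on_zero_deriv\<close> also needs both endpoints; hence the retreat to an interval
    around \<open>t\<close> that stays strictly inside.\<close>
  define u v where "u = (x + t) / 2" and "v = (t + y) / 2"
  have uv: "x < u" "u < t" "t < v" "v < y" using t by (auto simp: u_def v_def field_simps)
  have uvJ: "u \<in> J" "v \<in> J" using ac_on_interval[OF solvesD1[OF f] xy] uv by auto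
  have "AE w in m. w \<in> {u..<v} \<longrightarrow> of_real (s w) * f1 w = 0"
    by (rule ac_on_zero_deriv[OF solvesD1[OF f] uvJ]) (use uv z in auto)
  then have "AE w in m. w \<in> {u<..<v} \<longrightarrow> of_real (s w) * f1 w = 0" by eventually_elim auto
  then show ?thesis by (rule s_mult_zero[OF solvesD2[OF f] J uvJ]) (use uv in auto)
qed

text \<open>The right-hand sides may differ: \<sigma> has full support, so \<open>f\<close> alone
  fixes \<open>f1\<close>. This is what makes the definite description in \<open>qderiv\<close>
  meaningful.\<close>

lemma quasi_unique:
  assumes f: "solves I f f1 g" and h: "solves I f h1 k" and x: "x \<in> I"
  shows "f1 x = h1 x"
proof -
  obtain e where e: "e > 0" and J: "x - e \<in> I" "x + e \<in> I" using open_real_neighbours[OF I_open x] by blast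
  have "solves I (\<lambda>x. 1 * f x + (-1) * f x) (\<lambda>x. 1 * f1 x + (-1) * h1 x) (\<lambda>x. 1 * g x + (-1) * k x)"
    by (rule solves_comb[OF f h])
  from solves_zero_quasi[OF this order_refl J, of x] e show ?thesis by auto
qed

end

section \<open>Solutions vanishing almost everywhere\<close>

text \<open>By Lindelof's theorem countably many null balls cover \<open>U\<close>.\<close>

lemma null_if_disjoint_support:
  fixes \<rho> :: "'a::{metric_space,second_countable_topology} measure"
  assumes \<rho>: "sets \<rho> = sets borel" and U: "U \<in> sets borel" "\<And>x. x \<in> U \<Longrightarrow> \<exists>e>0. emeasure \<rho> (ball x e) = 0"
  shows "emeasure \<rho> U = 0"
proof -
  define F where "F = {ball x e | x e. emeasure \<rho> (ball x e) = 0}"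
  obtain F' where F': "F' \<subseteq> F" "countable F'" "\<Union>F' = \<Union>F"
    by (rule Lindelof[of F]) (auto simp: F_def)
  have "U \<subseteq> \<Union>F"
  proof
    fix x assume "x \<in> U"
    with U obtain e where e: "e > 0" "emeasure \<rho> (ball x e) = 0" by blast
    then have "ball x e \<in> F" "x \<in> ball x e" by (auto simp: F_def)
    then show "x \<in> \<Union>F" by blast
  qed
  moreover have "(\<Union>B\<in>F'. B) \<in> null_sets \<rho>"
    by (rule null_sets_UN'[OF F'(2)]) (use F'(1) \<rho> in \<open>auto simp: F_def null_sets_def\<close>)
  ultimately have "emeasure \<rho> U \<le> 0"
    using emeasure_mono[of U "\<Union>F'" \<rho>] F' by (auto simp: null_sets_def)
  then show ?thesis by simp
qed

context full_measure_system
begin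

text \<open>One-sided limits turn zeros almost everywhere into zeros at the ends of each gap of the
  support, (H5) spreads them over the gaps, and left continuity treats the remaining points between
  two points of the support. On an open interval where \<open>f\<close> is zero the quasi-derivative
  is zero too, and uniqueness of the initial value problem finishes.\<close>

lemma eq_zero_if_AE_zero:
  assumes Iab: "I = ivl a b" and \<rho>: "\<rho> = density m (\<lambda>x. ennreal (r x))"
    and f: "solves I f f1 (\<lambda>_. 0)" and ae: "AE x in \<rho>. f x = 0"
    and gap: "\<And>\<alpha> \<beta>. \<alpha> \<in> msupp a b \<rho> \<Longrightarrow> \<beta> \<in> msupp a b \<rho> \<Longrightarrow> \<alpha> < \<beta> \<Longrightarrow> {\<alpha><..<\<beta>} \<inter> msupp a b \<rho> = {} \<Longrightarrow>
      (f \<longlongrightarrow> 0) (at_left \<alpha>) \<Longrightarrow> (f \<longlongrightarrow> 0) (at_right \<beta>) \<Longrightarrow> \<forall>x\<in>{\<alpha><..<\<beta>}. f x = 0"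
    and x0: "x0 \<in> msupp a b \<rho>" and y0: "y0 \<in> msupp a b \<rho>" and xy0: "x0 < y0" and x: "x \<in> I"
  shows "f x = 0"
proof -
  have sets_\<rho> [simp, measurable_cong]: "sets \<rho> = sets borel" by (simp add: \<rho>)
  \<comment> \<open>The support before intersection with \<open>I\<close>. It is closed in the whole
    line, so that suprema and infima of its bounded pieces stay in it.\<close>
  define C0 where "C0 = {x. \<forall>e>0. emeasure \<rho> (ball x e) > 0}"
  have S: "msupp a b \<rho> = I \<inter> C0" by (auto simp: msupp_def C0_def Iab)
  have "open (- C0)"
    unfolding open_contains_ball
  proof
    fix x assume "x \<in> - C0"
    then obtain e where e: "e > 0" "emeasure \<rho> (ball x e) = 0" by (auto simp: C0_def)
    have "y \<in> - C0" if y: "y \<in> ball x (e/2)" for y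
    proof -
      have "ball y (e/2) \<subseteq> ball x e"
        using y by (auto simp: ball_eq_greaterThanLessThan field_simps)
      then have "emeasure \<rho> (ball y (e/2)) \<le> emeasure \<rho> (ball x e)" by (intro emeasure_mono) auto
      then have "emeasure \<rho> (ball y (e/2)) = 0" using e by simp
      then have "\<not> (\<forall>e>0. emeasure \<rho> (ball y e) > 0)" using e(1) by (metis half_gt_zero less_irrefl)
      then show ?thesis by (simp add: C0_def)
    qed
    then show "\<exists>e>0. ball x e \<subseteq> - C0" using e(1) by (intro exI[of _ "e/2"]) auto
  qed
  then have closed: "closed C0" by (simp add: closed_def)
  have null: "emeasure \<rho> U = 0" if "U \<in> sets borel" "U \<inter> C0 = {}" for U
  proof (rule null_if_disjoint_support[OF sets_\<rho> that(1)])
    fix x assume "x \<in> U"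
    then have "x \<notin> C0" using that(2) by blast
    then show "\<exists>e>0. emeasure \<rho> (ball x e) = 0" by (simp add: C0_def)
  qed
  have nullI: "emeasure \<rho> {u<..<v} = 0" if "u \<in> I" "v \<in> I" "{u<..<v} \<inter> msupp a b \<rho> = {}" for u v
  proof -
    have "{u<..<v} \<subseteq> I"
    proof
      fix t assume "t \<in> {u<..<v}"
      then have "u \<le> t" "t \<le> v" by auto
      then show "t \<in> I" using that(1,2) I unfolding is_interval_1 by blast
    qed
    moreover have "{u<..<v} \<inter> C0 = {}" using that(3) calculation unfolding S by blast
    ultimately show ?thesis by (intro null) simp_all
  qed
  \<comment> \<open>The form in which the almost everywhere hypothesis is used: every set of
    positive measure contains a zero of \<open>f\<close>.\<close>
  have pos: "\<exists>t\<in>A. f t = 0" if "emeasure \<rho> A > 0" for A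
  proof (rule ccontr)
    assume n: "\<not> (\<exists>t\<in>A. f t = 0)"
    have A: "A \<in> sets \<rho>" by (rule emeasure_neq_0_sets) (use that in \<open>simp add: less_le\<close>)
    have "AE t in \<rho>. t \<notin> A" using ae by eventually_elim (use n in auto)
    then have "A \<in> null_sets \<rho>" using A by (simp add: AE_iff_null_sets)
    then show False using that by auto
  qed
  \<comment> \<open>At an atom of \<rho>, (H4) forces \<open>s\<close> to vanish, so that
    \<open>f\<close> has no jump there.\<close>
  have atom: "f t = 0 \<and> s t = 0" if "emeasure \<rho> {t} > 0" "t \<in> I" for t
  proof -
    have "emeasure \<rho> {t} = ennreal (r t) * emeasure m {t}"
      unfolding \<rho> by (rule emeasure_density_singleton) simp
    then have "r t \<noteq> 0" "emeasure m {t} \<noteq> 0" using that by (auto simp: r_nonneg)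
    moreover have "measure m {t} \<noteq> 0"
      using calculation emeasure_singleton_finite[of t] by (auto simp: measure_def enn2real_eq_0_iff)
    ultimately have "s t = 0" using sr_atom[OF that(2)] by simp
    moreover have "f t = 0" using pos[OF that(1)] by auto
    ultimately show ?thesis by simp
  qed
  note nhd = open_real_neighbours[OF I_open]
  have lcont: "(f \<longlongrightarrow> f t) (at_left t)" if t: "t \<in> I" for t
  proof -
    obtain e where e: "e > 0" "t - e \<in> I" using nhd[OF t] by blast
    show ?thesis by (rule ac_on_left_continuous[OF solvesD1[OF f] sets_m e(2) t]) (use e in auto)
  qed
  have rlim: "(f \<longlongrightarrow> f t + (of_real (s t) * f1 t) * of_real (measure m {t})) (at_right t)" if t: "t \<in> I" for t
  proof -
    obtain e where e: "e > 0" "t + e \<in> I" using nhd[OF t] by blast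
    show ?thesis by (rule ac_on_right_limit[OF solvesD1[OF f] t e(2)]) (use e in auto)
  qed
  have left: "f t = 0" if t: "t \<in> I" and z: "\<And>e. e > 0 \<Longrightarrow> \<exists>t'\<in>{t - e<..t}. f t' = 0" for t
  proof (rule ccontr)
    assume n: "f t \<noteq> 0"
    have "\<forall>\<^sub>F u in at_left t. f u \<noteq> 0" using lcont[OF t] n by (rule tendsto_imp_eventually_ne)
    then obtain b where b: "b < t" "\<And>u. b < u \<Longrightarrow> u < t \<Longrightarrow> f u \<noteq> 0"
      using eventually_at_left[of "t - 1" t] by auto
    obtain t' where "t' \<in> {t - (t - b)<..t}" "f t' = 0" using z[of "t - b"] b(1) by auto
    then show False using b(2)[of t'] n by (cases "t' = t") auto
  qed
  have gap0: "f t = 0" if \<alpha>: "\<alpha> \<in> msupp a b \<rho>" and \<beta>: "\<beta> \<in> msupp a b \<rho>" and g: "{\<alpha><..<\<beta>} \<inter> msupp a b \<rho> = {}"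
    and t: "t \<in> {\<alpha><..<\<beta>}" for \<alpha> \<beta> t
  proof -
    have \<alpha>\<beta>: "\<alpha> < \<beta>" using t by auto
    have I': "\<alpha> \<in> I" "\<beta> \<in> I" "\<alpha> \<in> C0" "\<beta> \<in> C0" using \<alpha> \<beta> by (auto simp: S)
    have n0: "emeasure \<rho> {\<alpha><..<\<beta>} = 0" by (rule nullI[OF I'(1,2) g])
    \<comment> \<open>Every ball around \<alpha> has positive mass but the gap to its right has
      none. The mass therefore lies in the half-open interval ending at \<alpha>, and so does a zero
      of \<open>f\<close>.\<close>
    have "f \<alpha> = 0"
    proof (rule left[OF I'(1)])
      fix e :: real assume e: "e > 0"
      define d where "d = min e (\<beta> - \<alpha>)"
      have d: "d > 0" "d \<le> e" "d \<le> \<beta> - \<alpha>" using e \<alpha>\<beta> by (auto simp: d_def)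
      have "ball \<alpha> d = {\<alpha> - d<..\<alpha>} \<union> {\<alpha><..<\<alpha> + d}" using d by (auto simp: ball_eq_greaterThanLessThan)
      then have "emeasure \<rho> (ball \<alpha> d) \<le> emeasure \<rho> {\<alpha> - d<..\<alpha>} + emeasure \<rho> {\<alpha><..<\<alpha> + d}"
        using emeasure_subadditive[of "{\<alpha> - d<..\<alpha>}" \<rho> "{\<alpha><..<\<alpha> + d}"] by simp
      moreover have "emeasure \<rho> {\<alpha><..<\<alpha> + d} \<le> emeasure \<rho> {\<alpha><..<\<beta>}" using d by (intro emeasure_mono) auto
      moreover have "emeasure \<rho> (ball \<alpha> d) > 0" using I' d by (auto simp: C0_def)
      ultimately have "emeasure \<rho> {\<alpha> - d<..\<alpha>} > 0" using n0 by auto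
      from pos[OF this] show "\<exists>t'\<in>{\<alpha> - e<..\<alpha>}. f t' = 0" using d by auto
    qed
    then have L: "(f \<longlongrightarrow> 0) (at_left \<alpha>)" using lcont[OF I'(1)] by simp
    define R where "R = f \<beta> + (of_real (s \<beta>) * f1 \<beta>) * of_real (measure m {\<beta>})"
    have Rlim: "(f \<longlongrightarrow> R) (at_right \<beta>)" unfolding R_def by (rule rlim[OF I'(2)])
    \<comment> \<open>Either \<beta> is an atom, where \<open>f\<close> is zero and does not jump,
      or the mass near \<beta> lies strictly to its right and supplies zeros of \<open>f\<close>
      converging to \<beta>.\<close>
    have "R = 0"
    proof (cases "emeasure \<rho> {\<beta>} > 0")
      case True
      then show ?thesis using atom[OF True I'(2)] by (simp add: R_def)
    next
      case False
      show ?thesis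
      proof (rule ccontr)
        assume n: "R \<noteq> 0"
        have "\<forall>\<^sub>F u in at_right \<beta>. f u \<noteq> 0" using Rlim n by (rule tendsto_imp_eventually_ne)
        then obtain y where y: "y > \<beta>" "\<And>u. \<beta> < u \<Longrightarrow> u < y \<Longrightarrow> f u \<noteq> 0"
          using eventually_at_right[of \<beta> "\<beta> + 1"] by auto
        define d where "d = min (y - \<beta>) (\<beta> - \<alpha>)"
        have d: "d > 0" "d \<le> y - \<beta>" "d \<le> \<beta> - \<alpha>" using y \<alpha>\<beta> by (auto simp: d_def)
        have "ball \<beta> d = ({\<beta> - d<..<\<beta>} \<union> {\<beta>}) \<union> {\<beta><..<\<beta> + d}" using d by (auto simp: ball_eq_greaterThanLessThan)
        then have "emeasure \<rho> (ball \<beta> d) \<le> emeasure \<rho> ({\<beta> - d<..<\<beta>} \<union> {\<beta>}) + emeasure \<rho> {\<beta><..<\<beta> + d}"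
          using emeasure_subadditive[of "{\<beta> - d<..<\<beta>} \<union> {\<beta>}" \<rho> "{\<beta><..<\<beta> + d}"] by simp
        moreover have "emeasure \<rho> ({\<beta> - d<..<\<beta>} \<union> {\<beta>}) \<le> emeasure \<rho> {\<beta> - d<..<\<beta>} + emeasure \<rho> {\<beta>}"
          by (rule emeasure_subadditive) auto
        moreover have "emeasure \<rho> {\<beta> - d<..<\<beta>} \<le> emeasure \<rho> {\<alpha><..<\<beta>}" using d by (intro emeasure_mono) auto
        moreover have "emeasure \<rho> (ball \<beta> d) > 0" using I' d by (auto simp: C0_def)
        ultimately have "emeasure \<rho> {\<beta><..<\<beta> + d} > 0" using n0 False by auto
        from pos[OF this] y(2) d(2) show False by force
      qed
    qed
    then show ?thesis using gap[OF \<alpha> \<beta> \<alpha>\<beta> g L] Rlim t by auto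
  qed
  have xyI: "x0 \<in> I" "y0 \<in> I" and xyC: "x0 \<in> C0" "y0 \<in> C0" using x0 y0 by (auto simp: S)
  have in_I: "t \<in> I" if "x0 \<le> t" "t \<le> y0" for t using that xyI I unfolding is_interval_1 by blast
  have off: "f t = 0" if t: "t \<in> {x0<..<y0}" "t \<notin> C0" for t
  proof -
    define \<alpha> where "\<alpha> = Sup (C0 \<inter> {x0..t})"
    define \<beta> where "\<beta> = Inf (C0 \<inter> {t..y0})"
    have "\<alpha> \<in> C0 \<inter> {x0..t}" unfolding \<alpha>_def
      by (rule closed_contains_Sup) (use t xyC closed in \<open>auto intro!: closed_Int\<close>)
    moreover have "\<beta> \<in> C0 \<inter> {t..y0}" unfolding \<beta>_def
      by (rule closed_contains_Inf) (use t xyC closed in \<open>auto intro!: closed_Int\<close>)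
    moreover have "z \<le> \<alpha>" if "z \<in> C0" "x0 \<le> z" "z \<le> t" for z
      unfolding \<alpha>_def by (rule cSup_upper) (use that in auto)
    moreover have "\<beta> \<le> z" if "z \<in> C0" "t \<le> z" "z \<le> y0" for z
      unfolding \<beta>_def by (rule cInf_lower) (use that in auto)
    ultimately have 1: "\<alpha> \<in> C0" "x0 \<le> \<alpha>" "\<alpha> < t" "\<beta> \<in> C0" "t < \<beta>" "\<beta> \<le> y0" and 2: "{\<alpha><..<\<beta>} \<inter> C0 = {}"
      using t by (auto simp: less_le) force+
    show ?thesis
      by (rule gap0[of \<alpha> \<beta> t]) (use 1 2 in_I in \<open>auto simp: S\<close>)
  qed
  have on: "f t = 0" if t: "t \<in> {x0<..<y0}" for t
  proof (rule left)
    show "t \<in> I" using in_I t by auto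
    fix e :: real assume e: "e > 0"
    define d where "d = min e (t - x0)"
    have d: "d > 0" "d \<le> e" "d \<le> t - x0" using e t by (auto simp: d_def)
    show "\<exists>t'\<in>{t - e<..t}. f t' = 0"
    proof (cases "emeasure \<rho> {t - d<..t} > 0")
      case True
      from pos[OF this] show ?thesis using d by auto
    next
      case False
      \<comment> \<open>Without mass immediately to the left of \<open>t\<close>, the midpoint of
        that interval is off the support, where \<open>f\<close> is already known to vanish.\<close>
      define t' where "t' = t - d / 2"
      have t': "t' \<in> {t - d<..<t}" using d by (auto simp: t'_def field_simps)
      have "ball t' (d/2) \<subseteq> {t - d<..t}" unfolding t'_def
        by (auto simp: ball_eq_greaterThanLessThan field_simps)
      then have "emeasure \<rho> (ball t' (d/2)) \<le> emeasure \<rho> {t - d<..t}" by (intro emeasure_mono) auto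
      then have "emeasure \<rho> (ball t' (d/2)) = 0" using False by auto
      then have "\<not> (\<forall>e>0. emeasure \<rho> (ball t' e) > 0)" using d(1) by (metis half_gt_zero less_irrefl)
      then have "t' \<notin> C0" by (simp add: C0_def)
      then show ?thesis using off[of t'] t' t d by (intro bexI[of _ t']) auto
    qed
  qed
  define z where "z = (x0 + y0) / 2"
  have z: "z \<in> {x0<..<y0}" using xy0 by (auto simp: z_def)
  have "f1 z = 0" by (rule solves_zero_quasi[OF f order_refl xyI _ z]) (use on in auto)
  then show ?thesis using solves_zero[OF f order_refl I in_I[of z] _ _ x] on[OF z] z by auto
qed

end

section \<open>Square-integrable functions\<close>

lemma L2_measurable: "L2 \<rho> f \<Longrightarrow> f \<in> borel_measurable \<rho>"
  by (simp add: L2_def)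

lemma L2_integrable_norm: "L2 \<rho> f \<Longrightarrow> integrable \<rho> (\<lambda>x. (norm (f x))\<^sup>2)"
  by (simp add: L2_def)

lemma L2_mult_integrable:
  assumes f: "L2 \<rho> f" and g: "L2 \<rho> g"
  shows "integrable \<rho> (\<lambda>x. f x * g x)"
proof (rule Bochner_Integration.integrable_bound)
  show "integrable \<rho> (\<lambda>x. (norm (f x))\<^sup>2 + (norm (g x))\<^sup>2)" using f g by (simp add: L2_def)
  show "(\<lambda>x. f x * g x) \<in> borel_measurable \<rho>" using f g by (auto simp: L2_def)
  have "norm (f x * g x) \<le> (norm (f x))\<^sup>2 + (norm (g x))\<^sup>2" for x
  proof -
    have "2 * (norm (f x) * norm (g x)) \<le> (norm (f x))\<^sup>2 + (norm (g x))\<^sup>2"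
      using sum_squares_bound[of "norm (f x)" "norm (g x)"] by simp
    moreover have "0 \<le> norm (f x) * norm (g x)" by simp
    ultimately show ?thesis unfolding norm_mult by linarith
  qed
  then show "AE x in \<rho>. norm (f x * g x) \<le> norm ((norm (f x))\<^sup>2 + (norm (g x))\<^sup>2)" by (auto intro: order_trans)
qed

lemma L2_cnj: "L2 \<rho> f \<Longrightarrow> L2 \<rho> (\<lambda>x. cnj (f x))"
  by (auto simp: L2_def intro: bounded_linear_cnj borel_measurable_continuous_on[OF continuous_on_cnj[OF continuous_on_id]])

lemma L2_zero [simp]: "L2 \<rho> (\<lambda>_. 0)"
  by (simp add: L2_def)

lemma L2_dominated:
  assumes "L2 \<rho> f" "g \<in> borel_measurable \<rho>" "AE x in \<rho>. norm (g x) \<le> C * norm (f x)"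
  shows "L2 \<rho> g"
  unfolding L2_def
proof
  show "integrable \<rho> (\<lambda>x. (norm (g x))\<^sup>2)"
  proof (rule Bochner_Integration.integrable_bound)
    show "integrable \<rho> (\<lambda>x. C\<^sup>2 * (norm (f x))\<^sup>2)" using assms(1) by (simp add: L2_def)
    show "(\<lambda>x. (norm (g x))\<^sup>2) \<in> borel_measurable \<rho>" using assms(2) by simp
    show "AE x in \<rho>. norm ((norm (g x))\<^sup>2) \<le> norm (C\<^sup>2 * (norm (f x))\<^sup>2)"
      using assms(3) by eventually_elim (auto simp flip: power_mult_distrib intro!: power_mono)
  qed
qed fact

lemma L2_cmult: "L2 \<rho> f \<Longrightarrow> L2 \<rho> (\<lambda>x. k * f x)"
  by (rule L2_dominated[where C = "norm k"]) (auto simp: L2_def norm_mult)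

lemma L2_add:
  assumes f: "L2 \<rho> f" and g: "L2 \<rho> g"
  shows "L2 \<rho> (\<lambda>x. f x + g x)"
  unfolding L2_def
proof
  show "(\<lambda>x. f x + g x) \<in> borel_measurable \<rho>" using f g by (auto simp: L2_def)
  show "integrable \<rho> (\<lambda>x. (norm (f x + g x))\<^sup>2)"
  proof (rule Bochner_Integration.integrable_bound)
    show "integrable \<rho> (\<lambda>x. 2 * (norm (f x))\<^sup>2 + 2 * (norm (g x))\<^sup>2)" using f g by (simp add: L2_def)
    show "(\<lambda>x. (norm (f x + g x))\<^sup>2) \<in> borel_measurable \<rho>"
      using L2_measurable[OF f] L2_measurable[OF g] by measurable
    have "(norm (f x + g x))\<^sup>2 \<le> 2 * (norm (f x))\<^sup>2 + 2 * (norm (g x))\<^sup>2" for x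
    proof -
      have "(norm (f x + g x))\<^sup>2 \<le> (norm (f x) + norm (g x))\<^sup>2"
        by (intro power_mono norm_triangle_ineq) auto
      also have "\<dots> \<le> 2 * (norm (f x))\<^sup>2 + 2 * (norm (g x))\<^sup>2"
        using sum_squares_bound[of "norm (f x)" "norm (g x)"] by (simp add: power2_sum)
      finally show ?thesis .
    qed
    then show "AE x in \<rho>. norm ((norm (f x + g x))\<^sup>2) \<le> norm (2 * (norm (f x))\<^sup>2 + 2 * (norm (g x))\<^sup>2)"
      by simp
  qed
qed

lemma L2_comb: "L2 \<rho> f \<Longrightarrow> L2 \<rho> g \<Longrightarrow> L2 \<rho> (\<lambda>x. \<alpha> * f x + \<beta> * g x)"
  by (intro L2_add L2_cmult)

lemma L2_diff: "L2 \<rho> f \<Longrightarrow> L2 \<rho> g \<Longrightarrow> L2 \<rho> (\<lambda>x. f x - g x)"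
  using L2_comb[of \<rho> f g 1 "-1"] by simp

lemma L2_indicator: "L2 \<rho> f \<Longrightarrow> A \<in> sets \<rho> \<Longrightarrow> L2 \<rho> (\<lambda>x. indicator A x * f x)"
  by (rule L2_dominated[where C = 1]) (auto simp: L2_def indicator_def)

lemma L2_Cauchy_Schwarz:
  assumes f: "L2 \<rho> f" and g: "L2 \<rho> g"
  shows "(norm (LINT x|\<rho>. f x * g x))\<^sup>2 \<le> (LINT x|\<rho>. (norm (f x))\<^sup>2) * (LINT x|\<rho>. (norm (g x))\<^sup>2)"
proof -
  note [measurable] = L2_measurable[OF f] L2_measurable[OF g]
  have i: "integrable \<rho> (\<lambda>x. norm (f x) * norm (g x))" using L2_mult_integrable[OF f g] by (simp flip: norm_mult)
  have "ennreal ((LINT x|\<rho>. norm (f x) * norm (g x))\<^sup>2) = (\<integral>\<^sup>+x. ennreal (norm (f x)) * ennreal (norm (g x)) \<partial>\<rho>)\<^sup>2"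
    using i by (simp add: nn_integral_eq_integral ennreal_power flip: ennreal_mult)
  also have "\<dots> \<le> (\<integral>\<^sup>+x. (ennreal (norm (f x)))\<^sup>2 \<partial>\<rho>) * (\<integral>\<^sup>+x. (ennreal (norm (g x)))\<^sup>2 \<partial>\<rho>)"
    by (rule Cauchy_Schwarz_nn_integral) measurable
  also have "\<dots> = ennreal ((LINT x|\<rho>. (norm (f x))\<^sup>2) * (LINT x|\<rho>. (norm (g x))\<^sup>2))"
    using L2_integrable_norm[OF f] L2_integrable_norm[OF g]
    by (simp add: nn_integral_eq_integral ennreal_power ennreal_mult)
  finally have "(LINT x|\<rho>. norm (f x) * norm (g x))\<^sup>2 \<le> (LINT x|\<rho>. (norm (f x))\<^sup>2) * (LINT x|\<rho>. (norm (g x))\<^sup>2)"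
    by (subst (asm) ennreal_le_iff) (auto intro!: mult_nonneg_nonneg)
  moreover have "norm (LINT x|\<rho>. f x * g x) \<le> (LINT x|\<rho>. norm (f x) * norm (g x))"
    using integral_norm_bound[of \<rho> "\<lambda>x. f x * g x"] by (simp add: norm_mult)
  ultimately show ?thesis
    using power_mono[of "norm (LINT x|\<rho>. f x * g x)" _ 2] by (meson norm_ge_zero order_trans)
qed

section \<open>Boundary values in the limit-circle case\<close>

lemma ivl_eq_einterval: "ivl a b = einterval a b"
  by (simp add: ivl_def einterval_def)

lemma is_interval_ivl: "is_interval (ivl a b)"
  unfolding is_interval_1
proof (intro ballI allI impI)
  fix u v x assume "u \<in> ivl a b" "v \<in> ivl a b" "u \<le> x \<and> x \<le> v"
  then have u: "a < ereal u" "ereal u \<le> ereal x" and v: "ereal x \<le> ereal v" "ereal v < b" by (simp_all add: ivl_def)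
  show "x \<in> ivl a b" using less_le_trans[OF u] le_less_trans[OF v] by (simp add: ivl_def)
qed

lemma ivl_Icc_subset: "x \<in> ivl a b \<Longrightarrow> y \<in> ivl a b \<Longrightarrow> {x..y} \<subseteq> ivl a b"
  using is_interval_ivl[of a b] unfolding is_interval_1 by (meson atLeastAtMost_iff subsetI)

lemma open_ivl: "open (ivl a b)"
  by (simp add: ivl_eq_einterval)

lemma ivl_exhaustion:
  assumes "a < b"
  shows "\<exists>l u :: nat \<Rightarrow> real. (\<forall>n. l n \<in> ivl a b \<and> u n \<in> ivl a b \<and> l n < u n) \<and>
    (\<forall>x\<in>ivl a b. \<forall>\<^sub>F n in sequentially. x \<in> {l n<..<u n})"
proof -
  obtain u l :: "nat \<Rightarrow> real" where ul: "einterval a b = (\<Union>i. {l i .. u i})" "incseq u" "decseq l" "\<And>i. l i < u i"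
    "\<And>i. a < l i" "\<And>i. u i < b" "l \<longlonglongrightarrow> a" "u \<longlonglongrightarrow> b"
    by (rule einterval_Icc_approximation[OF assms]) (rule that)
  have in_I: "l n \<in> ivl a b" "u n \<in> ivl a b" for n
  proof -
    have "l n \<in> {l n..u n}" "u n \<in> {l n..u n}" using ul(4)[of n] by simp_all
    then show "l n \<in> ivl a b" "u n \<in> ivl a b" unfolding ivl_eq_einterval ul(1) by blast+
  qed
  have "\<forall>\<^sub>F n in sequentially. x \<in> {l n<..<u n}" if x: "x \<in> ivl a b" for x
  proof -
    obtain e where e: "e > 0" "x - e \<in> ivl a b" "x + e \<in> ivl a b" using open_real_neighbours[OF open_ivl x] by blast
    then obtain i j where i: "l i \<le> x - e" and j: "x + e \<le> u j" unfolding ivl_eq_einterval ul(1) by auto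
    show ?thesis
      using eventually_ge_at_top[of "max i j"]
    proof eventually_elim
      case (elim n)
      then have "l n \<le> l i" "u j \<le> u n" using ul(2,3) by (auto simp: incseq_def decseq_def)
      then show ?case using i j e by auto
    qed
  qed
  then show ?thesis using in_I ul(4) by blast
qed

lemma at_left_end_nontrivial:
  assumes "a < b" shows "at_left_end a \<noteq> bot"
  using assms by (auto simp: at_left_end_def)

lemma at_right_end_nontrivial: "at_right_end b \<noteq> bot"
  by (auto simp: at_right_end_def)

lemma eventually_at_left_end:
  assumes "y \<in> ivl a b" shows "\<forall>\<^sub>F x in at_left_end a. x \<in> ivl a b \<and> x < y"
proof (cases a)
  case (real a')
  then have "a' < y" using assms by (auto simp: ivl_def)
  then have "\<forall>\<^sub>F x in at_right a'. x \<in> {a'<..<y}" by (rule eventually_at_right_real)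
  then show ?thesis unfolding at_left_end_def real using assms real
    by (auto elim!: eventually_mono simp: ivl_def intro: less_trans[of _ "ereal y"])
next
  case MInf
  have "\<forall>\<^sub>F x in at_bot. x \<in> ivl a b \<and> x < y"
    using eventually_gt_at_bot[of y]
    by eventually_elim (use MInf assms in \<open>auto simp: ivl_def intro: less_trans[of _ "ereal y"]\<close>)
  then show ?thesis by (simp add: at_left_end_def MInf)
qed (use assms in \<open>auto simp: ivl_def\<close>)

lemma eventually_at_right_end:
  assumes "y \<in> ivl a b" shows "\<forall>\<^sub>F x in at_right_end b. x \<in> ivl a b \<and> y < x"
proof (cases b)
  case (real b')
  then have "y < b'" using assms by (auto simp: ivl_def)
  then have "\<forall>\<^sub>F x in at_left b'. x \<in> {y<..<b'}" by (rule eventually_at_left_real)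
  then show ?thesis unfolding at_right_end_def real using assms real
    by (auto elim!: eventually_mono simp: ivl_def intro: less_trans[of _ "ereal y"])
next
  case PInf
  have "\<forall>\<^sub>F x in at_top. x \<in> ivl a b \<and> y < x"
    using eventually_gt_at_top[of y]
    by eventually_elim (use PInf assms in \<open>auto simp: ivl_def intro: less_trans[of _ "ereal y"]\<close>)
  then show ?thesis by (simp add: at_right_end_def PInf)
qed (use assms in \<open>auto simp: ivl_def\<close>)

lemma vector_4:
  "(vector [w, x, y, z] :: 'a::zero^4) $ 1 = w" "(vector [w, x, y, z] :: 'a::zero^4) $ 2 = x"
  "(vector [w, x, y, z] :: 'a::zero^4) $ 3 = y" "(vector [w, x, y, z] :: 'a::zero^4) $ 4 = z"
  unfolding vector_def by simp_all

text \<open>Coordinates 1 and 2 stand for the limits at \<open>a\<close> of the Wronskians with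
  \<open>u1\<close> and \<open>u2\<close>, coordinates 3 and 4 for those at \<open>b\<close>. A
  Wronskian is the determinant of such coordinates, so this is the value at \<open>b\<close> minus
  the value at \<open>a\<close>, with the second argument conjugated.\<close>

definition bdry_form :: "complex^4 \<Rightarrow> complex^4 \<Rightarrow> complex" where
  "bdry_form x y = x$3 * cnj (y$4) - x$4 * cnj (y$3) - (x$1 * cnj (y$2) - x$2 * cnj (y$1))"

locale lc_system = full_measure_system m I s q r for m I s q r +
  fixes a b :: ereal and \<rho> :: "real measure" and u1 v1 u2 v2 :: cfun
  assumes ab: "a < b" and Iab: "I = ivl a b"
    and \<rho>: "\<rho> = density m (\<lambda>x. ennreal (r x))"
    and \<rho>_out: "emeasure \<rho> (UNIV - I) = 0"
    and u1: "solves I u1 v1 (\<lambda>_. 0)" and u2: "solves I u2 v2 (\<lambda>_. 0)"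
    and W: "\<And>x. x \<in> I \<Longrightarrow> u1 x * v2 x - v1 x * u2 x = 1"
    and real: "\<And>x. cnj (u1 x) = u1 x" "\<And>x. cnj (u2 x) = u2 x"
    and outside: "\<And>x. x \<notin> I \<Longrightarrow> u1 x = 0" "\<And>x. x \<notin> I \<Longrightarrow> u2 x = 0"
    and L2u: "L2 \<rho> u1" "L2 \<rho> u2"
    and indep: "\<And>\<alpha> \<beta>. AE x in \<rho>. \<alpha> * u1 x + \<beta> * u2 x = 0 \<Longrightarrow> \<alpha> = 0 \<and> \<beta> = 0"
begin

lemma sets_\<rho> [simp, measurable_cong]: "sets \<rho> = sets borel"
  by (simp add: \<rho>)

lemma space_\<rho> [simp]: "space \<rho> = UNIV"
  by (simp add: \<rho>)

lemma AE_in_I: "AE x in \<rho>. x \<in> I"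
proof (rule AE_I')
  show "UNIV - I \<in> null_sets \<rho>" using \<rho>_out I_open by (auto simp: null_sets_def)
qed auto

text \<open>Since \<rho> has no mass outside \<open>I\<close>, this is the primitive that vanishes
  at the left endpoint, finite or not. It is used for integrands like \<open>u1 * g\<close>,
  integrable up to the ends because both factors are in L2.\<close>

definition P :: "cfun \<Rightarrow> cfun" where "P \<phi> x = (LINT t:{..<x}|\<rho>. \<phi> t)"

lemma integrable_\<rho>:
  fixes \<phi> :: cfun
  shows "\<phi> \<in> borel_measurable borel \<Longrightarrow> integrable \<rho> \<phi> \<longleftrightarrow> integrable m (\<lambda>t. of_real (r t) * \<phi> t)"
  unfolding \<rho> by (subst integrable_density) (auto simp: r_nonneg scaleR_conv_of_real)

lemma set_integral_\<rho>:
  fixes \<phi> :: cfun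
  assumes "\<phi> \<in> borel_measurable borel" "A \<in> sets borel"
  shows "(LINT t:A|\<rho>. \<phi> t) = (LINT t:A|m. of_real (r t) * \<phi> t)"
  unfolding \<rho> set_lebesgue_integral_def using assms
  by (subst integral_density) (auto simp: r_nonneg scaleR_conv_of_real intro!: Bochner_Integration.integral_cong)

lemma integrable_\<rho>_measurable: "integrable \<rho> \<phi> \<Longrightarrow> \<phi> \<in> borel_measurable borel"
  by (drule borel_measurable_integrable) simp

lemma set_integrable_\<rho>: "integrable \<rho> \<phi> \<Longrightarrow> A \<in> sets borel \<Longrightarrow> set_integrable \<rho> A (\<phi> :: cfun)"
  unfolding set_integrable_def by (rule integrable_mult_indicator) simp_all

lemma ac_on_P:
  assumes \<phi>: "integrable \<rho> \<phi>"
  shows "ac_on m I (P \<phi>) (\<lambda>t. of_real (r t) * \<phi> t)"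
proof (rule ac_onI[OF I])
  note meas = integrable_\<rho>_measurable[OF \<phi>]
  have i: "integrable m (\<lambda>t. of_real (r t) * \<phi> t)" using \<phi> by (simp add: integrable_\<rho>[OF meas])
  have si: "set_integrable m A (\<lambda>t. of_real (r t) * \<phi> t)" if "A \<in> sets borel" for A
    unfolding set_integrable_def by (rule integrable_mult_indicator[OF _ i]) (use that in simp)
  fix x y :: real assume xy: "x \<le> y"
  show "set_integrable m {x..<y} (\<lambda>t. of_real (r t) * \<phi> t)" by (rule si) simp
  have e: "{..<y} = {..<x} \<union> {x..<y}" using xy by auto
  have "(LINT t:{..<x} \<union> {x..<y}|m. of_real (r t) * \<phi> t) =
      (LINT t:{..<x}|m. of_real (r t) * \<phi> t) + (LINT t:{x..<y}|m. of_real (r t) * \<phi> t)"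
    by (rule set_integral_Un) (use si in auto)
  then show "P \<phi> y = P \<phi> x + (LINT t:{x..<y}|m. of_real (r t) * \<phi> t)"
    unfolding P_def set_integral_\<rho>[OF meas, OF lessThan_borel] e[symmetric] .
qed

lemma P_measurable:
  assumes \<phi>: "integrable \<rho> \<phi>" shows "P \<phi> \<in> borel_measurable borel"
proof -
  note meas = integrable_\<rho>_measurable[OF \<phi>]
  have i: "integrable m (\<lambda>t. of_real (r t) * \<phi> t)" using \<phi> by (simp add: integrable_\<rho>[OF meas])
  from primitive_measurable[OF i] show ?thesis
    unfolding P_def set_integral_\<rho>[OF meas, OF lessThan_borel] .
qed

lemma P_bound:
  assumes \<phi>: "integrable \<rho> \<phi>" shows "norm (P \<phi> x) \<le> (LINT t|\<rho>. norm (\<phi> t))"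
  using set_integral_norm_mono[OF set_integrable_\<rho>[OF \<phi>], of UNIV "{..<x}"]
  by (simp add: P_def set_lebesgue_integral_def)

lemma P_comb:
  assumes "integrable \<rho> \<phi>" "integrable \<rho> \<psi>"
  shows "P (\<lambda>x. \<alpha> * \<phi> x + \<beta> * \<psi> x) x = \<alpha> * P \<phi> x + \<beta> * P \<psi> x"
  unfolding P_def
  by (subst set_integral_add) (auto intro!: set_integrable_mult_right set_integrable_\<rho> assms)

lemma P_cnj: "P (\<lambda>x. cnj (\<phi> x)) x = cnj (P \<phi> x)"
proof -
  have *: "indicator A t *\<^sub>R cnj (\<phi> t) = cnj (indicator A t *\<^sub>R \<phi> t)" for A :: "real set" and t by simp
  show ?thesis unfolding P_def set_lebesgue_integral_def * by (rule Bochner_Integration.integral_cnj)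
qed

lemma tendsto_tail:
  fixes \<phi> :: "real \<Rightarrow> 'c::{banach,second_countable_topology}"
  assumes \<phi>: "integrable \<rho> \<phi>" and A: "\<And>n. A n \<in> sets borel"
    and ev: "\<And>x. x \<in> I \<Longrightarrow> \<forall>\<^sub>F n in sequentially. x \<notin> A n"
  shows "(\<lambda>n. LINT t:A n|\<rho>. norm (\<phi> t)) \<longlonglongrightarrow> 0"
proof (rule tendsto_set_integral_vanish[where A=UNIV])
  show "set_integrable \<rho> UNIV (\<lambda>t. norm (\<phi> t))" using \<phi> by (simp add: set_integrable_def)
  show "AE t in \<rho>. t \<in> UNIV \<longrightarrow> (\<forall>\<^sub>F n in sequentially. t \<notin> A n)"
    using AE_in_I by eventually_elim (use ev in blast)
qed (use A in simp_all)

text \<open>Tails cut at points of the interval give the limits of \<open>P\<close> for finite and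
  infinite endpoints alike.\<close>

lemma small_tails:
  fixes \<phi> :: cfun
  assumes \<phi>: "integrable \<rho> \<phi>" and e: "e > 0"
  shows "\<exists>l\<in>ivl a b. (LINT t:{..<l}|\<rho>. norm (\<phi> t)) < e" "\<exists>u\<in>ivl a b. (LINT t:{u..}|\<rho>. norm (\<phi> t)) < e"
proof -
  obtain l u :: "nat \<Rightarrow> real" where lu: "\<And>n. l n \<in> ivl a b" "\<And>n. u n \<in> ivl a b"
    "\<And>x. x \<in> I \<Longrightarrow> \<forall>\<^sub>F n in sequentially. x \<in> {l n<..<u n}" using ivl_exhaustion[OF ab] unfolding Iab by blast
  have "\<forall>\<^sub>F n in sequentially. x \<notin> {..<l n}" "\<forall>\<^sub>F n in sequentially. x \<notin> {u n..}" if "x \<in> I" for x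
    using lu(3)[OF that] by (auto elim: eventually_mono)
  then have "(\<lambda>n. LINT t:{..<l n}|\<rho>. norm (\<phi> t)) \<longlonglongrightarrow> 0" "(\<lambda>n. LINT t:{u n..}|\<rho>. norm (\<phi> t)) \<longlonglongrightarrow> 0"
    by (auto intro!: tendsto_tail \<phi>)
  from this[THEN order_tendstoD(2), OF e]
  show "\<exists>l\<in>ivl a b. (LINT t:{..<l}|\<rho>. norm (\<phi> t)) < e" "\<exists>u\<in>ivl a b. (LINT t:{u..}|\<rho>. norm (\<phi> t)) < e"
    using lu(1,2) by (auto simp: eventually_sequentially)
qed

lemma P_left:
  assumes \<phi>: "integrable \<rho> \<phi>" shows "(P \<phi> \<longlongrightarrow> 0) (at_left_end a)"
proof (rule tendstoI)
  fix e :: real assume "e > 0"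
  then obtain l where l: "l \<in> ivl a b" "(LINT t:{..<l}|\<rho>. norm (\<phi> t)) < e" using small_tails(1)[OF \<phi>] by blast
  show "\<forall>\<^sub>F x in at_left_end a. dist (P \<phi> x) 0 < e"
    using eventually_at_left_end[OF l(1)]
  proof eventually_elim
    case (elim x)
    then show ?case
      using set_integral_norm_mono[OF set_integrable_\<rho>[OF \<phi>], of "{..<l}" "{..<x}"] l(2) by (simp add: P_def)
  qed
qed

lemma P_right:
  assumes \<phi>: "integrable \<rho> \<phi>" shows "(P \<phi> \<longlongrightarrow> (LINT t|\<rho>. \<phi> t)) (at_right_end b)"
proof (rule tendstoI)
  fix e :: real assume "e > 0"
  then obtain u where u: "u \<in> ivl a b" "(LINT t:{u..}|\<rho>. norm (\<phi> t)) < e" using small_tails(2)[OF \<phi>] by blast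
  show "\<forall>\<^sub>F x in at_right_end b. dist (P \<phi> x) (LINT t|\<rho>. \<phi> t) < e"
    using eventually_at_right_end[OF u(1)]
  proof eventually_elim
    case (elim x)
    have "(LINT t|\<rho>. \<phi> t) = (LINT t:{..<x} \<union> {x..}|\<rho>. \<phi> t)"
      unfolding set_lebesgue_integral_def by (rule Bochner_Integration.integral_cong) (auto simp: indicator_def)
    also have "\<dots> = P \<phi> x + (LINT t:{x..}|\<rho>. \<phi> t)"
      unfolding P_def by (rule set_integral_Un) (auto intro: set_integrable_\<rho>[OF \<phi>])
    finally have "dist (P \<phi> x) (LINT t|\<rho>. \<phi> t) = norm (LINT t:{x..}|\<rho>. \<phi> t)"
      by (simp add: dist_norm)
    then show ?case
      using set_integral_norm_mono[OF set_integrable_\<rho>[OF \<phi>], of "{u..}" "{x..}"] u(2) elim by simp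
  qed
qed

text \<open>Variation of constants: \<open>sol x1 x2 g\<close> is the solution of \<open>\<tau>f = g\<close> whose Wronskians with \<open>u1\<close> and
  \<open>u2\<close> tend to \<open>x1\<close> and \<open>x2\<close> at the left endpoint.\<close>
definition sol :: "complex \<Rightarrow> complex \<Rightarrow> cfun \<Rightarrow> cfun" where
  "sol x1 x2 g t = (x2 + P (\<lambda>t. u2 t * g t) t) * u1 t - (x1 + P (\<lambda>t. u1 t * g t) t) * u2 t"

definition sol' :: "complex \<Rightarrow> complex \<Rightarrow> cfun \<Rightarrow> cfun" where
  "sol' x1 x2 g t = (x2 + P (\<lambda>t. u2 t * g t) t) * v1 t - (x1 + P (\<lambda>t. u1 t * g t) t) * v2 t"

lemmas u_integrable = L2_mult_integrable[OF L2u(1)] L2_mult_integrable[OF L2u(2)]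

lemma sr_zero: "t \<in> I \<Longrightarrow> s t = 0 \<or> r t = 0 \<or> measure m {t} = 0"
  using sr_atom[of t] by auto

lemma sol_solves:
  assumes g: "L2 \<rho> g" shows "solves I (sol x1 x2 g) (sol' x1 x2 g) g"
proof -
  define A1 A2 where "A1 = (\<lambda>t. x1 + P (\<lambda>t. u1 t * g t) t)" and "A2 = (\<lambda>t. x2 + P (\<lambda>t. u2 t * g t) t)"
  have A: "ac_on m I A1 (\<lambda>t. of_real (r t) * (u1 t * g t))" "ac_on m I A2 (\<lambda>t. of_real (r t) * (u2 t * g t))"
    using ac_on_add[OF ac_on_const[OF I, of m x1] ac_on_P[OF u_integrable(1)[OF g]]]
      ac_on_add[OF ac_on_const[OF I, of m x2] ac_on_P[OF u_integrable(2)[OF g]]] by (simp_all add: A1_def A2_def)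
  have sol: "sol x1 x2 g = (\<lambda>t. A2 t * u1 t - A1 t * u2 t)" "sol' x1 x2 g = (\<lambda>t. A2 t * v1 t - A1 t * v2 t)"
    by (auto simp: sol_def sol'_def A1_def A2_def)
  have "ac_on m I (\<lambda>t. A2 t * u1 t) (\<lambda>t. A2 t * (of_real (s t) * v1 t) + u1 t * (of_real (r t) * (u2 t * g t)))"
    by (rule ac_on_mult_no_common_atoms[OF A(2) solvesD1[OF u1]]) (use sr_zero in fastforce)
  moreover have "ac_on m I (\<lambda>t. A1 t * u2 t) (\<lambda>t. A1 t * (of_real (s t) * v2 t) + u2 t * (of_real (r t) * (u1 t * g t)))"
    by (rule ac_on_mult_no_common_atoms[OF A(1) solvesD1[OF u2]]) (use sr_zero in fastforce)
  ultimately have 1: "ac_on m I (sol x1 x2 g) (\<lambda>t. of_real (s t) * sol' x1 x2 g t)"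
    unfolding sol by (rule ac_on_cong[OF ac_on_diff]) (auto simp: algebra_simps)
  \<comment> \<open>In contrast to the first component, the jump terms need not vanish one by one,
    as \<open>q\<close> and \<open>r\<close> may share atoms. They are the same in both products and
    cancel in the difference.\<close>
  have 2: "ac_on m I (sol' x1 x2 g) (\<lambda>t. of_real (q t) * sol x1 x2 g t - of_real (r t) * g t)"
    unfolding sol
  proof (rule ac_on_cong[OF ac_on_diff[OF ac_on_mult[OF A(2) solvesD2[OF u1]] ac_on_mult[OF A(1) solvesD2[OF u2]]]])
    fix t assume "t \<in> I"
    have "- (of_real (r t) * g t) = of_real (r t) * g t * (v1 t * u2 t - u1 t * v2 t)"
      using arg_cong[OF W[OF \<open>t \<in> I\<close>], of "\<lambda>z. of_real (r t) * g t * z"] by (simp add: algebra_simps)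
    then show "A2 t * (of_real (q t) * u1 t - of_real (r t) * 0) + v1 t * (of_real (r t) * (u2 t * g t)) +
         of_real (r t) * (u2 t * g t) * (of_real (q t) * u1 t - of_real (r t) * 0) * of_real (measure m {t}) -
         (A1 t * (of_real (q t) * u2 t - of_real (r t) * 0) + v2 t * (of_real (r t) * (u1 t * g t)) +
          of_real (r t) * (u1 t * g t) * (of_real (q t) * u2 t - of_real (r t) * 0) * of_real (measure m {t})) =
         of_real (q t) * (A2 t * u1 t - A1 t * u2 t) - of_real (r t) * g t"
      by (simp add: algebra_simps)
  qed simp
  show ?thesis using 1 2 by (simp add: solves_def)
qed

lemma I_nonempty: "\<exists>x. x \<in> I"
  using ivl_exhaustion[OF ab] Iab by metis

lemma solves_imp_sol:
  assumes f: "solves I f f1 g" and g: "L2 \<rho> g"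
  shows "\<exists>x1 x2. \<forall>t\<in>I. f t = sol x1 x2 g t \<and> f1 t = sol' x1 x2 g t"
proof -
  obtain x where x: "x \<in> I" using I_nonempty by blast
  \<comment> \<open>Chosen so that \<open>x1 + P (\<lambda>t. u1 t * g t) x\<close> is the Wronskian
    of \<open>f\<close> with \<open>u1\<close> at \<open>x\<close>, and likewise for
    \<open>x2\<close> and \<open>u2\<close>; the solution \<open>sol x1 x2 g\<close> then has the
    data of \<open>f\<close> at \<open>x\<close>.\<close>
  define x1 where "x1 = f x * v1 x - f1 x * u1 x - P (\<lambda>t. u1 t * g t) x"
  define x2 where "x2 = f x * v2 x - f1 x * u2 x - P (\<lambda>t. u2 t * g t) x"
  have "f x = sol x1 x2 g x" using arg_cong[OF W[OF x], of "\<lambda>z. f x * z"]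
    by (simp add: sol_def x1_def x2_def algebra_simps)
  moreover have "f1 x = sol' x1 x2 g x" using arg_cong[OF W[OF x], of "\<lambda>z. f1 x * z"]
    by (simp add: sol'_def x1_def x2_def algebra_simps)
  ultimately show ?thesis
    using solves_unique[OF f sol_solves[OF g] order_refl I x] by blast
qed

lemma sol_comb:
  assumes "L2 \<rho> g" "L2 \<rho> k"
  shows "\<alpha> * sol x1 x2 g t + \<beta> * sol y1 y2 k t = sol (\<alpha> * x1 + \<beta> * y1) (\<alpha> * x2 + \<beta> * y2) (\<lambda>t. \<alpha> * g t + \<beta> * k t) t"
proof -
  have "P (\<lambda>t. u1 t * (\<alpha> * g t + \<beta> * k t)) t = \<alpha> * P (\<lambda>t. u1 t * g t) t + \<beta> * P (\<lambda>t. u1 t * k t) t"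
    using P_comb[OF u_integrable(1)[OF assms(1)] u_integrable(1)[OF assms(2)]] by (simp add: algebra_simps)
  moreover have "P (\<lambda>t. u2 t * (\<alpha> * g t + \<beta> * k t)) t = \<alpha> * P (\<lambda>t. u2 t * g t) t + \<beta> * P (\<lambda>t. u2 t * k t) t"
    using P_comb[OF u_integrable(2)[OF assms(1)] u_integrable(2)[OF assms(2)]] by (simp add: algebra_simps)
  ultimately show ?thesis by (simp add: sol_def algebra_simps)
qed

lemma sol_cnj: "cnj (sol x1 x2 g t) = sol (cnj x1) (cnj x2) (\<lambda>t. cnj (g t)) t"
  using P_cnj[of "\<lambda>t. u1 t * g t" t] P_cnj[of "\<lambda>t. u2 t * g t" t] by (simp add: sol_def real)

text \<open>The coefficients of \<open>u1\<close> and \<open>u2\<close> are bounded, since both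
  functions are square-integrable up to the endpoints.\<close>

lemma L2_sol:
  assumes g: "L2 \<rho> g" shows "L2 \<rho> (sol x1 x2 g)"
proof -
  have *: "L2 \<rho> (\<lambda>t. (x + P \<phi> t) * u t)" if \<phi>: "integrable \<rho> \<phi>" and u: "L2 \<rho> u" for x \<phi> u
  proof (rule L2_dominated[OF u, where C = "norm x + (LINT t|\<rho>. norm (\<phi> t))"])
    have [measurable]: "P \<phi> \<in> borel_measurable borel" "u \<in> borel_measurable borel"
      using P_measurable[OF \<phi>] L2_measurable[OF u] by simp_all
    show "(\<lambda>t. (x + P \<phi> t) * u t) \<in> borel_measurable \<rho>" by measurable
    have "norm (x + P \<phi> t) \<le> norm x + (LINT t|\<rho>. norm (\<phi> t))" for t
      using norm_triangle_ineq[of x "P \<phi> t"] P_bound[OF \<phi>, of t] by linarith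
    then show "AE t in \<rho>. norm ((x + P \<phi> t) * u t) \<le> (norm x + (LINT t|\<rho>. norm (\<phi> t))) * norm (u t)"
      by (auto simp: norm_mult intro!: mult_right_mono)
  qed
  show ?thesis unfolding sol_def
    by (intro L2_diff * u_integrable g L2u)
qed

text \<open>The vector \<open>x\<close> lists the limits of the Wronskians of \<open>f\<close> with
  \<open>u1\<close>, \<open>u2\<close>, first at \<open>a\<close>, then at \<open>b\<close>; passing
  from one end to the other adds the total integral of \<open>u1 * g\<close> or
  \<open>u2 * g\<close>.\<close>

definition has_data :: "cfun \<Rightarrow> cfun \<Rightarrow> complex^4 \<Rightarrow> bool" where
  "has_data f g x \<longleftrightarrow> L2 \<rho> f \<and> L2 \<rho> g \<and> (\<forall>t\<in>I. f t = sol (x$1) (x$2) g t) \<and>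
     x$3 = x$1 + (LINT t|\<rho>. u1 t * g t) \<and> x$4 = x$2 + (LINT t|\<rho>. u2 t * g t)"

lemma has_data_comb:
  assumes f: "has_data f g x" and h: "has_data h k y"
  shows "has_data (\<lambda>t. \<alpha> * f t + \<beta> * h t) (\<lambda>t. \<alpha> * g t + \<beta> * k t) (\<alpha> *s x + \<beta> *s y)"
proof -
  have g: "L2 \<rho> g" and k: "L2 \<rho> k" using f h by (auto simp: has_data_def)
  have 1: "(LINT t|\<rho>. u1 t * (\<alpha> * g t + \<beta> * k t)) = \<alpha> * (LINT t|\<rho>. u1 t * g t) + \<beta> * (LINT t|\<rho>. u1 t * k t)"
    using u_integrable(1)[OF g] u_integrable(1)[OF k] by (simp add: distrib_left mult.left_commute)
  have 2: "(LINT t|\<rho>. u2 t * (\<alpha> * g t + \<beta> * k t)) = \<alpha> * (LINT t|\<rho>. u2 t * g t) + \<beta> * (LINT t|\<rho>. u2 t * k t)"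
    using u_integrable(2)[OF g] u_integrable(2)[OF k] by (simp add: distrib_left mult.left_commute)
  show ?thesis
    using f h unfolding has_data_def 1 2 by (simp add: L2_comb sol_comb distrib_left)
qed

lemma solves_has_data:
  assumes "solves I f f1 g" "L2 \<rho> f" "L2 \<rho> g"
  shows "\<exists>x. has_data f g x \<and> (\<forall>t\<in>I. f1 t = sol' (x$1) (x$2) g t)"
proof -
  obtain x1 x2 where x: "\<forall>t\<in>I. f t = sol x1 x2 g t \<and> f1 t = sol' x1 x2 g t"
    using solves_imp_sol[OF assms(1,3)] by blast
  show ?thesis
    using assms x by (auto simp: has_data_def vector_4
        intro!: exI[of _ "vector [x1, x2, x1 + (LINT t|\<rho>. u1 t * g t), x2 + (LINT t|\<rho>. u2 t * g t)]"])
qed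

lemma has_data_solves: "has_data f g x \<Longrightarrow> solves I f (sol' (x$1) (x$2) g) g"
  by (rule solves_cong[OF sol_solves]) (auto simp: has_data_def)

lemma wronskian_limits:
  fixes x1 x2 y1 y2 :: complex and g k :: cfun
  assumes f: "L2 \<rho> g" and h: "L2 \<rho> k"
  defines "w \<equiv> \<lambda>t. sol x1 x2 g t * sol' y1 y2 k t - sol' x1 x2 g t * sol y1 y2 k t"
  shows "(w \<longlongrightarrow> x1 * y2 - x2 * y1) (at_left_end a)"
    and "(w \<longlongrightarrow> (x1 + (LINT t|\<rho>. u1 t * g t)) * (y2 + (LINT t|\<rho>. u2 t * k t))
      - (x2 + (LINT t|\<rho>. u2 t * g t)) * (y1 + (LINT t|\<rho>. u1 t * k t))) (at_right_end b)"
proof -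
  define w' where "w' t = (x1 + P (\<lambda>t. u1 t * g t) t) * (y2 + P (\<lambda>t. u2 t * k t) t)
     - (x2 + P (\<lambda>t. u2 t * g t) t) * (y1 + P (\<lambda>t. u1 t * k t) t)" for t
  have w: "w' t = w t" if "t \<in> I" for t
  proof -
    \<comment> \<open>The Wronskian of two combinations of \<open>u1\<close> and \<open>u2\<close>
      is the determinant of their coefficients times the Wronskian of \<open>u1\<close> and
      \<open>u2\<close>, which is 1. Only the coefficients have to be followed to the
      endpoints.\<close>
    have "w t = (u1 t * v2 t - v1 t * u2 t) * w' t"
      unfolding w_def w'_def sol_def sol'_def by algebra
    then show ?thesis using W[OF that] by simp
  qed
  obtain x where x: "x \<in> I" using I_nonempty by blast
  have "\<forall>\<^sub>F t in at_left_end a. w' t = w t" "\<forall>\<^sub>F t in at_right_end b. w' t = w t"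
    using eventually_at_left_end[of x a b] eventually_at_right_end[of x a b] x w
    by (auto simp: Iab elim!: eventually_mono)
  moreover have "(w' \<longlongrightarrow> (x1 + 0) * (y2 + 0) - (x2 + 0) * (y1 + 0)) (at_left_end a)"
    unfolding w'_def by (intro tendsto_intros P_left u_integrable f h)
  moreover have "(w' \<longlongrightarrow> (x1 + (LINT t|\<rho>. u1 t * g t)) * (y2 + (LINT t|\<rho>. u2 t * k t))
      - (x2 + (LINT t|\<rho>. u2 t * g t)) * (y1 + (LINT t|\<rho>. u1 t * k t))) (at_right_end b)"
    unfolding w'_def by (intro tendsto_intros P_right u_integrable f h)
  ultimately show "(w \<longlongrightarrow> x1 * y2 - x2 * y1) (at_left_end a)"
    "(w \<longlongrightarrow> (x1 + (LINT t|\<rho>. u1 t * g t)) * (y2 + (LINT t|\<rho>. u2 t * k t))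
      - (x2 + (LINT t|\<rho>. u2 t * g t)) * (y1 + (LINT t|\<rho>. u1 t * k t))) (at_right_end b)"
    by (simp_all add: tendsto_cong)
qed

lemma integral_cnj_u:
  "(LINT t|\<rho>. u1 t * cnj (g t)) = cnj (LINT t|\<rho>. u1 t * g t)"
  "(LINT t|\<rho>. u2 t * cnj (g t)) = cnj (LINT t|\<rho>. u2 t * g t)"
  using Bochner_Integration.integral_cnj[of \<rho> "\<lambda>t. u1 t * g t"] Bochner_Integration.integral_cnj[of \<rho> "\<lambda>t. u2 t * g t"]
  by (simp_all add: real)

text \<open>The Wronskian and the primitive of its density differ by a constant; evaluating this
  constant at both ends and comparing gives the identity. It transports properties of the inner
  product to boundary values.\<close>

lemma lagrange:
  assumes f: "has_data f g x" and h: "has_data h k y"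
  shows "inner_L2 \<rho> g h - inner_L2 \<rho> f k = bdry_form x y"
proof -
  have L: "L2 \<rho> f" "L2 \<rho> g" "L2 \<rho> (\<lambda>t. cnj (h t))" "L2 \<rho> (\<lambda>t. cnj (k t))"
    using f h by (auto simp: has_data_def intro: L2_cnj)
  define F' where "F' = sol' (x$1) (x$2) g"
  define H where "H = sol (cnj (y$1)) (cnj (y$2)) (\<lambda>t. cnj (k t))"
  define H' where "H' = sol' (cnj (y$1)) (cnj (y$2)) (\<lambda>t. cnj (k t))"
  have eqs: "f t = sol (x$1) (x$2) g t" "cnj (h t) = H t" if "t \<in> I" for t
    using f h that sol_cnj by (auto simp: has_data_def H_def)
  have sF: "solves I f F' g" unfolding F'_def by (rule has_data_solves[OF f])
  have sH: "solves I H H' (\<lambda>t. cnj (k t))" unfolding H_def H'_def by (rule sol_solves[OF L(4)])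
  define \<phi> where "\<phi> = (\<lambda>t. cnj (h t) * g t - f t * cnj (k t))"
  have i: "integrable \<rho> \<phi>" unfolding \<phi>_def
    by (intro Bochner_Integration.integrable_diff L2_mult_integrable L)
  define w where "w = (\<lambda>t. sol (x$1) (x$2) g t * H' t - F' t * H t)"
  have "ac_on m I w (\<lambda>t. of_real (r t) * \<phi> t)"
  proof (rule ac_on_cong[OF solves_wronskian[OF order_refl sF sH]])
    fix t assume t: "t \<in> I"
    show "f t * H' t - F' t * H t = w t" by (simp add: w_def eqs(1)[OF t])
    show "of_real (r t) * (H t * g t - f t * cnj (k t)) = of_real (r t) * \<phi> t" by (simp add: \<phi>_def eqs(2)[OF t])
  qed
  from ac_on_diff[OF this ac_on_P[OF i]] have ac: "ac_on m I (\<lambda>t. w t - P \<phi> t) (\<lambda>t. 0)" by simp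
  obtain c where c: "c \<in> I" using I_nonempty by blast
  define C where "C = w c - P \<phi> c"
  have const: "w t - P \<phi> t = C" if "t \<in> I" for t
    using ac_on_eq[OF ac, of t c] ac_on_eq[OF ac, of c t] that c by (cases "t \<le> c") (auto simp: C_def)
  have ev: "\<forall>\<^sub>F t in at_left_end a. w t - P \<phi> t = C" "\<forall>\<^sub>F t in at_right_end b. w t - P \<phi> t = C"
    using eventually_at_left_end[of c a b] eventually_at_right_end[of c a b] c const
    by (auto simp: Iab elim!: eventually_mono)
  note lim = wronskian_limits[OF L(2) L(4), of "x$1" "x$2" "cnj (y$1)" "cnj (y$2)", folded H_def H'_def F'_def, folded w_def]
  have "((\<lambda>t. w t - P \<phi> t) \<longlongrightarrow> (x$1 * cnj (y$2) - x$2 * cnj (y$1)) - 0) (at_left_end a)"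
    by (intro tendsto_diff lim(1) P_left i)
  from tendsto_unique[OF at_left_end_nontrivial[OF ab] tendsto_eventually[OF ev(1)] this]
  have "C = x$1 * cnj (y$2) - x$2 * cnj (y$1)" by simp
  moreover
  have "((\<lambda>t. w t - P \<phi> t) \<longlongrightarrow> (x$3 * cnj (y$4) - x$4 * cnj (y$3)) - (LINT t|\<rho>. \<phi> t)) (at_right_end b)"
    using tendsto_diff[OF lim(2) P_right[OF i]] f h by (simp add: has_data_def integral_cnj_u)
  from tendsto_unique[OF at_right_end_nontrivial tendsto_eventually[OF ev(2)] this]
  have "C = (x$3 * cnj (y$4) - x$4 * cnj (y$3)) - (LINT t|\<rho>. \<phi> t)" .
  moreover have "(LINT t|\<rho>. \<phi> t) = inner_L2 \<rho> g h - inner_L2 \<rho> f k"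
    unfolding \<phi>_def inner_L2_def
    by (subst Bochner_Integration.integral_diff) (auto intro!: L2_mult_integrable L simp: mult.commute)
  ultimately show ?thesis by (simp add: bdry_form_def algebra_simps)
qed

end

section \<open>Linear algebra of the boundary form\<close>

lemma bdry_form_skew: "bdry_form y x = - cnj (bdry_form x y)"
  by (simp add: bdry_form_def algebra_simps)

lemma bdry_form_comb:
  "bdry_form (\<alpha> *s x + \<beta> *s y) z = \<alpha> * bdry_form x z + \<beta> * bdry_form y z"
  "bdry_form z (\<alpha> *s x + \<beta> *s y) = cnj \<alpha> * bdry_form z x + cnj \<beta> * bdry_form z y"
  by (simp_all add: bdry_form_def algebra_simps)

lemma bdry_form_zero [simp]: "bdry_form 0 x = 0" "bdry_form x 0 = 0"
  by (simp_all add: bdry_form_def)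

lemma bdry_form_nondegenerate:
  assumes "\<And>y. bdry_form x y = 0" shows "x = 0"
  using assms[of "vector [1,0,0,0]"] assms[of "vector [0,1,0,0]"] assms[of "vector [0,0,1,0]"] assms[of "vector [0,0,0,1]"]
  by (simp add: bdry_form_def vector_4 vec_eq_iff forall_4)

text \<open>A dimension count made explicit: the nonzero minor in columns \<open>i\<close>,
  \<open>j\<close> means that a vector killed by \<open>R\<close> and \<open>T\<close> is determined
  by its two other coordinates. In these \<open>v\<close> and \<open>w\<close> form a basis, and
  Cramer's rule expresses \<open>x\<close>.\<close>

lemma kernel_of_two_rows:
  fixes x v w R T :: "complex^4" and i j :: 4
  assumes R: "\<And>z. z \<in> {x, v, w} \<Longrightarrow> (\<Sum>n\<in>UNIV. R$n * z$n) = 0"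
    and T: "\<And>z. z \<in> {x, v, w} \<Longrightarrow> (\<Sum>n\<in>UNIV. T$n * z$n) = 0"
    and D: "R$i * T$j - R$j * T$i \<noteq> 0"
    and indep: "\<And>\<alpha> \<beta>. \<alpha> *s v + \<beta> *s w = 0 \<Longrightarrow> \<alpha> = 0 \<and> \<beta> = 0"
  shows "\<exists>\<alpha> \<beta>. x = \<alpha> *s v + \<beta> *s w"
proof -
  have ij: "i \<noteq> j" using D by auto
  then have "card (UNIV - {i, j}) = 2" by (simp add: card_Diff_subset)
  then obtain k l where kl: "UNIV - {i, j} = {k, l}" "k \<noteq> l" by (auto simp: card_2_iff)
  then have neq: "k \<noteq> i" "k \<noteq> j" "l \<noteq> i" "l \<noteq> j" and all: "UNIV = {i, j, k, l}" by blast+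
  have sum: "(\<Sum>n\<in>UNIV. f n) = f i + f j + f k + f l" for f :: "4 \<Rightarrow> complex"
    unfolding all using ij kl(2) neq by (simp add: neq[symmetric] ij[symmetric])
  have Z: "y = 0" if y: "y$k = 0" "y$l = 0" "y = \<gamma> *s x + \<alpha> *s v + \<beta> *s w" for y \<alpha> \<beta> \<gamma>
  proof -
    have lin: "(\<Sum>n\<in>UNIV. X$n * y$n) = \<gamma> * (\<Sum>n\<in>UNIV. X$n * x$n) + \<alpha> * (\<Sum>n\<in>UNIV. X$n * v$n) + \<beta> * (\<Sum>n\<in>UNIV. X$n * w$n)"
      for X :: "complex^4" unfolding y(3) by (simp add: sum algebra_simps)
    have 1: "R$i * y$i + R$j * y$j = 0" using lin[of R] R y(1,2) by (simp add: sum[of "\<lambda>n. R$n * y$n"])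
    have 2: "T$i * y$i + T$j * y$j = 0" using lin[of T] T y(1,2) by (simp add: sum[of "\<lambda>n. T$n * y$n"])
    have "(R$i * T$j - R$j * T$i) * y$i = T$j * (R$i * y$i + R$j * y$j) - R$j * (T$i * y$i + T$j * y$j)"
      "(R$i * T$j - R$j * T$i) * y$j = R$i * (T$i * y$i + T$j * y$j) - T$i * (R$i * y$i + R$j * y$j)"
      by (simp_all add: algebra_simps)
    then have "y$i = 0" "y$j = 0" using 1 2 D by auto
    then have "y$n = 0" for n using UNIV_I[of n, unfolded all] y(1,2) by auto
    then show ?thesis by (simp add: vec_eq_iff)
  qed
  define E where "E = v$k * w$l - v$l * w$k"
  have E: "E \<noteq> 0"
  proof
    assume E0: "E = 0"
    have *: "\<alpha> = 0 \<and> \<beta> = 0" if "\<alpha> * v$k + \<beta> * w$k = 0" "\<alpha> * v$l + \<beta> * w$l = 0" for \<alpha> \<beta>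
      by (rule indep, rule Z[where \<gamma>=0 and \<alpha>=\<alpha> and \<beta>=\<beta>]) (use that in simp_all)
    have "v$k = 0 \<and> w$k = 0" using *[of "w$k" "- v$k"] E0 by (simp add: E_def algebra_simps)
    moreover have "v$l = 0 \<and> w$l = 0" using *[of "w$l" "- v$l"] E0 by (simp add: E_def algebra_simps)
    ultimately show False using *[of 1 0] by simp
  qed
  define \<alpha> \<beta> where "\<alpha> = (x$k * w$l - x$l * w$k) / E" and "\<beta> = (v$k * x$l - v$l * x$k) / E"
  have "E * (x$k - \<alpha> * v$k - \<beta> * w$k) = E * x$k - (x$k * w$l - x$l * w$k) * v$k - (v$k * x$l - v$l * x$k) * w$k"
    "E * (x$l - \<alpha> * v$l - \<beta> * w$l) = E * x$l - (x$k * w$l - x$l * w$k) * v$l - (v$k * x$l - v$l * x$k) * w$l"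
    using E by (simp_all add: \<alpha>_def \<beta>_def right_diff_distrib)
  then have "E * (x$k - \<alpha> * v$k - \<beta> * w$k) = 0" "E * (x$l - \<alpha> * v$l - \<beta> * w$l) = 0"
    by (simp_all add: E_def algebra_simps)
  then have "x - \<alpha> *s v - \<beta> *s w = 0"
    using E by (intro Z[where \<gamma>=1 and \<alpha>="-\<alpha>" and \<beta>="-\<beta>"]) (simp_all add: vec_eq_iff)
  then show ?thesis by (intro exI[of _ \<alpha>] exI[of _ \<beta>]) (simp add: algebra_simps)
qed

text \<open>The form is nondegenerate, so the complement of two independent vectors in \<complex>^4
  is two-dimensional; isotropy places \<open>v\<close> and \<open>w\<close> inside it, and they fill
  it.\<close>

lemma isotropic_pair_spans:
  assumes indep: "\<And>\<alpha> \<beta>. \<alpha> *s v + \<beta> *s w = 0 \<Longrightarrow> \<alpha> = 0 \<and> \<beta> = 0"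
    and iso: "bdry_form v v = 0" "bdry_form w w = 0" "bdry_form v w = 0"
    and x: "bdry_form x v = 0" "bdry_form x w = 0"
  shows "\<exists>\<alpha> \<beta>. x = \<alpha> *s v + \<beta> *s w"
proof -
  define row :: "complex^4 \<Rightarrow> complex^4" where
    "row y = vector [- cnj (y$2), cnj (y$1), cnj (y$4), - cnj (y$3)]" for y
  have row: "bdry_form z y = (\<Sum>n\<in>UNIV. row y $ n * z$n)" for y z
    by (simp add: bdry_form_def row_def sum_4 vector_4 algebra_simps)
  have wv: "bdry_form w v = 0" using bdry_form_skew[of w v] iso by simp
  have R: "(\<Sum>n\<in>UNIV. row v $ n * z$n) = 0" and T: "(\<Sum>n\<in>UNIV. row w $ n * z$n) = 0" if "z \<in> {x, v, w}" for z
    using that iso x wv by (auto simp flip: row)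
  \<comment> \<open>\<open>row\<close> conjugates and permutes entries up to sign. If all minors of
    the two rows vanished, so would those of \<open>v\<close> and \<open>w\<close>, which would make
    these dependent.\<close>
  have "\<exists>i j. row v $ i * row w $ j - row v $ j * row w $ i \<noteq> 0"
  proof (rule ccontr)
    assume "\<not> ?thesis"
    then have M0: "row v $ i * row w $ j = row v $ j * row w $ i" for i j by simp
    have vw: "v$1 * w$2 = v$2 * w$1" "v$1 * w$3 = v$3 * w$1" "v$1 * w$4 = v$4 * w$1"
      "v$2 * w$3 = v$3 * w$2" "v$2 * w$4 = v$4 * w$2" "v$3 * w$4 = v$4 * w$3"
      using M0[of 1 2] M0[of 2 4] M0[of 2 3] M0[of 1 4] M0[of 1 3] M0[of 3 4]
      by (auto simp: row_def vector_4 simp flip: complex_cnj_mult)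
    have "w$i *s v + (- v$i) *s w = 0" for i
      using exhaust_4[of i] vw by (auto simp: vec_eq_iff forall_4 algebra_simps)
    then have "v$i = 0" for i using indep[of "w$i" "- v$i"] by simp
    then have "v = 0" by (simp add: vec_eq_iff)
    then show False using indep[of 1 0] by simp
  qed
  then show ?thesis using kernel_of_two_rows[OF R T _ indep] by blast
qed

lemma exists_orthogonal_not_multiple:
  assumes "v \<noteq> 0"
  shows "\<exists>x. bdry_form x v = 0 \<and> (\<forall>\<alpha>. x \<noteq> \<alpha> *s v)"
proof -
  consider (first) "v$1 = 0" "v$2 = 0" | (second) "v$3 = 0" "v$4 = 0"
    | (mixed) "v$1 \<noteq> 0 \<or> v$2 \<noteq> 0" "v$3 \<noteq> 0 \<or> v$4 \<noteq> 0" by blast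
  then show ?thesis
  proof cases
    case first
    then show ?thesis
      by (intro exI[of _ "vector [1,0,0,0]"]) (simp add: bdry_form_def vector_4 vec_eq_iff forall_4)
  next
    case second
    then show ?thesis
      by (intro exI[of _ "vector [0,0,1,0]"]) (simp add: bdry_form_def vector_4 vec_eq_iff forall_4)
  next
    case mixed
    \<comment> \<open>The left part of the form is a determinant, so the conjugated left half of
      \<open>v\<close> is orthogonal to \<open>v\<close>. It is no multiple of \<open>v\<close>: it
      is zero in the right half, where \<open>v\<close> is not, or it is nonzero in the left
      half.\<close>
    then show ?thesis
      by (intro exI[of _ "vector [cnj (v$1), cnj (v$2), 0, 0]"]) (auto simp: bdry_form_def vector_4 vec_eq_iff forall_4)
  qed
qed

text \<open>A space that is its own complement is neither zero, whose complement is everything, nor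
  a line, whose complement is larger. Two independent elements exist, and
  \<open>isotropic_pair_spans\<close> shows that they suffice.\<close>

lemma lagrangian_basis:
  assumes lin: "\<And>x y \<alpha> \<beta>. x \<in> N \<Longrightarrow> y \<in> N \<Longrightarrow> \<alpha> *s x + \<beta> *s y \<in> N"
    and N: "\<And>x. x \<in> N \<longleftrightarrow> (\<forall>y\<in>N. bdry_form x y = 0)"
  shows "\<exists>v\<in>N. \<exists>w\<in>N. (\<forall>\<alpha> \<beta>. \<alpha> *s v + \<beta> *s w = 0 \<longrightarrow> \<alpha> = 0 \<and> \<beta> = 0) \<and>
     (\<forall>x. x \<in> N \<longleftrightarrow> bdry_form x v = 0 \<and> bdry_form x w = 0)"
proof -
  have "\<exists>v\<in>N. v \<noteq> 0"
  proof (rule ccontr)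
    assume n: "\<not> ?thesis"
    then have "x \<in> N" for x using N[of x] by auto
    then have "(vector [1,0,0,0] :: complex^4) = 0" using n by blast
    then show False by (simp add: vec_eq_iff forall_4 vector_4)
  qed
  then obtain v where v: "v \<in> N" "v \<noteq> 0" by blast
  have "\<exists>w\<in>N. \<forall>\<alpha>. w \<noteq> \<alpha> *s v"
  proof (rule ccontr)
    assume n: "\<not> ?thesis"
    obtain x where x: "bdry_form x v = 0" "\<forall>\<alpha>. x \<noteq> \<alpha> *s v" using exists_orthogonal_not_multiple[OF v(2)] by blast
    have "bdry_form x y = 0" if "y \<in> N" for y
    proof -
      obtain \<alpha> where "y = \<alpha> *s v" using n \<open>y \<in> N\<close> by blast
      then show ?thesis using x(1) bdry_form_comb(2)[of x \<alpha> v 0 0] by simp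
    qed
    then have "x \<in> N" using N by blast
    then show False using n x(2) by blast
  qed
  then obtain w where w: "w \<in> N" "\<And>\<alpha>. w \<noteq> \<alpha> *s v" by blast
  have indep: "\<alpha> = 0 \<and> \<beta> = 0" if "\<alpha> *s v + \<beta> *s w = 0" for \<alpha> \<beta>
  proof -
    have "\<beta> = 0"
    proof (rule ccontr)
      assume "\<beta> \<noteq> 0"
      have "w$i = ((- \<alpha> / \<beta>) *s v)$i" for i
        using arg_cong[OF that, of "\<lambda>z. z$i"] \<open>\<beta> \<noteq> 0\<close> by (simp add: field_simps eq_neg_iff_add_eq_0)
      then have "w = (- \<alpha> / \<beta>) *s v" by (simp add: vec_eq_iff)
      then show False using w(2) by blast
    qed
    then show ?thesis using that v(2) by (auto simp: vec_eq_iff)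
  qed
  have iso: "bdry_form x y = 0" if "x \<in> N" "y \<in> N" for x y using N that by blast
  have "x \<in> N" if "bdry_form x v = 0" "bdry_form x w = 0" for x
    using isotropic_pair_spans[of v w x, OF indep] iso v(1) w(1) that lin by blast
  then show ?thesis using v(1) w(1) indep iso by blast
qed

section \<open>Minimal and maximal relation\<close>

context lc_system
begin

lemma L2_null:
  assumes "L2 \<rho> f" "(LINT t|\<rho>. (norm (f t))\<^sup>2) = 0" shows "AE t in \<rho>. f t = 0"
  using integral_nonneg_eq_0_iff_AE[OF L2_integrable_norm[OF assms(1)]] assms(2) by simp

lemma tendsto_exhaustion:
  fixes \<phi> :: "real \<Rightarrow> 'c::{banach,second_countable_topology}"
  assumes \<phi>: "integrable \<rho> \<phi>" and ev: "\<And>x. x \<in> I \<Longrightarrow> \<forall>\<^sub>F n in sequentially. x \<in> {l n<..<u n}"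
  shows "(\<lambda>n. LINT t|\<rho>. indicator {l n..<u n} t *\<^sub>R \<phi> t) \<longlonglongrightarrow> (LINT t|\<rho>. \<phi> t)"
proof (rule integral_dominated_convergence[where w="\<lambda>t. norm (\<phi> t)"])
  have [measurable]: "\<phi> \<in> borel_measurable borel" using borel_measurable_integrable[OF \<phi>] by simp
  show "\<phi> \<in> borel_measurable \<rho>" by measurable
  show "(\<lambda>t. indicat_real {l n..<u n} t *\<^sub>R \<phi> t) \<in> borel_measurable \<rho>" for n by measurable
  show "AE x in \<rho>. (\<lambda>i. indicat_real {l i..<u i} x *\<^sub>R \<phi> x) \<longlonglongrightarrow> \<phi> x"
    using AE_in_I
  proof eventually_elim
    case (elim x)
    show ?case by (rule tendsto_eventually) (use ev[OF elim] in eventually_elim, auto)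
  qed
qed (use \<phi> in \<open>auto simp: indicator_def\<close>)

lemma L2_real_null:
  assumes f: "L2 \<rho> f" "\<And>t. cnj (f t) = f t" "(LINT t|\<rho>. f t * f t) = 0"
  shows "AE t in \<rho>. f t = 0"
proof (rule L2_null[OF f(1)])
  have *: "of_real ((norm (f t))\<^sup>2) = f t * f t" for t
    using complex_norm_square[of "f t"] f(2)[of t] by simp
  have "complex_of_real (LINT t|\<rho>. (norm (f t))\<^sup>2) = (LINT t|\<rho>. of_real ((norm (f t))\<^sup>2))"
    by (rule integral_of_real[symmetric]) (rule L2_integrable_norm[OF f(1)])
  also have "\<dots> = 0" unfolding * using f(3) .
  finally show "(LINT t|\<rho>. (norm (f t))\<^sup>2) = 0" by simp
qed

lemma gram_nonzero:
  "(LINT t|\<rho>. u1 t * u1 t) * (LINT t|\<rho>. u2 t * u2 t) \<noteq> (LINT t|\<rho>. u1 t * u2 t)\<^sup>2"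
proof
  define G11 G12 G22 where "G11 = (LINT t|\<rho>. u1 t * u1 t)" and "G12 = (LINT t|\<rho>. u1 t * u2 t)" and "G22 = (LINT t|\<rho>. u2 t * u2 t)"
  note G = G11_def[symmetric] G12_def[symmetric] G22_def[symmetric]
  assume "(LINT t|\<rho>. u1 t * u1 t) * (LINT t|\<rho>. u2 t * u2 t) = (LINT t|\<rho>. u1 t * u2 t)\<^sup>2"
  then have det: "G11 * G22 = G12\<^sup>2" by (simp add: G)
  note i = u_integrable(1)[OF L2u(1)] u_integrable(1)[OF L2u(2)] u_integrable(2)[OF L2u(2)]
  have cnjG: "cnj G12 = G12" "cnj G22 = G22"
    using integral_cnj_u(1)[of u2] integral_cnj_u(2)[of u2] by (simp_all add: real G)
  \<comment> \<open>The integral of \<open>h * h\<close> is \<open>G22\<close> times the Gram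
    determinant. If that is zero, the real function \<open>h\<close> vanishes almost everywhere, and
    independence gives \<open>G22 = 0\<close>, which makes \<open>u2\<close> vanish as well.\<close>
  define h where "h = (\<lambda>t. G22 * u1 t + (- G12) * u2 t)"
  have h: "L2 \<rho> h" unfolding h_def by (rule L2_comb[OF L2u])
  have "(LINT t|\<rho>. h t * h t) = (LINT t|\<rho>. (G22 * G22) * (u1 t * u1 t) + (-2 * G12 * G22) * (u1 t * u2 t) + (G12 * G12) * (u2 t * u2 t))"
    by (rule Bochner_Integration.integral_cong) (auto simp: h_def algebra_simps)
  also have "\<dots> = (G22 * G22) * G11 + (-2 * G12 * G22) * G12 + (G12 * G12) * G22"
    using i by (simp add: G)
  also have "\<dots> = 0" using det by (simp add: algebra_simps power2_eq_square)
  finally have "AE t in \<rho>. h t = 0"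
    by (intro L2_real_null[OF h]) (simp_all add: h_def cnjG real)
  then have "G22 = 0" using indep[of G22 "- G12"] by (simp add: h_def)
  then have "AE t in \<rho>. u2 t = 0" by (intro L2_real_null L2u real) (simp add: G)
  then show False using indep[of 0 1] by simp
qed

definition dual_on :: "real \<Rightarrow> real \<Rightarrow> cfun \<Rightarrow> cfun \<Rightarrow> bool" where
  "dual_on l u \<phi>1 \<phi>2 \<longleftrightarrow> L2 \<rho> \<phi>1 \<and> L2 \<rho> \<phi>2 \<and> l \<in> I \<and> u \<in> I \<and> (\<forall>t. t \<notin> {l..<u} \<longrightarrow> \<phi>1 t = 0 \<and> \<phi>2 t = 0) \<and>
    (LINT t|\<rho>. u1 t * \<phi>1 t) = 1 \<and> (LINT t|\<rho>. u2 t * \<phi>1 t) = 0 \<and>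
    (LINT t|\<rho>. u1 t * \<phi>2 t) = 0 \<and> (LINT t|\<rho>. u2 t * \<phi>2 t) = 1"

text \<open>Works because the Gram determinants over an exhausting sequence of compact intervals converge to a nonzero limit.\<close>
lemma exists_dual: "\<exists>l u \<phi>1 \<phi>2. dual_on l u \<phi>1 \<phi>2"
proof -
  obtain l u where lu: "\<And>n. l n \<in> I" "\<And>n. u n \<in> I"
    "\<And>x. x \<in> I \<Longrightarrow> \<forall>\<^sub>F n in sequentially. x \<in> {l n<..<u n}" using ivl_exhaustion[OF ab] unfolding Iab by blast
  define e where "e n = (indicator {l n..<u n} :: real \<Rightarrow> complex)" for n
  have e: "indicator {l n..<u n} t *\<^sub>R z = e n t * z" for n t and z :: complex by (simp add: e_def indicator_def)
  define G11 G12 G22 where "G11 n = (LINT t|\<rho>. e n t * (u1 t * u1 t))" and "G12 n = (LINT t|\<rho>. e n t * (u1 t * u2 t))"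
    and "G22 n = (LINT t|\<rho>. e n t * (u2 t * u2 t))" for n
  note i = u_integrable(1)[OF L2u(1)] u_integrable(1)[OF L2u(2)] u_integrable(2)[OF L2u(2)]
  have "(\<lambda>n. G11 n * G22 n - (G12 n)\<^sup>2) \<longlonglongrightarrow>
    (LINT t|\<rho>. u1 t * u1 t) * (LINT t|\<rho>. u2 t * u2 t) - (LINT t|\<rho>. u1 t * u2 t)\<^sup>2"
    unfolding G11_def G12_def G22_def
    by (intro tendsto_intros tendsto_exhaustion[OF i(1) lu(3), unfolded e] tendsto_exhaustion[OF i(2) lu(3), unfolded e]
         tendsto_exhaustion[OF i(3) lu(3), unfolded e])
  then have "\<forall>\<^sub>F n in sequentially. G11 n * G22 n - (G12 n)\<^sup>2 \<noteq> 0"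
    by (rule tendsto_imp_eventually_ne) (use gram_nonzero in simp)
  then obtain n where D: "G11 n * G22 n - (G12 n)\<^sup>2 \<noteq> 0" by (auto simp: eventually_sequentially)
  define d where "d = G11 n * G22 n - (G12 n)\<^sup>2"
  define \<phi> where "\<phi> \<alpha> \<beta> = (\<lambda>t. e n t * (\<alpha> * u1 t + \<beta> * u2 t))" for \<alpha> \<beta>
  have i': "integrable \<rho> (\<lambda>t. e n t * (u1 t * u1 t))" "integrable \<rho> (\<lambda>t. e n t * (u1 t * u2 t))" "integrable \<rho> (\<lambda>t. e n t * (u2 t * u2 t))"
    using i by (auto simp flip: e intro!: integrable_mult_indicator)
  have L: "L2 \<rho> (\<phi> \<alpha> \<beta>)" for \<alpha> \<beta> unfolding \<phi>_def e_def by (intro L2_indicator L2_comb L2u) simp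
  have 1: "(LINT t|\<rho>. u1 t * \<phi> \<alpha> \<beta> t) = \<alpha> * G11 n + \<beta> * G12 n" for \<alpha> \<beta>
  proof -
    have "(LINT t|\<rho>. u1 t * \<phi> \<alpha> \<beta> t) = (LINT t|\<rho>. \<alpha> * (e n t * (u1 t * u1 t)) + \<beta> * (e n t * (u1 t * u2 t)))"
      by (rule Bochner_Integration.integral_cong) (auto simp: \<phi>_def algebra_simps)
    then show ?thesis using i' by (simp add: G11_def G12_def)
  qed
  have 2: "(LINT t|\<rho>. u2 t * \<phi> \<alpha> \<beta> t) = \<alpha> * G12 n + \<beta> * G22 n" for \<alpha> \<beta>
  proof -
    have "(LINT t|\<rho>. u2 t * \<phi> \<alpha> \<beta> t) = (LINT t|\<rho>. \<alpha> * (e n t * (u1 t * u2 t)) + \<beta> * (e n t * (u2 t * u2 t)))"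
      by (rule Bochner_Integration.integral_cong) (auto simp: \<phi>_def algebra_simps)
    then show ?thesis using i' by (simp add: G12_def G22_def)
  qed
  have d: "d \<noteq> 0" using D by (simp add: d_def)
  \<comment> \<open>The coefficients are the columns of the inverse of the truncated Gram
    matrix.\<close>
  have "(LINT t|\<rho>. u1 t * \<phi> (G22 n / d) (- G12 n / d) t) = 1" "(LINT t|\<rho>. u2 t * \<phi> (G22 n / d) (- G12 n / d) t) = 0"
    "(LINT t|\<rho>. u1 t * \<phi> (- G12 n / d) (G11 n / d) t) = 0" "(LINT t|\<rho>. u2 t * \<phi> (- G12 n / d) (G11 n / d) t) = 1"
    using d by (simp_all add: 1 2 divide_simps) (simp_all add: d_def algebra_simps power2_eq_square)
  moreover have "\<phi> \<alpha> \<beta> t = 0" if "t \<notin> {l n..<u n}" for \<alpha> \<beta> t using that by (simp add: \<phi>_def e_def)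
  ultimately show ?thesis unfolding dual_on_def using L lu(1,2) by blast
qed

text \<open>The values at the left end are free parameters of \<open>sol\<close>; the values at the
  right end exceed them by integrals against \<open>g\<close>, which the dual functions set to any
  prescribed numbers.\<close>

lemma has_data_surj: "\<exists>f g. has_data f g x"
proof -
  obtain l u \<phi>1 \<phi>2 where "dual_on l u \<phi>1 \<phi>2" using exists_dual by blast
  note \<phi> = this[unfolded dual_on_def]
  define A B where "A = x$3 - x$1" and "B = x$4 - x$2"
  have L: "L2 \<rho> \<phi>1" "L2 \<rho> \<phi>2" using \<phi> by auto
  define g where "g = (\<lambda>t. A * \<phi>1 t + B * \<phi>2 t)"
  have g: "L2 \<rho> g" unfolding g_def by (rule L2_comb[OF L])
  have "(LINT t|\<rho>. u1 t * g t) = (LINT t|\<rho>. A * (u1 t * \<phi>1 t) + B * (u1 t * \<phi>2 t))"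
    "(LINT t|\<rho>. u2 t * g t) = (LINT t|\<rho>. A * (u2 t * \<phi>1 t) + B * (u2 t * \<phi>2 t))"
    by (auto simp: g_def algebra_simps intro!: Bochner_Integration.integral_cong)
  then have "(LINT t|\<rho>. u1 t * g t) = A" "(LINT t|\<rho>. u2 t * g t) = B"
    using u_integrable(1)[OF L(1)] u_integrable(1)[OF L(2)] u_integrable(2)[OF L(1)] u_integrable(2)[OF L(2)] \<phi>
    by simp_all
  then have "has_data (sol (x$1) (x$2) g) g x"
    using g L2_sol[OF g] by (simp add: has_data_def A_def B_def)
  then show ?thesis by blast
qed

text \<open>Near each endpoint both \<open>f\<close> and its quasi-derivative vanish, hence so do
  its Wronskians with all solutions of the homogeneous equation, and these exhibit the four boundary
  values.\<close>

lemma compact_support_data: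
  assumes f: "has_data f g x" and K: "compact K" "K \<subseteq> I" "\<And>t. t \<in> I - K \<Longrightarrow> f t = 0"
  shows "x = 0"
proof -
  have L: "L2 \<rho> g" using f by (simp add: has_data_def)
  note sf = has_data_solves[OF f]
  obtain l u where lu: "l \<in> I" "u \<in> I" "K \<subseteq> {l..u}"
  proof (cases "K = {}")
    case True
    then show ?thesis using that I_nonempty by blast
  next
    case False
    obtain p where p: "p \<in> K" "\<forall>t\<in>K. p \<le> t" using compact_attains_inf[OF K(1) False] by blast
    obtain q where q: "q \<in> K" "\<forall>t\<in>K. t \<le> q" using compact_attains_sup[OF K(1) False] by blast
    show ?thesis by (rule that[of p q]) (use p q K(2) in auto)
  qed
  have quasi: "sol' (x$1) (x$2) g t = 0" if "t \<in> I" "t < l \<or> u < t" for t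
  proof -
    obtain e where e: "e > 0" "cball t e \<subseteq> I" using I_open \<open>t \<in> I\<close> open_contains_cball by blast
    \<comment> \<open>Small enough that the neighbourhood of \<open>t\<close> stays in
      \<open>I\<close> and does not cross \<open>l\<close> or \<open>u\<close>.\<close>
    define d where "d = min e (if t < l then l - t else t - u)"
    have d: "d > 0" "d \<le> e" "t + d \<le> l \<or> u \<le> t - d" using e that by (auto simp: d_def)
    have J: "t - d \<in> I" "t + d \<in> I" using e(2) d by (auto simp: dist_real_def subset_iff)
    show ?thesis
    proof (rule solves_zero_quasi[OF sf order_refl J])
      fix z assume z: "t - d < z" "z < t + d"
      have "z \<in> cball t e" using z d by (auto simp: dist_real_def)
      moreover have "z \<notin> K" using lu(3) z d(3) by auto
      ultimately show "f z = 0" using K(3) e(2) by blast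
    qed (use d in auto)
  qed
  have "w t = 0" if "t \<in> I" "t < l \<or> u < t"
    and "w = (\<lambda>t. sol (x$1) (x$2) g t * sol' y1 y2 (\<lambda>_. 0) t - sol' (x$1) (x$2) g t * sol y1 y2 (\<lambda>_. 0) t)" for t y1 y2 and w :: cfun
    using quasi[OF that(1,2)] K(3)[of t] lu(3) that f by (force simp: has_data_def)
  then have ev: "\<forall>\<^sub>F t in at_left_end a. sol (x$1) (x$2) g t * sol' y1 y2 (\<lambda>_. 0) t - sol' (x$1) (x$2) g t * sol y1 y2 (\<lambda>_. 0) t = 0"
    "\<forall>\<^sub>F t in at_right_end b. sol (x$1) (x$2) g t * sol' y1 y2 (\<lambda>_. 0) t - sol' (x$1) (x$2) g t * sol y1 y2 (\<lambda>_. 0) t = 0" for y1 y2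
    using eventually_at_left_end[of l a b] eventually_at_right_end[of u a b] lu
    by (auto simp: Iab elim!: eventually_mono)
  have "x$1 * y2 - x$2 * y1 = 0" for y1 y2
    by (rule tendsto_unique[OF at_left_end_nontrivial[OF ab] wronskian_limits(1)[OF L L2_zero] tendsto_eventually[OF ev(1)]])
  from this[of 0 1] this[of 1 0] have "x$1 = 0" "x$2 = 0" by simp_all
  moreover have "x$3 * y2 - x$4 * y1 = 0" for y1 y2
    using tendsto_unique[OF at_right_end_nontrivial wronskian_limits(2)[OF L L2_zero] tendsto_eventually[OF ev(2)]] f
    by (simp add: has_data_def)
  from this[of 0 1] this[of 1 0] have "x$3 = 0" "x$4 = 0" by simp_all
  ultimately show ?thesis by (simp add: vec_eq_iff forall_4)
qed

end

section \<open>Inner product and saturation modulo null sets\<close>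

lemma sat_cong_AE:
  "(f, g) \<in> sat \<rho> R \<longleftrightarrow> L2 \<rho> f \<and> L2 \<rho> g \<and> (\<exists>f' g'. (f', g') \<in> R \<and> (AE x in \<rho>. f x = f' x \<and> g x = g' x))"
  by (auto simp: sat_def)

lemma inner_L2_cong_AE:
  assumes "L2 \<rho> f" "L2 \<rho> f'" "L2 \<rho> g" "L2 \<rho> g'" "AE x in \<rho>. f x = f' x" "AE x in \<rho>. g x = g' x"
  shows "inner_L2 \<rho> f g = inner_L2 \<rho> f' g'"
  unfolding inner_L2_def
proof (rule integral_cong_AE)
  note [measurable] = L2_measurable[OF assms(1)] L2_measurable[OF assms(2)]
    L2_measurable[OF L2_cnj[OF assms(3)]] L2_measurable[OF L2_cnj[OF assms(4)]]
  show "(\<lambda>x. f x * cnj (g x)) \<in> borel_measurable \<rho>" "(\<lambda>x. f' x * cnj (g' x)) \<in> borel_measurable \<rho>"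
    by measurable
  show "AE x in \<rho>. f x * cnj (g x) = f' x * cnj (g' x)"
    using assms(5,6) by eventually_elim simp
qed

lemma inner_L2_comb_left:
  assumes "L2 \<rho> f" "L2 \<rho> g" "L2 \<rho> h"
  shows "inner_L2 \<rho> (\<lambda>x. \<alpha> * f x + \<beta> * g x) h = \<alpha> * inner_L2 \<rho> f h + \<beta> * inner_L2 \<rho> g h"
proof -
  have "inner_L2 \<rho> (\<lambda>x. \<alpha> * f x + \<beta> * g x) h = (LINT x|\<rho>. \<alpha> * (f x * cnj (h x)) + \<beta> * (g x * cnj (h x)))"
    unfolding inner_L2_def by (rule Bochner_Integration.integral_cong) (auto simp: algebra_simps)
  then show ?thesis using L2_mult_integrable[OF assms(1) L2_cnj[OF assms(3)]] L2_mult_integrable[OF assms(2) L2_cnj[OF assms(3)]]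
    by (simp add: inner_L2_def)
qed

lemma inner_L2_bound:
  assumes "L2 \<rho> f" "L2 \<rho> h"
  shows "(norm (inner_L2 \<rho> f h))\<^sup>2 \<le> (LINT x|\<rho>. (norm (f x))\<^sup>2) * (LINT x|\<rho>. (norm (h x))\<^sup>2)"
  using L2_Cauchy_Schwarz[OF assms(1) L2_cnj[OF assms(2)]] by (simp add: inner_L2_def)

lemma tendsto_inner_L2:
  assumes f: "L2 \<rho> f" and F: "\<And>n. L2 \<rho> (F n)" and h: "L2 \<rho> h"
    and lim: "(\<lambda>n. LINT x|\<rho>. (norm (F n x - f x))\<^sup>2) \<longlonglongrightarrow> 0"
  shows "(\<lambda>n. inner_L2 \<rho> (F n) h) \<longlonglongrightarrow> inner_L2 \<rho> f h"
proof -
  have eq: "inner_L2 \<rho> (F n) h - inner_L2 \<rho> f h = inner_L2 \<rho> (\<lambda>x. F n x - f x) h" for n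
    using inner_L2_comb_left[OF F f h, of 1 n "-1"] by simp
  have "(\<lambda>n. (norm (inner_L2 \<rho> (F n) h - inner_L2 \<rho> f h))\<^sup>2) \<longlonglongrightarrow> 0"
  proof (rule tendsto_sandwich[OF _ _ tendsto_const])
    show "\<forall>\<^sub>F n in sequentially. 0 \<le> (norm (inner_L2 \<rho> (F n) h - inner_L2 \<rho> f h))\<^sup>2" by simp
    show "\<forall>\<^sub>F n in sequentially. (norm (inner_L2 \<rho> (F n) h - inner_L2 \<rho> f h))\<^sup>2 \<le>
       (LINT x|\<rho>. (norm (F n x - f x))\<^sup>2) * (LINT x|\<rho>. (norm (h x))\<^sup>2)"
      unfolding eq by (intro always_eventually allI inner_L2_bound L2_diff F f h)
    show "(\<lambda>n. (LINT x|\<rho>. (norm (F n x - f x))\<^sup>2) * (LINT x|\<rho>. (norm (h x))\<^sup>2)) \<longlonglongrightarrow> 0"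
      by (rule tendsto_mult_left_zero[OF lim])
  qed
  then have "(\<lambda>n. norm (inner_L2 \<rho> (F n) h - inner_L2 \<rho> f h)) \<longlonglongrightarrow> 0"
    by (simp add: tendsto_power_zero power_tendsto_0_iff)
  then show ?thesis by (simp add: tendsto_norm_zero_iff LIM_zero_iff)
qed

context lc_system
begin

text \<open>\<open>TM\<close>, \<open>TC\<close> and \<open>TMIN\<close> are \<open>Tmax\<close>,
  \<open>T0\<close> and \<open>Tmin\<close> described through boundary data; the identification is
  \<open>Tmax_eq\<close>, \<open>T0_eq\<close> and \<open>Tmin_eq\<close>.\<close>

definition TM :: "(cfun \<times> cfun) set" where "TM = {(f, g). \<exists>x. has_data f g x}"

definition TC :: "(cfun \<times> cfun) set" where
  "TC = {(f, g) \<in> TM. \<exists>K. compact K \<and> K \<subseteq> I \<and> (\<forall>x\<in>I - K. f x = 0)}"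

definition TMIN :: "(cfun \<times> cfun) set" where
  "TMIN = {(f, g). L2 \<rho> f \<and> L2 \<rho> g \<and> (\<exists>s. (\<forall>n. s n \<in> TC) \<and>
     ((\<lambda>n. LINT x|\<rho>. (norm (fst (s n) x - f x))\<^sup>2) \<longlonglongrightarrow> 0) \<and>
     ((\<lambda>n. LINT x|\<rho>. (norm (snd (s n) x - g x))\<^sup>2) \<longlonglongrightarrow> 0))}"

lemma TC_data: "(f, g) \<in> TC \<Longrightarrow> has_data f g 0"
  using compact_support_data by (fastforce simp: TC_def TM_def)

lemma P_Cauchy_Schwarz:
  assumes f: "L2 \<rho> f" and g: "L2 \<rho> g"
  shows "(norm (P (\<lambda>t. f t * g t) x))\<^sup>2 \<le> (LINT x|\<rho>. (norm (f x))\<^sup>2) * (LINT x|\<rho>. (norm (g x))\<^sup>2)"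
proof -
  have 1: "P (\<lambda>t. f t * g t) x = (LINT t|\<rho>. f t * (indicator {..<x} t * g t))"
    unfolding P_def set_lebesgue_integral_def
    by (rule Bochner_Integration.integral_cong) (auto simp: indicator_def)
  have L: "L2 \<rho> (\<lambda>t. indicator {..<x} t * g t)" by (rule L2_indicator[OF g]) simp
  have "(LINT t|\<rho>. (norm (indicator {..<x} t * g t))\<^sup>2) \<le> (LINT x|\<rho>. (norm (g x))\<^sup>2)"
    by (rule integral_mono[OF L2_integrable_norm[OF L] L2_integrable_norm[OF g]]) (auto simp: indicator_def)
  then show ?thesis unfolding 1
    by (intro order_trans[OF L2_Cauchy_Schwarz[OF f L]] mult_left_mono) simp_all
qed

text \<open>Boundedness in L2 of the operator from \<open>g\<close> to its solution with zero data
  at the left end. It transfers convergence from right-hand sides to solutions.\<close>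

lemma sol_bound:
  assumes h: "L2 \<rho> h"
  shows "(LINT t|\<rho>. (norm (sol 0 0 h t))\<^sup>2) \<le>
    4 * (LINT t|\<rho>. (norm (u1 t))\<^sup>2) * (LINT t|\<rho>. (norm (u2 t))\<^sup>2) * (LINT t|\<rho>. (norm (h t))\<^sup>2)"
proof -
  define U1 U2 H where "U1 = (LINT t|\<rho>. (norm (u1 t))\<^sup>2)" and "U2 = (LINT t|\<rho>. (norm (u2 t))\<^sup>2)"
    and "H = (LINT t|\<rho>. (norm (h t))\<^sup>2)"
  have "(norm (sol 0 0 h t))\<^sup>2 \<le> 2 * (U2 * H) * (norm (u1 t))\<^sup>2 + 2 * (U1 * H) * (norm (u2 t))\<^sup>2" for t
  proof -
    define X Y where "X = norm (P (\<lambda>t. u2 t * h t) t * u1 t)" and "Y = norm (P (\<lambda>t. u1 t * h t) t * u2 t)"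
    have "norm (sol 0 0 h t) \<le> X + Y"
      unfolding sol_def X_def Y_def by (simp add: norm_triangle_ineq4)
    then have "(norm (sol 0 0 h t))\<^sup>2 \<le> (X + Y)\<^sup>2" by (rule power_mono) simp
    also have "\<dots> \<le> 2 * X\<^sup>2 + 2 * Y\<^sup>2" using sum_squares_bound[of X Y] by (simp add: power2_sum)
    also have "X\<^sup>2 \<le> (U2 * H) * (norm (u1 t))\<^sup>2"
      unfolding X_def norm_mult power_mult_distrib U2_def H_def
      by (intro mult_right_mono P_Cauchy_Schwarz L2u h) simp
    also have "Y\<^sup>2 \<le> (U1 * H) * (norm (u2 t))\<^sup>2"
      unfolding Y_def norm_mult power_mult_distrib U1_def H_def
      by (intro mult_right_mono P_Cauchy_Schwarz L2u h) simp
    finally show ?thesis by simp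
  qed
  then have "(LINT t|\<rho>. (norm (sol 0 0 h t))\<^sup>2) \<le> (LINT t|\<rho>. 2 * (U2 * H) * (norm (u1 t))\<^sup>2 + 2 * (U1 * H) * (norm (u2 t))\<^sup>2)"
    by (intro integral_mono L2_integrable_norm L2_sol h Bochner_Integration.integrable_add integrable_mult_right L2u)
  also have "\<dots> = 4 * U1 * U2 * H"
    using L2_integrable_norm[OF L2u(1)] L2_integrable_norm[OF L2u(2)] by (simp add: U1_def U2_def)
  finally show ?thesis by (simp add: U1_def U2_def H_def)
qed

text \<open>Up to \<open>l\<close> the coefficients in \<open>sol\<close> are integrals over
  nothing; beyond \<open>u\<close> they have reached the total integrals, which are zero by
  orthogonality.\<close>

lemma orthogonal_in_TC:
  assumes g: "L2 \<rho> g" and lu: "l \<in> I" "u \<in> I" "\<And>t. t \<notin> {l..<u} \<Longrightarrow> g t = 0"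
    and orth: "(LINT t|\<rho>. u1 t * g t) = 0" "(LINT t|\<rho>. u2 t * g t) = 0"
  shows "(sol 0 0 g, g) \<in> TC"
proof -
  have d: "has_data (sol 0 0 g) g 0" using g orth by (simp add: has_data_def L2_sol)
  have P0: "P (\<lambda>t. v t * g t) x = (if x \<le> l then 0 else (LINT t|\<rho>. v t * g t))" if "x \<notin> {l..u}" for v x
  proof (cases "x \<le> l")
    case True
    have "P (\<lambda>t. v t * g t) x = (LINT t|\<rho>. 0)"
      unfolding P_def set_lebesgue_integral_def
      by (rule Bochner_Integration.integral_cong) (use True lu(3) in \<open>auto simp: indicator_def\<close>)
    with True show ?thesis by simp
  next
    case False
    then have "P (\<lambda>t. v t * g t) x = (LINT t|\<rho>. v t * g t)"
      unfolding P_def set_lebesgue_integral_def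
      by (intro Bochner_Integration.integral_cong) (use that lu(3) in \<open>auto simp: indicator_def\<close>)
    with False show ?thesis by simp
  qed
  have "{l..u} \<subseteq> I" using ac_on_interval[OF solvesD1[OF u1] lu(1,2)] by auto
  moreover have "sol 0 0 g x = 0" if "x \<notin> {l..u}" for x
    using P0[OF that] orth by (simp add: sol_def)
  ultimately have "\<exists>K. compact K \<and> K \<subseteq> I \<and> (\<forall>x\<in>I - K. sol 0 0 g x = 0)"
    by (intro exI[of _ "{l..u}"]) blast
  then show "(sol 0 0 g, g) \<in> TC" using d unfolding TC_def TM_def by blast
qed

text \<open>Removes the integrals against \<open>u1\<close> and \<open>u2\<close> at the cost of
  multiples of the fixed compactly supported dual functions, so compact support is kept.\<close>

definition compl :: "cfun \<Rightarrow> cfun \<Rightarrow> cfun \<Rightarrow> cfun" where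
  "compl \<phi>1 \<phi>2 k = (\<lambda>t. k t - (LINT t|\<rho>. u1 t * k t) * \<phi>1 t - (LINT t|\<rho>. u2 t * k t) * \<phi>2 t)"

lemma compl_in_TC:
  assumes dual: "dual_on l0 u0 \<phi>1 \<phi>2" and k: "L2 \<rho> k" and lu: "l \<in> I" "u \<in> I" "\<And>t. t \<notin> {l..<u} \<Longrightarrow> k t = 0"
  shows "L2 \<rho> (compl \<phi>1 \<phi>2 k)" "(sol 0 0 (compl \<phi>1 \<phi>2 k), compl \<phi>1 \<phi>2 k) \<in> TC"
proof -
  note \<phi> = dual[unfolded dual_on_def]
  have L: "L2 \<rho> \<phi>1" "L2 \<rho> \<phi>2" using \<phi> by auto
  show G: "L2 \<rho> (compl \<phi>1 \<phi>2 k)" unfolding compl_def by (intro L2_diff L2_cmult k L)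
  have lin: "(LINT t|\<rho>. v t * (k t - A * \<phi>1 t - B * \<phi>2 t)) = (LINT t|\<rho>. v t * k t) - A * (LINT t|\<rho>. v t * \<phi>1 t) - B * (LINT t|\<rho>. v t * \<phi>2 t)"
    if "L2 \<rho> v" for v A B
  proof -
    have "(LINT t|\<rho>. v t * (k t - A * \<phi>1 t - B * \<phi>2 t)) = (LINT t|\<rho>. v t * k t - A * (v t * \<phi>1 t) - B * (v t * \<phi>2 t))"
      by (rule Bochner_Integration.integral_cong) (auto simp: algebra_simps)
    then show ?thesis
      using L2_mult_integrable[OF that k] L2_mult_integrable[OF that L(1)] L2_mult_integrable[OF that L(2)] by simp
  qed
  show "(sol 0 0 (compl \<phi>1 \<phi>2 k), compl \<phi>1 \<phi>2 k) \<in> TC"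
  proof (rule orthogonal_in_TC[OF G, of "min l l0" "max u u0"])
    show "min l l0 \<in> I" "max u u0 \<in> I" using lu \<phi> by (auto simp: min_def max_def)
    show "compl \<phi>1 \<phi>2 k t = 0" if "t \<notin> {min l l0..<max u u0}" for t
    proof -
      have "t \<notin> {l..<u}" "t \<notin> {l0..<u0}" using that by auto
      then show ?thesis using \<phi> lu(3) unfolding compl_def by simp
    qed
    show "(LINT t|\<rho>. u1 t * compl \<phi>1 \<phi>2 k t) = 0" "(LINT t|\<rho>. u2 t * compl \<phi>1 \<phi>2 k t) = 0"
      using \<phi> unfolding compl_def lin[OF L2u(1)] lin[OF L2u(2)] by simp_all
  qed
qed

text \<open>Truncating \<open>g\<close> to a compact interval destroys its orthogonality to
  \<open>u1\<close> and \<open>u2\<close>; \<open>compl\<close> restores it with coefficients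
  \<open>A n\<close> and \<open>B n\<close> that tend to zero because the full integrals are zero.
  \<open>sol_bound\<close> carries the convergence over to \<open>f\<close>.\<close>

lemma zero_data_in_TMIN:
  assumes f: "has_data f g 0" shows "(f, g) \<in> TMIN"
proof -
  have L: "L2 \<rho> f" "L2 \<rho> g" using f by (auto simp: has_data_def)
  have orth: "(LINT t|\<rho>. u1 t * g t) = 0" "(LINT t|\<rho>. u2 t * g t) = 0" using f by (auto simp: has_data_def)
  obtain l0 u0 \<phi>1 \<phi>2 where dual: "dual_on l0 u0 \<phi>1 \<phi>2" using exists_dual by blast
  then have \<phi>: "L2 \<rho> \<phi>1" "L2 \<rho> \<phi>2" by (auto simp: dual_on_def)
  obtain l u where lu: "\<And>n. l n \<in> I" "\<And>n. u n \<in> I"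
    "\<And>x. x \<in> I \<Longrightarrow> \<forall>\<^sub>F n in sequentially. x \<in> {l n<..<u n}" using ivl_exhaustion[OF ab] unfolding Iab by blast
  define k where "k n = (\<lambda>t. indicator {l n..<u n} t * g t)" for n
  have k: "L2 \<rho> (k n)" for n unfolding k_def by (rule L2_indicator[OF L(2)]) simp
  define A where "A n = (LINT t|\<rho>. u1 t * k n t)" for n
  define B where "B n = (LINT t|\<rho>. u2 t * k n t)" for n
  define G where "G n = compl \<phi>1 \<phi>2 (k n)" for n
  have G: "L2 \<rho> (G n)" and GC: "(sol 0 0 (G n), G n) \<in> TC" for n
    unfolding G_def by (rule compl_in_TC[OF dual k lu(1)[of n] lu(2)[of n]]; simp add: k_def)+
  have eqk: "v t * k n t = indicator {l n..<u n} t *\<^sub>R (v t * g t)" for v n t by (simp add: k_def indicator_def)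
  have A0: "A \<longlonglongrightarrow> 0" and B0: "B \<longlonglongrightarrow> 0"
    using tendsto_exhaustion[OF u_integrable(1)[OF L(2)] lu(3)] tendsto_exhaustion[OF u_integrable(2)[OF L(2)] lu(3)]
    unfolding A_def B_def eqk by (simp_all add: orth)
  define T where "T n = (LINT t:{..<l n} \<union> {u n..}|\<rho>. norm ((norm (g t))\<^sup>2))" for n
  have T0: "T \<longlonglongrightarrow> 0"
    unfolding T_def
  proof (rule tendsto_tail)
    show "integrable \<rho> (\<lambda>t. (norm (g t))\<^sup>2)" by (rule L2_integrable_norm[OF L(2)])
    fix x assume "x \<in> I"
    from lu(3)[OF this] show "\<forall>\<^sub>F n in sequentially. x \<notin> {..<l n} \<union> {u n..}" by eventually_elim auto
  qed simp
  define F1 F2 where "F1 = (LINT t|\<rho>. (norm (\<phi>1 t))\<^sup>2)" and "F2 = (LINT t|\<rho>. (norm (\<phi>2 t))\<^sup>2)"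
  have Gg: "L2 \<rho> (\<lambda>t. G n t - g t)" for n by (rule L2_diff[OF G L(2)])
  have bound: "(LINT t|\<rho>. (norm (G n t - g t))\<^sup>2) \<le> 3 * T n + 3 * (norm (A n))\<^sup>2 * F1 + 3 * (norm (B n))\<^sup>2 * F2" for n
  proof -
    define t1 where "t1 = (\<lambda>t. indicator ({..<l n} \<union> {u n..}) t * g t)"
    have t1: "L2 \<rho> t1" unfolding t1_def by (rule L2_indicator[OF L(2)]) simp
    have T1: "T n = (LINT t|\<rho>. (norm (t1 t))\<^sup>2)"
      unfolding T_def t1_def set_lebesgue_integral_def
      by (rule Bochner_Integration.integral_cong) (auto simp: indicator_def norm_power)
    have "(norm (G n t - g t))\<^sup>2 \<le> 3 * (norm (t1 t))\<^sup>2 + 3 * (norm (A n))\<^sup>2 * (norm (\<phi>1 t))\<^sup>2 + 3 * (norm (B n))\<^sup>2 * (norm (\<phi>2 t))\<^sup>2" for t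
    proof -
      define X Y Z where "X = norm (t1 t)" and "Y = norm (A n * \<phi>1 t)" and "Z = norm (B n * \<phi>2 t)"
      have "G n t - g t = - (t1 t + A n * \<phi>1 t + B n * \<phi>2 t)"
        by (auto simp: G_def compl_def A_def B_def k_def t1_def indicator_def)
      then have "norm (G n t - g t) \<le> X + Y + Z"
        unfolding X_def Y_def Z_def by (simp only: norm_minus_cancel) (meson norm_triangle_le norm_triangle_ineq add_right_mono)
      then have "(norm (G n t - g t))\<^sup>2 \<le> (X + Y + Z)\<^sup>2" by (rule power_mono) simp
      also have "\<dots> \<le> 3 * X\<^sup>2 + 3 * Y\<^sup>2 + 3 * Z\<^sup>2"
        using sum_squares_bound[of X Y] sum_squares_bound[of X Z] sum_squares_bound[of Y Z]
        by (simp add: power2_eq_square algebra_simps)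
      finally show ?thesis by (simp add: X_def Y_def Z_def norm_mult power_mult_distrib)
    qed
    then have "(LINT t|\<rho>. (norm (G n t - g t))\<^sup>2) \<le> (LINT t|\<rho>. 3 * (norm (t1 t))\<^sup>2 + 3 * (norm (A n))\<^sup>2 * (norm (\<phi>1 t))\<^sup>2 + 3 * (norm (B n))\<^sup>2 * (norm (\<phi>2 t))\<^sup>2)"
      by (intro integral_mono L2_integrable_norm Gg Bochner_Integration.integrable_add integrable_mult_right t1 \<phi>)
    also have "\<dots> = 3 * T n + 3 * (norm (A n))\<^sup>2 * F1 + 3 * (norm (B n))\<^sup>2 * F2"
      using L2_integrable_norm[OF t1] L2_integrable_norm[OF \<phi>(1)] L2_integrable_norm[OF \<phi>(2)] by (simp add: T1 F1_def F2_def)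
    finally show ?thesis .
  qed
  have limG: "(\<lambda>n. LINT t|\<rho>. (norm (G n t - g t))\<^sup>2) \<longlonglongrightarrow> 0"
  proof (rule tendsto_sandwich[OF _ _ tendsto_const])
    show "\<forall>\<^sub>F n in sequentially. (LINT t|\<rho>. (norm (G n t - g t))\<^sup>2) \<le> 3 * T n + 3 * (norm (A n))\<^sup>2 * F1 + 3 * (norm (B n))\<^sup>2 * F2"
      using bound by simp
    have "(\<lambda>n. 3 * T n + 3 * (norm (A n))\<^sup>2 * F1 + 3 * (norm (B n))\<^sup>2 * F2) \<longlonglongrightarrow> 3 * 0 + 3 * (norm (0::complex))\<^sup>2 * F1 + 3 * (norm (0::complex))\<^sup>2 * F2"
      by (intro tendsto_intros T0 A0 B0)
    then show "(\<lambda>n. 3 * T n + 3 * (norm (A n))\<^sup>2 * F1 + 3 * (norm (B n))\<^sup>2 * F2) \<longlonglongrightarrow> 0" by simp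
  qed simp
  define C where "C = 4 * (LINT t|\<rho>. (norm (u1 t))\<^sup>2) * (LINT t|\<rho>. (norm (u2 t))\<^sup>2)"
  have boundF: "(LINT t|\<rho>. (norm (sol 0 0 (G n) t - f t))\<^sup>2) \<le> C * (LINT t|\<rho>. (norm (G n t - g t))\<^sup>2)" for n
  proof -
    have "AE t in \<rho>. (norm (sol 0 0 (G n) t - f t))\<^sup>2 = (norm (sol 0 0 (\<lambda>t. G n t - g t) t))\<^sup>2"
      using AE_in_I
    proof eventually_elim
      case (elim t)
      then have "f t = sol 0 0 g t" using f by (simp add: has_data_def)
      then show ?case using sol_comb[OF G[of n] L(2), of 1 0 0 t "-1" 0 0] by simp
    qed
    then have "(LINT t|\<rho>. (norm (sol 0 0 (G n) t - f t))\<^sup>2) = (LINT t|\<rho>. (norm (sol 0 0 (\<lambda>t. G n t - g t) t))\<^sup>2)"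
      by (intro integral_cong_AE borel_measurable_integrable[OF L2_integrable_norm] L2_sol L2_diff G L)
    also have "\<dots> \<le> C * (LINT t|\<rho>. (norm (G n t - g t))\<^sup>2)" unfolding C_def by (rule sol_bound[OF Gg])
    finally show ?thesis .
  qed
  have limF: "(\<lambda>n. LINT t|\<rho>. (norm (sol 0 0 (G n) t - f t))\<^sup>2) \<longlonglongrightarrow> 0"
  proof (rule tendsto_sandwich[OF _ _ tendsto_const])
    show "\<forall>\<^sub>F n in sequentially. (LINT t|\<rho>. (norm (sol 0 0 (G n) t - f t))\<^sup>2) \<le> C * (LINT t|\<rho>. (norm (G n t - g t))\<^sup>2)"
      using boundF by simp
    show "(\<lambda>n. C * (LINT t|\<rho>. (norm (G n t - g t))\<^sup>2)) \<longlonglongrightarrow> 0" by (rule tendsto_mult_right_zero[OF limG])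
  qed simp
  show ?thesis unfolding TMIN_def using L GC limF limG
    by (auto intro!: exI[of _ "\<lambda>n. (sol 0 0 (G n), G n)"])
qed

text \<open>Lagrange's identity writes \<open>bdry_form x y\<close> by inner products, which pass to
  the limit from compactly supported elements and give zero. Every \<open>y\<close> occurs as data,
  so nondegeneracy applies.\<close>

lemma TMIN_zero_data:
  assumes f: "has_data f g x" and m: "(f, g) \<in> TMIN" shows "x = 0"
proof (rule bdry_form_nondegenerate)
  fix y
  obtain h k where h: "has_data h k y" using has_data_surj by blast
  have L: "L2 \<rho> f" "L2 \<rho> g" "L2 \<rho> h" "L2 \<rho> k" using f h by (auto simp: has_data_def)
  obtain s where s: "\<And>n. s n \<in> TC" "(\<lambda>n. LINT x|\<rho>. (norm (fst (s n) x - f x))\<^sup>2) \<longlonglongrightarrow> 0"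
    "(\<lambda>n. LINT x|\<rho>. (norm (snd (s n) x - g x))\<^sup>2) \<longlonglongrightarrow> 0" using m by (auto simp: TMIN_def)
  have d: "has_data (fst (s n)) (snd (s n)) 0" for n using TC_data[of "fst (s n)" "snd (s n)"] s(1)[of n] by simp
  have "inner_L2 \<rho> (snd (s n)) h - inner_L2 \<rho> (fst (s n)) k = 0" for n using lagrange[OF d h] by simp
  moreover have "(\<lambda>n. inner_L2 \<rho> (snd (s n)) h - inner_L2 \<rho> (fst (s n)) k) \<longlonglongrightarrow> inner_L2 \<rho> g h - inner_L2 \<rho> f k"
    using d by (intro tendsto_diff tendsto_inner_L2 L s) (auto simp: has_data_def)
  ultimately have "inner_L2 \<rho> g h - inner_L2 \<rho> f k = 0" by (simp add: LIMSEQ_const_iff)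
  then show "bdry_form x y = 0" using lagrange[OF f h] by simp
qed

text \<open>Subtracting the particular solution reduces the claim to the fact that an element orthogonal to all compactly
  supported functions orthogonal to \<open>u1\<close>, \<open>u2\<close> is a combination of \<open>u1\<close> and \<open>u2\<close>.\<close>
lemma adjoint_TC:
  assumes "(f, g) \<in> adjoint \<rho> TC" shows "(f, g) \<in> sat \<rho> TM"
proof -
  have L: "L2 \<rho> f" "L2 \<rho> g" and adj: "\<And>h k. (h, k) \<in> TC \<Longrightarrow> inner_L2 \<rho> g h = inner_L2 \<rho> f k"
    using assms by (auto simp: adjoint_def)
  define f0 where "f0 = sol 0 0 g"
  have f0: "L2 \<rho> f0" unfolding f0_def by (rule L2_sol[OF L(2)])
  obtain z where z: "has_data f0 g z"
    using solves_has_data[OF sol_solves[OF L(2)] f0[unfolded f0_def] L(2)] f0_def by blast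
  define d where "d = (\<lambda>t. f t - f0 t)"
  have d: "L2 \<rho> d" unfolding d_def by (rule L2_diff[OF L(1) f0])
  obtain l0 u0 \<phi>1 \<phi>2 where dual: "dual_on l0 u0 \<phi>1 \<phi>2" using exists_dual by blast
  then have \<phi>: "L2 \<rho> \<phi>1" "L2 \<rho> \<phi>2" by (auto simp: dual_on_def)
  \<comment> \<open>If \<open>d\<close> is a combination of \<open>u1\<close> and \<open>u2\<close>,
    duality shows that these are its coefficients.\<close>
  define d1 d2 where "d1 = inner_L2 \<rho> d \<phi>1" and "d2 = inner_L2 \<rho> d \<phi>2"
  define d0 where "d0 = (\<lambda>t. d t - (d1 * u1 t + d2 * u2 t))"
  have d0: "L2 \<rho> d0" unfolding d0_def by (intro L2_diff d L2_comb L2u)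
  have orth: "inner_L2 \<rho> d0 k = 0" if k: "L2 \<rho> k" and lu: "l \<in> I" "u \<in> I" "\<And>t. t \<notin> {l..<u} \<Longrightarrow> k t = 0" for k l u
  proof -
    define A B where "A = (LINT t|\<rho>. u1 t * k t)" and "B = (LINT t|\<rho>. u2 t * k t)"
    define k' where "k' = compl \<phi>1 \<phi>2 k"
    have k': "L2 \<rho> k'" and TC: "(sol 0 0 k', k') \<in> TC"
      unfolding k'_def by (rule compl_in_TC[OF dual k lu]; assumption)+
    have "inner_L2 \<rho> f k' = inner_L2 \<rho> f0 k'"
      using adj[OF TC] lagrange[OF z TC_data[OF TC]] by simp
    then have "inner_L2 \<rho> d k' = 0"
      using inner_L2_comb_left[OF L(1) f0 k', of 1 "-1"] by (simp add: d_def)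
    moreover have "inner_L2 \<rho> d k' = inner_L2 \<rho> d k - cnj A * d1 - cnj B * d2"
    proof -
      have "inner_L2 \<rho> d k' = (LINT t|\<rho>. d t * cnj (k t) - cnj A * (d t * cnj (\<phi>1 t)) - cnj B * (d t * cnj (\<phi>2 t)))"
        unfolding inner_L2_def by (rule Bochner_Integration.integral_cong) (auto simp: k'_def compl_def A_def B_def algebra_simps)
      also have "\<dots> = inner_L2 \<rho> d k - cnj A * d1 - cnj B * d2"
        using L2_mult_integrable[OF d L2_cnj[OF k]] L2_mult_integrable[OF d L2_cnj[OF \<phi>(1)]] L2_mult_integrable[OF d L2_cnj[OF \<phi>(2)]]
        by (simp add: inner_L2_def d1_def d2_def)
      finally show ?thesis .
    qed
    moreover have "inner_L2 \<rho> d0 k = inner_L2 \<rho> d k - d1 * cnj A - d2 * cnj B"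
    proof -
      have "inner_L2 \<rho> d0 k = (LINT t|\<rho>. d t * cnj (k t) - d1 * (u1 t * cnj (k t)) - d2 * (u2 t * cnj (k t)))"
        unfolding inner_L2_def by (rule Bochner_Integration.integral_cong) (auto simp: d0_def algebra_simps)
      also have "\<dots> = inner_L2 \<rho> d k - d1 * cnj A - d2 * cnj B"
        using L2_mult_integrable[OF d L2_cnj[OF k]] u_integrable(1)[OF L2_cnj[OF k]] u_integrable(2)[OF L2_cnj[OF k]]
        by (simp add: inner_L2_def A_def B_def integral_cnj_u)
      finally show ?thesis .
    qed
    ultimately show ?thesis by (simp add: mult.commute)
  qed
  obtain l u where lu: "\<And>n. l n \<in> I" "\<And>n. u n \<in> I"
    "\<And>x. x \<in> I \<Longrightarrow> \<forall>\<^sub>F n in sequentially. x \<in> {l n<..<u n}" using ivl_exhaustion[OF ab] unfolding Iab by blast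
  have "AE t in \<rho>. d0 t = 0"
  proof (rule L2_null[OF d0])
    have i: "integrable \<rho> (\<lambda>t. d0 t * cnj (d0 t))" by (rule L2_mult_integrable[OF d0 L2_cnj[OF d0]])
    have "(\<lambda>n. LINT t|\<rho>. indicator {l n..<u n} t *\<^sub>R (d0 t * cnj (d0 t))) \<longlonglongrightarrow> (LINT t|\<rho>. d0 t * cnj (d0 t))"
      by (rule tendsto_exhaustion[OF i lu(3)])
    \<comment> \<open>The test function is the truncation of \<open>d0\<close> itself; exhausting
      the interval then gives \<open>d0\<close> norm zero.\<close>
    moreover have "(LINT t|\<rho>. indicator {l n..<u n} t *\<^sub>R (d0 t * cnj (d0 t))) = 0" for n
    proof -
      have "(LINT t|\<rho>. indicator {l n..<u n} t *\<^sub>R (d0 t * cnj (d0 t))) = inner_L2 \<rho> d0 (\<lambda>t. indicator {l n..<u n} t * d0 t)"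
        unfolding inner_L2_def by (rule Bochner_Integration.integral_cong) (auto simp: indicator_def)
      also have "\<dots> = 0" by (rule orth[OF L2_indicator[OF d0] lu(1)[of n] lu(2)[of n]]) auto
      finally show ?thesis .
    qed
    ultimately have "(LINT t|\<rho>. d0 t * cnj (d0 t)) = 0" by (simp add: LIMSEQ_const_iff)
    moreover have "(LINT t|\<rho>. d0 t * cnj (d0 t)) = of_real (LINT t|\<rho>. (norm (d0 t))\<^sup>2)"
      unfolding complex_norm_square[symmetric] by (rule integral_of_real) (rule L2_integrable_norm[OF d0])
    ultimately show "(LINT t|\<rho>. (norm (d0 t))\<^sup>2) = 0" by simp
  qed
  \<comment> \<open>In \<open>sol x1 x2 g\<close> the free coefficient of \<open>u1\<close> is
    \<open>x2\<close> and that of \<open>u2\<close> is \<open>- x1\<close>, whence the order and the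
    sign of the arguments.\<close>
  moreover have "d0 t = f t - sol (- d2) d1 g t" for t
    by (simp add: d0_def d_def f0_def sol_def algebra_simps)
  ultimately have "AE t in \<rho>. f t = sol (- d2) d1 g t \<and> g t = g t" by simp
  moreover have "(sol (- d2) d1 g, g) \<in> TM"
    unfolding TM_def using solves_has_data[OF sol_solves[OF L(2)] L2_sol[OF L(2)] L(2)] by blast
  ultimately show ?thesis using L unfolding sat_cong_AE by blast
qed

end

section \<open>Self-adjoint restrictions\<close>

context lc_system
begin

lemma TM_data: "(f, g) \<in> TM \<longleftrightarrow> (\<exists>x. has_data f g x)"
  by (simp add: TM_def)

lemma inner_data_AE:
  assumes "has_data f' g' x" "has_data h' k' y" and fg: "L2 \<rho> f" "L2 \<rho> g" and hk: "L2 \<rho> h" "L2 \<rho> k"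
    and "AE t in \<rho>. f t = f' t \<and> g t = g' t" "AE t in \<rho>. h t = h' t \<and> k t = k' t"
  shows "inner_L2 \<rho> g h - inner_L2 \<rho> f k = bdry_form x y"
proof -
  have "L2 \<rho> f'" "L2 \<rho> g'" "L2 \<rho> h'" "L2 \<rho> k'" using assms(1,2) by (auto simp: has_data_def)
  then have "inner_L2 \<rho> g h = inner_L2 \<rho> g' h'" "inner_L2 \<rho> f k = inner_L2 \<rho> f' k'"
    by (auto intro!: inner_L2_cong_AE fg hk intro: AE_mp[OF assms(7)] AE_mp[OF assms(8)])
  then show ?thesis using lagrange[OF assms(1,2)] by simp
qed

text \<open>An adjoint does not see null sets, so a self-adjoint relation contains all
  representatives of its elements, among them those which carry boundary values.\<close>

lemma adjoint_saturated:
  assumes "(f', g') \<in> adjoint \<rho> R" "R \<subseteq> {(f, g). L2 \<rho> f \<and> L2 \<rho> g}" "L2 \<rho> f" "L2 \<rho> g"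
    "AE t in \<rho>. f t = f' t \<and> g t = g' t"
  shows "(f, g) \<in> adjoint \<rho> R"
proof -
  have L: "L2 \<rho> f'" "L2 \<rho> g'" using assms(1) by (auto simp: adjoint_def)
  have "inner_L2 \<rho> g u = inner_L2 \<rho> f v" if uv: "(u, v) \<in> R" for u v
  proof -
    have Luv: "L2 \<rho> u" "L2 \<rho> v" using assms(2) uv by auto
    have "inner_L2 \<rho> g u = inner_L2 \<rho> g' u" "inner_L2 \<rho> f v = inner_L2 \<rho> f' v"
      by (auto intro!: inner_L2_cong_AE L Luv assms intro: AE_mp[OF assms(5)])
    then show ?thesis using assms(1) uv by (auto simp: adjoint_def)
  qed
  then show ?thesis using assms(3,4) by (auto simp: adjoint_def)
qed

text \<open>Self-adjointness of \<open>S\<close> amounts to its set of boundary values being its own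
  complement. In one direction a basis of this set gives \<open>v\<close> and \<open>w\<close>; in
  the other \<open>S\<close> contains \<open>TC\<close>, which confines its adjoint to
  \<open>TM\<close>, and testing with \<open>v\<close> and \<open>w\<close> yields the boundary
  conditions.\<close>

lemma self_adjoint_iff:
  "S \<subseteq> sat \<rho> TM \<and> adjoint \<rho> S = S \<longleftrightarrow>
    (\<exists>v gv w gw x y. has_data v gv x \<and> has_data w gw y \<and>
       (\<forall>\<alpha> \<beta>. (\<lambda>t. \<alpha> * v t + \<beta> * w t, \<lambda>t. \<alpha> * gv t + \<beta> * gw t) \<in> TMIN \<longrightarrow> \<alpha> = 0 \<and> \<beta> = 0) \<and>
       bdry_form x x = 0 \<and> bdry_form y y = 0 \<and> bdry_form x y = 0 \<and>
       S = sat \<rho> {(f, g). \<exists>z. has_data f g z \<and> bdry_form z x = 0 \<and> bdry_form z y = 0})"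
  (is "?L \<longleftrightarrow> ?R")
proof
  assume ?L
  then have sub: "S \<subseteq> sat \<rho> TM" and adj: "adjoint \<rho> S = S" by auto
  have SL: "S \<subseteq> {(f, g). L2 \<rho> f \<and> L2 \<rho> g}" using sub by (auto simp: sat_def)
  \<comment> \<open>Boundary values of those elements of \<open>S\<close> whose given
    representatives lie in \<open>TM\<close>; by \<open>rep\<close> each element of \<open>S\<close>
    agrees almost everywhere with such a pair in \<open>S\<close>.\<close>
  define N where "N = {z. \<exists>f g. (f, g) \<in> S \<and> has_data f g z}"
  have rep: "\<exists>f' g' z. (f', g') \<in> S \<and> has_data f' g' z \<and> (AE t in \<rho>. f t = f' t \<and> g t = g' t)" if fg: "(f, g) \<in> S" for f g
  proof -
    obtain f' g' where fg': "(f', g') \<in> TM" "AE t in \<rho>. f t = f' t \<and> g t = g' t" using subsetD[OF sub fg] unfolding sat_cong_AE by blast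
    then obtain z where z: "has_data f' g' z" by (auto simp: TM_data)
    have ae: "AE t in \<rho>. f' t = f t \<and> g' t = g t" using fg'(2) by eventually_elim auto
    have "(f', g') \<in> S"
      using adjoint_saturated[OF _ SL _ _ ae] z fg adj by (auto simp: has_data_def)
    then show ?thesis using z fg'(2) by blast
  qed
  have orth: "bdry_form x y = 0" if "x \<in> N" "y \<in> N" for x y
  proof -
    obtain f g h k where fg: "(f, g) \<in> S" "has_data f g x" and hk: "(h, k) \<in> S" "has_data h k y"
      using \<open>x \<in> N\<close> \<open>y \<in> N\<close> unfolding N_def by blast
    have "(f, g) \<in> adjoint \<rho> S" using fg(1) adj by simp
    then have "inner_L2 \<rho> g h = inner_L2 \<rho> f k" using hk(1) by (auto simp: adjoint_def)
    then show ?thesis using lagrange[OF fg(2) hk(2)] by simp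
  qed
  have in_S: "(f, g) \<in> S" if fg: "has_data f g z" and z: "\<And>y. y \<in> N \<Longrightarrow> bdry_form z y = 0" for f g z
  proof -
    have L: "L2 \<rho> f" "L2 \<rho> g" using fg by (auto simp: has_data_def)
    have "inner_L2 \<rho> g h = inner_L2 \<rho> f k" if hk: "(h, k) \<in> S" for h k
    proof -
      obtain h' k' y where y: "(h', k') \<in> S" "has_data h' k' y" "AE t in \<rho>. h t = h' t \<and> k t = k' t"
        using rep[OF hk] by blast
      have "y \<in> N" using y by (auto simp: N_def)
      moreover have "L2 \<rho> h" "L2 \<rho> k" using SL hk by auto
      ultimately show ?thesis using inner_data_AE[OF fg y(2) L _ _ _ y(3)] z by auto
    qed
    then show ?thesis using L adj by (auto simp: adjoint_def)
  qed
  have N: "z \<in> N \<longleftrightarrow> (\<forall>y\<in>N. bdry_form z y = 0)" for z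
  proof
    assume "\<forall>y\<in>N. bdry_form z y = 0"
    moreover obtain f g where "has_data f g z" using has_data_surj by blast
    ultimately show "z \<in> N" using in_S[of f g z] by (auto simp: N_def)
  qed (use orth in blast)
  have lin: "\<alpha> *s x + \<beta> *s y \<in> N" if "x \<in> N" "y \<in> N" for x y \<alpha> \<beta>
    using that by (subst N) (simp add: bdry_form_comb orth)
  obtain x y where xy: "x \<in> N" "y \<in> N" and indep: "\<And>\<alpha> \<beta>. \<alpha> *s x + \<beta> *s y = 0 \<Longrightarrow> \<alpha> = 0 \<and> \<beta> = 0"
    and Nxy: "\<And>z. z \<in> N \<longleftrightarrow> bdry_form z x = 0 \<and> bdry_form z y = 0"
    using lagrangian_basis[OF lin N] by blast
  obtain v gv w gw where v: "has_data v gv x" and w: "has_data w gw y" using xy unfolding N_def by blast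
  have "S = sat \<rho> {(f, g). \<exists>z. has_data f g z \<and> bdry_form z x = 0 \<and> bdry_form z y = 0}" (is "S = sat \<rho> ?B")
  proof (intro subset_antisym subrelI)
    fix f g assume fg: "(f, g) \<in> S"
    then obtain f' g' z where z: "(f', g') \<in> S" "has_data f' g' z" "AE t in \<rho>. f t = f' t \<and> g t = g' t" using rep by blast
    then have "z \<in> N" by (auto simp: N_def)
    then have "(f', g') \<in> ?B" using z(2) Nxy by blast
    moreover have "L2 \<rho> f" "L2 \<rho> g" using SL fg by auto
    ultimately show "(f, g) \<in> sat \<rho> ?B" using z(3) unfolding sat_cong_AE by blast
  next
    fix f g assume "(f, g) \<in> sat \<rho> ?B"
    then obtain f' g' z where L: "L2 \<rho> f" "L2 \<rho> g" and z: "has_data f' g' z" "bdry_form z x = 0" "bdry_form z y = 0"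
      and ae: "AE t in \<rho>. f t = f' t \<and> g t = g' t" unfolding sat_cong_AE by blast
    have "z \<in> N" using Nxy z by blast
    then have "(f', g') \<in> adjoint \<rho> S" using in_S[OF z(1)] orth adj by blast
    from adjoint_saturated[OF this SL L ae] show "(f, g) \<in> S" using adj by simp
  qed
  moreover have "\<alpha> = 0 \<and> \<beta> = 0" if "(\<lambda>t. \<alpha> * v t + \<beta> * w t, \<lambda>t. \<alpha> * gv t + \<beta> * gw t) \<in> TMIN" for \<alpha> \<beta>
    using indep TMIN_zero_data[OF has_data_comb[OF v w] that] .
  ultimately show ?R using v w orth xy by blast
next
  assume ?R
  then obtain v gv w gw x y where v: "has_data v gv x" and w: "has_data w gw y"
    and min: "\<And>\<alpha> \<beta>. (\<lambda>t. \<alpha> * v t + \<beta> * w t, \<lambda>t. \<alpha> * gv t + \<beta> * gw t) \<in> TMIN \<Longrightarrow> \<alpha> = 0 \<and> \<beta> = 0"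
    and iso: "bdry_form x x = 0" "bdry_form y y = 0" "bdry_form x y = 0"
    and S: "S = sat \<rho> {(f, g). \<exists>z. has_data f g z \<and> bdry_form z x = 0 \<and> bdry_form z y = 0}" by blast
  have indep: "\<alpha> = 0 \<and> \<beta> = 0" if "\<alpha> *s x + \<beta> *s y = 0" for \<alpha> \<beta>
    using zero_data_in_TMIN[of "\<lambda>t. \<alpha> * v t + \<beta> * w t" "\<lambda>t. \<alpha> * gv t + \<beta> * gw t"] has_data_comb[OF v w, of \<alpha> \<beta>] min that by simp
  have yx: "bdry_form y x = 0" using bdry_form_skew[of y x] iso by simp
  have S': "(f, g) \<in> S \<longleftrightarrow> L2 \<rho> f \<and> L2 \<rho> g \<and> (\<exists>f' g' z. has_data f' g' z \<and> bdry_form z x = 0 \<and> bdry_form z y = 0 \<and>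
      (AE t in \<rho>. f t = f' t \<and> g t = g' t))" for f g
    unfolding S sat_cong_AE by blast
  have inS: "(f, g) \<in> S" if "has_data f g z" "bdry_form z x = 0" "bdry_form z y = 0" for f g z
  proof -
    have "AE t in \<rho>. f t = f t \<and> g t = g t" "L2 \<rho> f" "L2 \<rho> g" using that(1) by (simp_all add: has_data_def)
    then show ?thesis unfolding S' using that by blast
  qed
  have sub: "S \<subseteq> sat \<rho> TM"
  proof (rule subrelI)
    fix f g assume "(f, g) \<in> S"
    then show "(f, g) \<in> sat \<rho> TM" unfolding S' sat_cong_AE TM_data by blast
  qed
  have "adjoint \<rho> S = S"
  proof (intro subset_antisym subrelI)
    fix f g assume fg: "(f, g) \<in> S"
    then obtain f' g' z where L: "L2 \<rho> f" "L2 \<rho> g" and z: "has_data f' g' z" "bdry_form z x = 0" "bdry_form z y = 0"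
      "AE t in \<rho>. f t = f' t \<and> g t = g' t" unfolding S' by blast
    have "inner_L2 \<rho> g h = inner_L2 \<rho> f k" if hk: "(h, k) \<in> S" for h k
    proof -
      obtain h' k' z' where L': "L2 \<rho> h" "L2 \<rho> k" and z': "has_data h' k' z'" "bdry_form z' x = 0" "bdry_form z' y = 0"
        "AE t in \<rho>. h t = h' t \<and> k t = k' t" using hk unfolding S' by blast
      \<comment> \<open>The boundary conditions cut out the span of \<open>x\<close> and
        \<open>y\<close>, so the data of any two elements of \<open>S\<close> are
        orthogonal.\<close>
      obtain \<alpha> \<beta> where "z' = \<alpha> *s x + \<beta> *s y"
        using isotropic_pair_spans[OF indep iso z'(2,3)] by blast
      then have "bdry_form z z' = 0" using z by (simp add: bdry_form_comb)
      then show ?thesis using inner_data_AE[OF z(1) z'(1) L L' z(4) z'(4)] by simp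
    qed
    then show "(f, g) \<in> adjoint \<rho> S" using L by (auto simp: adjoint_def)
  next
    fix f g assume fg: "(f, g) \<in> adjoint \<rho> S"
    then have L: "L2 \<rho> f" "L2 \<rho> g" and orth: "\<And>h k. (h, k) \<in> S \<Longrightarrow> inner_L2 \<rho> g h = inner_L2 \<rho> f k" by (auto simp: adjoint_def)
    have "(h, k) \<in> S" if "(h, k) \<in> TC" for h k using inS[OF TC_data[OF that]] by simp
    then have "(f, g) \<in> adjoint \<rho> TC" using L orth by (auto simp: adjoint_def)
    from adjoint_TC[OF this] obtain f' g' z where z: "has_data f' g' z" "AE t in \<rho>. f t = f' t \<and> g t = g' t"
      by (auto simp: sat_cong_AE TM_data)
    have vw: "(v, gv) \<in> S" "(w, gw) \<in> S" using inS[OF v] inS[OF w] iso yx by auto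
    have Lv: "L2 \<rho> v" "L2 \<rho> gv" "L2 \<rho> w" "L2 \<rho> gw" using v w by (auto simp: has_data_def)
    have "bdry_form z x = 0" "bdry_form z y = 0"
      using inner_data_AE[OF z(1) v L Lv(1,2) z(2)] inner_data_AE[OF z(1) w L Lv(3,4) z(2)] orth[OF vw(1)] orth[OF vw(2)] by auto
    then show "(f, g) \<in> S" unfolding S' using L z by blast
  qed
  with sub show ?L by blast
qed

end

section \<open>Reduction to densities with respect to a common measure\<close>

definition sum_measure :: "'a measure list \<Rightarrow> 'a measure \<Rightarrow> 'a measure" where
  "sum_measure Ms M = measure_of (space M) (sets M) (\<lambda>A. \<Sum>N\<leftarrow>Ms. emeasure N A)"

lemma sets_sum_measure [simp]: "sets (sum_measure Ms M) = sets M"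
  by (simp add: sum_measure_def)

lemma emeasure_sum_measure:
  assumes sets: "\<And>N. N \<in> set Ms \<Longrightarrow> sets N = sets M" and A: "A \<in> sets M"
  shows "emeasure (sum_measure Ms M) A = (\<Sum>N\<leftarrow>Ms. emeasure N A)"
  unfolding sum_measure_def
proof (rule emeasure_measure_of_sigma[OF sets.sigma_algebra_axioms _ _ A])
  show "positive (sets M) (\<lambda>A. \<Sum>N\<leftarrow>Ms. emeasure N A)"
    by (auto simp: positive_def sum_list_0)
  show "countably_additive (sets M) (\<lambda>A. \<Sum>N\<leftarrow>Ms. emeasure N A)"
    unfolding countably_additive_def
  proof (intro allI impI)
    fix A :: "nat \<Rightarrow> 'a set" assume A: "range A \<subseteq> sets M" "disjoint_family A"
    show "(\<Sum>i. \<Sum>N\<leftarrow>Ms. emeasure N (A i)) = (\<Sum>N\<leftarrow>Ms. emeasure N (\<Union>(range A)))"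
      using sets
    proof (induction Ms)
      case (Cons N Ms)
      have "(\<Sum>i. emeasure N (A i)) = emeasure N (\<Union>(range A))"
        by (rule suminf_emeasure) (use A Cons.prems in auto)
      then show ?case using Cons by (simp flip: suminf_add)
    qed simp
  qed
qed

context
  fixes a b :: ereal
  assumes ab: "a < b"
begin

lemma pos_lf_sigma_finite:
  assumes N: "pos_lf_measure a b N" shows "sigma_finite_measure N"
proof
  have sN: "sets N = sets borel" using N by (simp add: pos_lf_measure_def)
  obtain l u :: "nat \<Rightarrow> real" where lu: "\<And>n. l n \<in> ivl a b" "\<And>n. u n \<in> ivl a b"
    "\<And>x. x \<in> ivl a b \<Longrightarrow> \<forall>\<^sub>F n in sequentially. x \<in> {l n<..<u n}" using ivl_exhaustion[OF ab] by blast
  define C where "C = insert (UNIV - ivl a b) (range (\<lambda>n. {l n..u n}))"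
  have "{l n..u n} \<subseteq> ivl a b" for n by (rule ivl_Icc_subset[OF lu(1,2)])
  then have "emeasure N K \<noteq> \<infinity>" if "K \<in> C" for K
    using that N by (auto simp: C_def pos_lf_measure_def less_top)
  moreover have "x \<in> \<Union>C" for x
  proof (cases "x \<in> ivl a b")
    case True
    then obtain n where "x \<in> {l n<..<u n}" using lu(3)[OF True] by (auto simp: eventually_sequentially)
    then have "x \<in> {l n..u n}" by auto
    then show ?thesis unfolding C_def by blast
  qed (auto simp: C_def)
  moreover have "C \<subseteq> sets N"
    unfolding C_def sN insert_subset image_subset_iff using borel_open[OF open_ivl[of a b]] by simp
  moreover have "countable C" by (simp add: C_def)
  moreover have "space N = UNIV" using sN sets_eq_imp_space_eq[of N borel] by simp
  ultimately show "\<exists>A. countable A \<and> A \<subseteq> sets N \<and> \<Union>A = space N \<and> (\<forall>a\<in>A. emeasure N a \<noteq> \<infinity>)"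
    by (intro exI[of _ C]) auto
qed

lemma real_density_exists:
  assumes m: "pos_lf_measure a b m" and N: "pos_lf_measure a b N" and ac: "absolutely_continuous m N"
  shows "\<exists>d :: real \<Rightarrow> real. d \<in> borel_measurable borel \<and> (\<forall>x. 0 \<le> d x) \<and> N = density m (\<lambda>x. ennreal (d x))"
proof -
  interpret m: sigma_finite_measure m by (rule pos_lf_sigma_finite[OF m])
  have s: "sets N = sets m" "sets m = sets borel" using m N by (simp_all add: pos_lf_measure_def)
  note [measurable_cong] = s(2)
  define d where "d = (\<lambda>x. enn2real (RN_deriv m N x))"
  have [measurable]: "RN_deriv m N \<in> borel_measurable borel" using borel_measurable_RN_deriv[of m N] s by (simp cong: measurable_cong_sets)
  have "N = density m (RN_deriv m N)" using m.density_RN_deriv[OF ac s(1)] by simp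
  also have "\<dots> = density m (\<lambda>x. ennreal (d x))"
  proof (rule density_cong)
    show "AE x in m. RN_deriv m N x = ennreal (d x)"
      using m.RN_deriv_finite[OF pos_lf_sigma_finite[OF N] ac s(1)] by eventually_elim (simp add: d_def less_top)
  qed (simp_all add: d_def)
  finally show ?thesis by (intro exI[of _ d]) (simp add: d_def)
qed

text \<open>Restricting the densities to the two sides of a Hahn decomposition makes their product
  zero at every point. Their difference then vanishes only where both do, which turns full support
  of the signed measure into a property of one real density.\<close>

lemma signed_densities_exist:
  assumes m: "pos_lf_measure a b m" and N: "signed_lf_measure a b Np Nn"
    and ac: "absolutely_continuous m Np" "absolutely_continuous m Nn"
  shows "\<exists>dp dn :: real \<Rightarrow> real. dp \<in> borel_measurable borel \<and> dn \<in> borel_measurable borel \<and>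
    (\<forall>x. 0 \<le> dp x \<and> 0 \<le> dn x \<and> dp x * dn x = 0) \<and>
    Np = density m (\<lambda>x. ennreal (dp x)) \<and> Nn = density m (\<lambda>x. ennreal (dn x))"
proof -
  note [measurable_cong] = m[unfolded pos_lf_measure_def, THEN conjunct1]
  have s: "sets m = sets borel" using m by (simp add: pos_lf_measure_def)
  obtain A where A: "A \<in> sets borel" "emeasure Np A = 0" "emeasure Nn (UNIV - A) = 0"
    and lf: "pos_lf_measure a b Np" "pos_lf_measure a b Nn" using N by (auto simp: signed_lf_measure_def)
  note [measurable] = A(1)
  obtain dp where dp [measurable]: "dp \<in> borel_measurable borel" and dp': "\<And>x. 0 \<le> dp x" "Np = density m (\<lambda>x. ennreal (dp x))"
    using real_density_exists[OF m lf(1) ac(1)] by blast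
  obtain dn where dn [measurable]: "dn \<in> borel_measurable borel" and dn': "\<And>x. 0 \<le> dn x" "Nn = density m (\<lambda>x. ennreal (dn x))"
    using real_density_exists[OF m lf(2) ac(2)] by blast
  have restrict: "density m (\<lambda>x. ennreal (d x)) = density m (\<lambda>x. ennreal (indicator (UNIV - B) x * d x))"
    if [measurable]: "B \<in> sets borel" "d \<in> borel_measurable borel" and d: "\<And>x. 0 \<le> d x"
      and z: "emeasure (density m (\<lambda>x. ennreal (d x))) B = 0" for B and d :: "real \<Rightarrow> real"
  proof (rule density_cong)
    have "B \<in> null_sets (density m (\<lambda>x. ennreal (d x)))" using z s by (auto simp: null_sets_def)
    then have "AE x in density m (\<lambda>x. ennreal (d x)). x \<notin> B" by (rule AE_not_in)
    then have "AE x in m. 0 < ennreal (d x) \<longrightarrow> x \<notin> B" by (subst (asm) AE_density) auto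
    then show "AE x in m. ennreal (d x) = ennreal (indicator (UNIV - B) x * d x)"
    proof eventually_elim
      case (elim x)
      then show ?case using d[of x] by (cases "x \<in> B") auto
    qed
  qed auto
  have "Np = density m (\<lambda>x. ennreal (indicator (UNIV - A) x * dp x))"
    using restrict[OF A(1) dp dp'(1)] A(2) unfolding dp'(2) by simp
  moreover have "Nn = density m (\<lambda>x. ennreal (indicator (UNIV - (UNIV - A)) x * dn x))"
    using restrict[OF _ dn dn'(1), of "UNIV - A"] A(1,3) unfolding dn'(2) by simp
  ultimately show ?thesis
    using dp' dn' by (intro exI[of _ "\<lambda>x. indicator (UNIV - A) x * dp x"] exI[of _ "\<lambda>x. indicator (UNIV - (UNIV - A)) x * dn x"])
      (auto simp: indicator_def)
qed

end

text \<open>Passes from the integral with base point \<open>c\<close> and its sign convention to the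
  two-point form of \<open>ac_on\<close>; the cases are the positions of \<open>c\<close> relative
  to \<open>x\<close> and \<open>y\<close>.\<close>

lemma pint_diff:
  assumes i: "\<And>u v. u \<in> J \<Longrightarrow> v \<in> J \<Longrightarrow> set_integrable N {u..<v} h"
    and J: "c \<in> J" "x \<in> J" "y \<in> J" "x \<le> y" and N: "sets N = sets borel"
  shows "pint N c y h = pint N c x h + (LINT t:{x..<y}|N. h t)"
proof -
  have split: "(LINT t:{u..<w}|N. h t) = (LINT t:{u..<v}|N. h t) + (LINT t:{v..<w}|N. h t)"
    if "u \<in> J" "v \<in> J" "w \<in> J" "u \<le> v" "v \<le> w" for u v w
  proof -
    have "{u..<w} = {u..<v} \<union> {v..<w}" using that by auto
    then show ?thesis using i that by (simp add: set_integral_Un)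
  qed
  have pos: "pint N c z h = (LINT t:{c..<z}|N. h t)" if "c \<le> z" for z
    using that by (auto simp: pint_def set_lebesgue_integral_def)
  have neg: "pint N c z h = - (LINT t:{z..<c}|N. h t)" if "z \<le> c" for z
    using that by (auto simp: pint_def set_lebesgue_integral_def)
  consider "c \<le> x" | "x \<le> c" "c \<le> y" | "y \<le> c" by linarith
  then show ?thesis
  proof cases
    case 1
    then show ?thesis using pos split[of c x y] J by simp
  next
    case 2
    then show ?thesis using pos[of y] neg[of x] split[of x c y] J by simp
  next
    case 3
    then show ?thesis using neg[of x] neg[of y] split[of x y c] J by simp
  qed
qed

lemma pint_refl [simp]: "pint N c c h = 0"
  by (simp add: pint_def)

lemma loc_int_Ico:
  assumes "loc_int a b Np Nn h" "x \<in> ivl a b" "y \<in> ivl a b" "sets Np = sets borel" "sets Nn = sets borel"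
  shows "set_integrable Np {x..<y} h" "set_integrable Nn {x..<y} h"
proof -
  have i: "set_integrable Np {x..y} h" "set_integrable Nn {x..y} h" using assms(1-3) unfolding loc_int_def by blast+
  show "set_integrable Np {x..<y} h" by (rule set_integrable_subset[OF i(1)]) (simp_all add: assms(4) subset_iff)
  show "set_integrable Nn {x..<y} h" by (rule set_integrable_subset[OF i(2)]) (simp_all add: assms(5) subset_iff)
qed

lemma ivl_extend:
  assumes "y \<in> ivl a b" obtains y' where "y' \<in> ivl a b" "y < y'"
proof -
  obtain e where "e > 0" "y + e \<in> ivl a b" using open_real_neighbours[OF open_ivl assms] by blast
  then show ?thesis using that[of "y + e"] by simp
qed

lemma loc_intI:
  assumes "\<And>x y. x \<in> ivl a b \<Longrightarrow> y \<in> ivl a b \<Longrightarrow> set_integrable Np {x..<y} h"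
    "\<And>x y. x \<in> ivl a b \<Longrightarrow> y \<in> ivl a b \<Longrightarrow> set_integrable Nn {x..<y} h" "sets Np = sets borel" "sets Nn = sets borel"
  shows "loc_int a b Np Nn h"
  unfolding loc_int_def
proof (intro allI impI)
  fix \<alpha> \<beta> assume *: "\<alpha> \<in> ivl a b \<and> \<beta> \<in> ivl a b"
  then obtain y where y: "y \<in> ivl a b" "\<beta> < y" using ivl_extend by blast
  have i: "set_integrable Np {\<alpha>..<y} h" "set_integrable Nn {\<alpha>..<y} h" using assms(1,2) * y(1) by blast+
  show "set_integrable Np {\<alpha>..\<beta>} h \<and> set_integrable Nn {\<alpha>..\<beta>} h"
    by (intro conjI set_integrable_subset[OF i(1)] set_integrable_subset[OF i(2)]) (use y(2) in \<open>simp_all add: assms(3,4) subset_iff\<close>)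
qed

lemma set_integrable_density_iff:
  fixes h :: cfun
  assumes d: "d \<in> borel_measurable borel" "\<And>x. 0 \<le> d x" and m: "sets m = sets borel"
    and h: "(\<lambda>x. indicator A x *\<^sub>R h x) \<in> borel_measurable borel"
  shows "set_integrable (density m (\<lambda>x. ennreal (d x))) A h \<longleftrightarrow> set_integrable m A (\<lambda>x. of_real (d x) * h x)"
    and "(LINT t:A|density m (\<lambda>x. ennreal (d x)). h t) = (LINT t:A|m. of_real (d t) * h t)"
proof -
  note [measurable] = d(1) h and [measurable_cong] = m
  have e: "d x *\<^sub>R indicat_real A x *\<^sub>R h x = indicat_real A x *\<^sub>R (of_real (d x) * h x)" for x
    by (simp add: scaleR_conv_of_real mult.left_commute)
  show "set_integrable (density m (\<lambda>x. ennreal (d x))) A h \<longleftrightarrow> set_integrable m A (\<lambda>x. of_real (d x) * h x)"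
    using integrable_density[of "\<lambda>x. indicat_real A x *\<^sub>R h x" m d] d(2) unfolding set_integrable_def e by simp
  show "(LINT t:A|density m (\<lambda>x. ennreal (d x)). h t) = (LINT t:A|m. of_real (d t) * h t)"
    using integral_density[of "\<lambda>x. indicat_real A x *\<^sub>R h x" m d] d(2) unfolding set_lebesgue_integral_def e by simp
qed

lemma set_integrable_density_dest:
  fixes h :: cfun
  assumes d: "d \<in> borel_measurable borel" "\<And>x. 0 \<le> d x" and m: "sets m = sets borel"
    and h: "set_integrable (density m (\<lambda>x. ennreal (d x))) A h"
  shows "set_integrable m A (\<lambda>x. of_real (d x) * h x)"
    and "(LINT t:A|density m (\<lambda>x. ennreal (d x)). h t) = (LINT t:A|m. of_real (d t) * h t)"
proof -
  have "(\<lambda>x. indicator A x *\<^sub>R h x) \<in> borel_measurable (density m (\<lambda>x. ennreal (d x)))"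
    using h unfolding set_integrable_def by auto
  then have meas: "(\<lambda>x. indicator A x *\<^sub>R h x) \<in> borel_measurable borel"
    using m by (simp cong: measurable_cong_sets)
  show "set_integrable m A (\<lambda>x. of_real (d x) * h x)"
    using set_integrable_density_iff(1)[OF d m meas] h by simp
  show "(LINT t:A|density m (\<lambda>x. ennreal (d x)). h t) = (LINT t:A|m. of_real (d t) * h t)"
    by (rule set_integrable_density_iff(2)[OF d m meas])
qed

lemma ac_deriv_iff_ac_on:
  assumes d: "dp \<in> borel_measurable borel" "\<And>x. 0 \<le> dp x" "dn \<in> borel_measurable borel" "\<And>x. 0 \<le> dn x"
    and m: "sets m = sets borel" and Np: "Np = density m (\<lambda>x. ennreal (dp x))" and Nn: "Nn = density m (\<lambda>x. ennreal (dn x))"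
    and c: "c \<in> ivl a b" and h: "loc_int a b Np Nn h"
  shows "ac_deriv a b c Np Nn f h \<longleftrightarrow> ac_on m (ivl a b) f (\<lambda>t. of_real (dp t - dn t) * h t)"
proof -
  have s: "sets Np = sets borel" "sets Nn = sets borel" using m by (simp_all add: Np Nn)
  have i: "set_integrable Np {x..<y} h" "set_integrable Nn {x..<y} h" if "x \<in> ivl a b" "y \<in> ivl a b" for x y
    using loc_int_Ico[OF h that s] by auto
  have diff: "sint Np Nn c y h = sint Np Nn c x h + (LINT t:{x..<y}|m. of_real (dp t - dn t) * h t)"
    and int: "set_integrable m {x..<y} (\<lambda>t. of_real (dp t - dn t) * h t)"
    if xy: "x \<in> ivl a b" "y \<in> ivl a b" "x \<le> y" for x y
  proof -
    note P = set_integrable_density_dest[OF d(1,2) m i(1)[OF xy(1,2), unfolded Np]]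
    note Q = set_integrable_density_dest[OF d(3,4) m i(2)[OF xy(1,2), unfolded Nn]]
    show "set_integrable m {x..<y} (\<lambda>t. of_real (dp t - dn t) * h t)"
      using set_integral_diff(1)[OF P(1) Q(1)] by (simp add: algebra_simps)
    have "(LINT t:{x..<y}|m. of_real (dp t - dn t) * h t) = (LINT t:{x..<y}|Np. h t) - (LINT t:{x..<y}|Nn. h t)"
      using set_integral_diff(2)[OF P(1) Q(1)] P(2) Q(2) by (simp add: Np Nn algebra_simps)
    then show "sint Np Nn c y h = sint Np Nn c x h + (LINT t:{x..<y}|m. of_real (dp t - dn t) * h t)"
      using pint_diff[of "ivl a b" Np h c x y, OF i(1) c xy s(1)] pint_diff[of "ivl a b" Nn h c x y, OF i(2) c xy s(2)]
      by (simp add: sint_def)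
  qed
  have sc: "sint Np Nn c c h = 0" by (simp add: sint_def)
  show ?thesis
  proof
    assume "ac_deriv a b c Np Nn f h"
    then have f: "f x = f c + sint Np Nn c x h" if "x \<in> ivl a b" for x using that by (simp add: ac_deriv_def)
    show "ac_on m (ivl a b) f (\<lambda>t. of_real (dp t - dn t) * h t)"
    proof (rule ac_onI[OF is_interval_ivl int])
      fix x y assume xy: "x \<in> ivl a b" "y \<in> ivl a b" "x \<le> y"
      show "f y = f x + (LINT t:{x..<y}|m. of_real (dp t - dn t) * h t)"
        using f[OF xy(1)] f[OF xy(2)] diff[OF xy] by (simp only: add.assoc)
    qed
  next
    assume ac: "ac_on m (ivl a b) f (\<lambda>t. of_real (dp t - dn t) * h t)"
    have "f x = f c + sint Np Nn c x h" if x: "x \<in> ivl a b" for x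
      using ac_on_eq[OF ac c x] ac_on_eq[OF ac x c] diff[OF c x] diff[OF x c] sc by (cases "c \<le> x") (auto simp: algebra_simps)
    then show "ac_deriv a b c Np Nn f h" using h by (simp add: ac_deriv_def)
  qed
qed

lemma (in borel_sigma_finite) ac_on_cong_AE:
  assumes f: "ac_on m J f \<phi>" and \<psi>: "\<And>x y. x \<in> J \<Longrightarrow> y \<in> J \<Longrightarrow> set_integrable m {x..<y} \<psi>"
    and ae: "AE t in m. t \<in> J \<longrightarrow> \<phi> t = \<psi> t"
  shows "ac_on m J f \<psi>"
proof (rule ac_onI[OF ac_on_is_interval[OF f] \<psi>])
  fix x y assume xy: "x \<in> J" "y \<in> J" "x \<le> y"
  have "(LINT t:{x..<y}|m. \<phi> t) = (LINT t:{x..<y}|m. \<psi> t)"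
    unfolding set_lebesgue_integral_def
  proof (rule integral_cong_AE)
    show "(\<lambda>t. indicat_real {x..<y} t *\<^sub>R \<phi> t) \<in> borel_measurable m" "(\<lambda>t. indicat_real {x..<y} t *\<^sub>R \<psi> t) \<in> borel_measurable m"
      using ac_on_integrable[OF f xy(1,2)] \<psi>[OF xy(1,2)] by (auto simp: set_integrable_def)
    show "AE t in m. indicat_real {x..<y} t *\<^sub>R \<phi> t = indicat_real {x..<y} t *\<^sub>R \<psi> t"
      using ae by eventually_elim (use ac_on_interval[OF f xy(1,2)] in \<open>auto simp: indicator_def\<close>)
  qed
  then show "f y = f x + (LINT t:{x..<y}|m. \<psi> t)" using ac_on_eq[OF f xy] by simp
qed

section \<open>Translation between \<tau> and the first order system\<close>

locale sl_measures = full_measure_system m "ivl a b" s q r for a b :: ereal and m s q r +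
  fixes c :: real and \<rho> \<sigma>p \<sigma>n \<chi>p \<chi>n :: "real measure" and sp sn qp qn :: "real \<Rightarrow> real"
  assumes ab: "a < b" and c: "c \<in> ivl a b"
    and lf: "pos_lf_measure a b \<rho>" "pos_lf_measure a b \<sigma>p" "pos_lf_measure a b \<sigma>n"
      "pos_lf_measure a b \<chi>p" "pos_lf_measure a b \<chi>n"
    and dens_meas [measurable]: "sp \<in> borel_measurable borel" "sn \<in> borel_measurable borel"
      "qp \<in> borel_measurable borel" "qn \<in> borel_measurable borel"
    and dens_nonneg: "\<And>t. 0 \<le> sp t" "\<And>t. 0 \<le> sn t" "\<And>t. 0 \<le> qp t" "\<And>t. 0 \<le> qn t"
    and \<rho>_dens: "\<rho> = density m (\<lambda>x. ennreal (r x))"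
    and \<sigma>_dens: "\<sigma>p = density m (\<lambda>x. ennreal (sp x))" "\<sigma>n = density m (\<lambda>x. ennreal (sn x))"
    and \<chi>_dens: "\<chi>p = density m (\<lambda>x. ennreal (qp x))" "\<chi>n = density m (\<lambda>x. ennreal (qn x))"
    and s_eq: "\<And>t. s t = sp t - sn t" and q_eq: "\<And>t. q t = qp t - qn t"
begin

abbreviation tau where "tau \<equiv> tau_rel a b c \<rho> \<sigma>p \<sigma>n \<chi>p \<chi>n"

lemma sets_all [simp]: "sets \<rho> = sets borel" "sets \<sigma>p = sets borel" "sets \<sigma>n = sets borel"
  "sets \<chi>p = sets borel" "sets \<chi>n = sets borel"
  using lf by (simp_all add: pos_lf_measure_def)

lemma pos_lf_emeasure_finite:
  assumes "pos_lf_measure a b N" "x \<in> ivl a b" "y \<in> ivl a b"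
  shows "emeasure N {x..<y} < \<infinity>"
proof -
  have "emeasure N {x..<y} \<le> emeasure N {x..y}"
    using assms(1) by (intro emeasure_mono) (auto simp: pos_lf_measure_def)
  also have "\<dots> < \<infinity>" using assms ivl_Icc_subset by (auto simp: pos_lf_measure_def)
  finally show ?thesis .
qed

lemma loc_int_ac_on:
  assumes N: "pos_lf_measure a b N" and f: "ac_on m (ivl a b) f \<phi>" and xy: "x \<in> ivl a b" "y \<in> ivl a b"
  shows "set_integrable N {x..<y} (f :: cfun)"
proof -
  have sN: "sets N = sets borel" using N by (simp add: pos_lf_measure_def)
  have "integrable N (\<lambda>t. of_real (indicator {x..<y} t) :: complex)"
    by (rule integrable_of_real, rule integrable_real_indicator) (use pos_lf_emeasure_finite[OF N xy] sN in auto)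
  then have "set_integrable N {x..<y} (\<lambda>_. 1 :: complex)" by (simp add: set_integrable_def scaleR_conv_of_real)
  from set_integrable_mult_ac_on[OF f xy this sN] show ?thesis by simp
qed

lemma sint_\<chi>:
  assumes f: "ac_on m (ivl a b) f \<phi>"
  shows "ac_on m (ivl a b) (\<lambda>x. sint \<chi>p \<chi>n c x f) (\<lambda>t. of_real (q t) * f t)"
proof -
  have l: "loc_int a b \<chi>p \<chi>n f" by (rule loc_intI) (use loc_int_ac_on f lf in auto)
  have "ac_deriv a b c \<chi>p \<chi>n (\<lambda>x. sint \<chi>p \<chi>n c x f) f"
    using l by (simp add: ac_deriv_def sint_def)
  then show ?thesis
    using ac_deriv_iff_ac_on[OF dens_meas(3) dens_nonneg(3) dens_meas(4) dens_nonneg(4) sets_m \<chi>_dens c l] by (simp add: q_eq)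
qed

text \<open>A positive measure is the signed case with negative density zero, so the conversion for
  signed measures also covers the condition on \<open>F\<close>.\<close>

lemma null_dens: "null_measure \<rho> = density m (\<lambda>x. ennreal ((\<lambda>_. 0) x))"
  by (rule measure_eqI) (auto simp: emeasure_density)

lemma ac_deriv_\<rho>:
  assumes "loc_int a b \<rho> (null_measure \<rho>) g"
  shows "ac_deriv a b c \<rho> (null_measure \<rho>) F g \<longleftrightarrow> ac_on m (ivl a b) F (\<lambda>t. of_real (r t) * g t)"
  using ac_deriv_iff_ac_on[OF meas(3) r_nonneg _ _ sets_m \<rho>_dens null_dens c assms] by simp

lemma ac_deriv_\<sigma>:
  assumes "loc_int a b \<sigma>p \<sigma>n h"
  shows "ac_deriv a b c \<sigma>p \<sigma>n f h \<longleftrightarrow> ac_on m (ivl a b) f (\<lambda>t. of_real (s t) * h t)"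
  using ac_deriv_iff_ac_on[OF dens_meas(1) dens_nonneg(1) dens_meas(2) dens_nonneg(2) sets_m \<sigma>_dens c assms] by (simp add: s_eq)

text \<open>The density \<open>h\<close> agrees with the quasi-derivative only almost everywhere for
  \<sigma>. That covers almost all points where \<open>s\<close> is nonzero, and elsewhere the
  factor \<open>s\<close> hides the difference.\<close>

lemma tau_solves:
  assumes "tau f F g"
  shows "solves (ivl a b) f (\<lambda>x. sint \<chi>p \<chi>n c x f - F x) g"
proof -
  define f1 where "f1 = (\<lambda>x. sint \<chi>p \<chi>n c x f - F x)"
  obtain h where h: "ac_deriv a b c \<sigma>p \<sigma>n f h" and F: "ac_deriv a b c \<rho> (null_measure \<rho>) F g"
    and aep: "AE x in \<sigma>p. x \<in> ivl a b \<longrightarrow> F x = - h x + sint \<chi>p \<chi>n c x f"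
    and aen: "AE x in \<sigma>n. x \<in> ivl a b \<longrightarrow> F x = - h x + sint \<chi>p \<chi>n c x f"
    using assms unfolding tau_rel_def by blast
  have "loc_int a b \<sigma>p \<sigma>n h" using h by (simp add: ac_deriv_def)
  then have f: "ac_on m (ivl a b) f (\<lambda>t. of_real (s t) * h t)" using h ac_deriv_\<sigma> by simp
  have "loc_int a b \<rho> (null_measure \<rho>) g" using F by (simp add: ac_deriv_def)
  then have F': "ac_on m (ivl a b) F (\<lambda>t. of_real (r t) * g t)" using F ac_deriv_\<rho> by simp
  have f1: "ac_on m (ivl a b) f1 (\<lambda>t. of_real (q t) * f t - of_real (r t) * g t)"
    unfolding f1_def by (rule ac_on_diff[OF sint_\<chi>[OF f] F'])
  have [measurable]: "(\<lambda>x. ennreal (sp x)) \<in> borel_measurable m" "(\<lambda>x. ennreal (sn x)) \<in> borel_measurable m" by measurable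
  have "AE x in m. 0 < ennreal (sp x) \<longrightarrow> x \<in> ivl a b \<longrightarrow> F x = - h x + sint \<chi>p \<chi>n c x f"
    using aep unfolding \<sigma>_dens(1) by (subst (asm) AE_density) auto
  moreover have "AE x in m. 0 < ennreal (sn x) \<longrightarrow> x \<in> ivl a b \<longrightarrow> F x = - h x + sint \<chi>p \<chi>n c x f"
    using aen unfolding \<sigma>_dens(2) by (subst (asm) AE_density) auto
  ultimately have "AE t in m. t \<in> ivl a b \<longrightarrow> of_real (s t) * h t = of_real (s t) * f1 t"
  proof eventually_elim
    case (elim t)
    show ?case
    proof (cases "s t = 0")
      case False
      then have "0 < sp t \<or> 0 < sn t" using dens_nonneg(1)[of t] dens_nonneg(2)[of t] s_eq[of t] by linarith
      then show ?thesis using elim by (auto simp: f1_def)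
    qed simp
  qed
  moreover have "set_integrable m {x..<y} (\<lambda>t. of_real (s t) * f1 t)" if "x \<in> ivl a b" "y \<in> ivl a b" for x y
    using set_integrable_mult_ac_on[OF f1 that set_integrable_of_real[OF loc_s[OF that]] sets_m] by (simp add: mult.commute)
  ultimately have "ac_on m (ivl a b) f (\<lambda>t. of_real (s t) * f1 t)" using ac_on_cong_AE[OF f] by blast
  then show ?thesis using f1 by (simp add: solves_def f1_def)
qed

lemma solves_tau:
  assumes f: "solves (ivl a b) f f1 g" and g: "loc_int a b \<rho> (null_measure \<rho>) g"
  shows "tau f (\<lambda>x. if x \<in> ivl a b then sint \<chi>p \<chi>n c x f - f1 x else 0) g"
proof -
  have l: "loc_int a b \<sigma>p \<sigma>n f1"
    by (rule loc_intI) (use loc_int_ac_on solvesD2[OF f] lf in auto)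
  have "ac_deriv a b c \<sigma>p \<sigma>n f f1" using ac_deriv_\<sigma>[OF l] solvesD1[OF f] by simp
  moreover have "ac_on m (ivl a b) (\<lambda>x. if x \<in> ivl a b then sint \<chi>p \<chi>n c x f - f1 x else 0) (\<lambda>t. of_real (r t) * g t)"
    by (rule ac_on_cong[OF ac_on_diff[OF sint_\<chi>[OF solvesD1[OF f]] solvesD2[OF f]]]) auto
  then have "ac_deriv a b c \<rho> (null_measure \<rho>) (\<lambda>x. if x \<in> ivl a b then sint \<chi>p \<chi>n c x f - f1 x else 0) g"
    using ac_deriv_\<rho>[OF g] by simp
  ultimately show ?thesis unfolding tau_rel_def by (intro conjI exI[of _ f1]) auto
qed

lemma L2_loc_int:
  assumes g: "L2 \<rho> g" shows "loc_int a b \<rho> (null_measure \<rho>) g"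
proof (rule loc_intI)
  fix x y assume xy: "x \<in> ivl a b" "y \<in> ivl a b"
  have [measurable]: "g \<in> borel_measurable \<rho>" by (rule L2_measurable[OF g])
  have "integrable \<rho> (indicator {x..<y} :: real \<Rightarrow> real)"
    by (rule integrable_real_indicator) (use pos_lf_emeasure_finite[OF lf(1) xy] in auto)
  then have i: "integrable \<rho> (\<lambda>t. indicator {x..<y} t + (norm (g t))\<^sup>2)" using L2_integrable_norm[OF g] by simp
  have "norm z \<le> 1 + (norm z)\<^sup>2" for z :: complex
    using sum_squares_bound[of 1 "norm z"] norm_ge_zero[of z] unfolding one_power2 by linarith
  then have "AE t in \<rho>. norm (indicator {x..<y} t *\<^sub>R g t) \<le> norm (indicator {x..<y} t + (norm (g t))\<^sup>2)"
    by (auto simp: indicator_def)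
  moreover have meas: "(\<lambda>t. indicator {x..<y} t *\<^sub>R g t) \<in> borel_measurable \<rho>"
    by (intro borel_measurable_scaleR borel_measurable_indicator L2_measurable[OF g]) simp
  ultimately show "set_integrable \<rho> {x..<y} g"
    unfolding set_integrable_def by (intro Bochner_Integration.integrable_bound[OF i])
  have "(\<lambda>t. indicator {x..<y} t *\<^sub>R g t) \<in> borel_measurable (null_measure \<rho>)"
    using meas by (simp cong: measurable_cong_sets)
  then show "set_integrable (null_measure \<rho>) {x..<y} g"
    unfolding set_integrable_def integrable_iff_bounded by (simp add: nn_integral_null_measure)
qed simp_all

lemma tau_unique:
  assumes "tau f F g" "tau f F' g'" shows "F = F'"
proof
  fix x
  show "F x = F' x"
  proof (cases "x \<in> ivl a b")
    case True
    from quasi_unique[OF tau_solves[OF assms(1)] tau_solves[OF assms(2)] True] show ?thesis by simp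
  qed (use assms in \<open>simp add: tau_rel_def\<close>)
qed

lemma qderiv_eq:
  assumes f: "solves (ivl a b) f f1 g" and g: "L2 \<rho> g" and x: "x \<in> ivl a b"
  shows "qderiv a b c \<rho> \<sigma>p \<sigma>n \<chi>p \<chi>n f x = f1 x"
proof -
  define F where "F = (\<lambda>x. if x \<in> ivl a b then sint \<chi>p \<chi>n c x f - f1 x else 0)"
  have F: "tau f F g" unfolding F_def by (rule solves_tau[OF f L2_loc_int[OF g]])
  have "(THE F. \<exists>g. tau f F g) = F" by (rule the_equality) (use F tau_unique in blast)+
  then show ?thesis using x by (simp add: qderiv_def F_def)
qed

lemma Tmax_solves:
  "(f, g) \<in> Tmax a b c \<rho> \<sigma>p \<sigma>n \<chi>p \<chi>n \<longleftrightarrow> (\<exists>f1. solves (ivl a b) f f1 g) \<and> L2 \<rho> f \<and> L2 \<rho> g"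
  unfolding Tmax_def using tau_solves solves_tau L2_loc_int by blast

end

context sl_measures
begin

lemma ac_on_extend_measurable:
  assumes f: "ac_on m (ivl a b) f \<phi>" and z: "\<And>x. x \<notin> ivl a b \<Longrightarrow> f x = 0"
  shows "(f :: cfun) \<in> borel_measurable borel"
proof -
  obtain l u :: "nat \<Rightarrow> real" where lu: "\<And>n. l n \<in> ivl a b" "\<And>n. u n \<in> ivl a b"
    "\<And>x. x \<in> ivl a b \<Longrightarrow> \<forall>\<^sub>F n in sequentially. x \<in> {l n<..<u n}" using ivl_exhaustion[OF ab] by blast
  show ?thesis
  proof (rule borel_measurable_LIMSEQ_metric)
    show "(\<lambda>t. indicator {l n..<u n} t *\<^sub>R f t) \<in> borel_measurable borel" for n
      by (rule ac_on_measurable[OF f lu(1,2)])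
    show "(\<lambda>n. indicator {l n..<u n} x *\<^sub>R f x) \<longlonglongrightarrow> f x" for x
    proof (rule tendsto_eventually, cases "x \<in> ivl a b")
      case True
      from lu(3)[OF True] show "\<forall>\<^sub>F n in sequentially. indicator {l n..<u n} x *\<^sub>R f x = f x" by eventually_elim auto
    qed (simp add: z)
  qed
qed

text \<open>The limit-circle hypothesis at \<open>z = 0\<close> controls both tails; on the compact
  part between them \<open>u\<close> is bounded.\<close>

lemma lc_solution_L2:
  assumes lc: "lc_left a b c \<rho> \<sigma>p \<sigma>n \<chi>p \<chi>n" "lc_right a b c \<rho> \<sigma>p \<sigma>n \<chi>p \<chi>n"
    and u: "solves (ivl a b) u u1 (\<lambda>_. 0)" and z: "\<And>x. x \<notin> ivl a b \<Longrightarrow> u x = 0"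
  shows "L2 \<rho> u"
proof -
  have u_meas [measurable]: "u \<in> borel_measurable borel" by (rule ac_on_extend_measurable[OF solvesD1[OF u] z])
  have "tau u (\<lambda>x. if x \<in> ivl a b then sint \<chi>p \<chi>n c x u - u1 x else 0) (\<lambda>_. 0)"
    by (rule solves_tau[OF u L2_loc_int[OF L2_zero]])
  moreover have "AE x in \<rho>. (0::complex) = 0 * u x" by simp
  ultimately have t: "tau u (\<lambda>x. if x \<in> ivl a b then sint \<chi>p \<chi>n c x u - u1 x else 0) (\<lambda>_. 0) \<and> (AE x in \<rho>. (0::complex) = 0 * u x)"
    by blast
  obtain \<alpha> where \<alpha>: "\<alpha> \<in> ivl a b" "set_integrable \<rho> {x. a < ereal x \<and> x \<le> \<alpha>} (\<lambda>x. (norm (u x))\<^sup>2)"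
    using lc(1)[unfolded lc_left_def, rule_format, OF t] by blast
  obtain \<beta> where \<beta>: "\<beta> \<in> ivl a b" "set_integrable \<rho> {x. \<beta> \<le> x \<and> ereal x < b} (\<lambda>x. (norm (u x))\<^sup>2)"
    using lc(2)[unfolded lc_right_def, rule_format, OF t] by blast
  have "set_integrable \<rho> {\<alpha>..<\<beta>} (\<lambda>x. u x * cnj (u x))"
    using set_integrable_mult_ac_on[OF solvesD1[OF u] \<alpha>(1) \<beta>(1) loc_int_ac_on[OF lf(1) ac_on_cnj[OF solvesD1[OF u]] \<alpha>(1) \<beta>(1)]] by simp
  from set_integrable_norm[OF this] have mid: "set_integrable \<rho> {\<alpha>..<\<beta>} (\<lambda>x. (norm (u x))\<^sup>2)"
    by (simp add: norm_mult power2_eq_square)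
  have "integrable \<rho> (\<lambda>x. (norm (u x))\<^sup>2)"
  proof (rule Bochner_Integration.integrable_bound)
    show "integrable \<rho> (\<lambda>x. indicator {x. a < ereal x \<and> x \<le> \<alpha>} x *\<^sub>R (norm (u x))\<^sup>2 +
      (indicator {\<alpha>..<\<beta>} x *\<^sub>R (norm (u x))\<^sup>2 + indicator {x. \<beta> \<le> x \<and> ereal x < b} x *\<^sub>R (norm (u x))\<^sup>2))"
      using \<alpha>(2) \<beta>(2) mid unfolding set_integrable_def by (intro Bochner_Integration.integrable_add)
    show "(\<lambda>x. (norm (u x))\<^sup>2) \<in> borel_measurable \<rho>" by (simp cong: measurable_cong_sets)
    \<comment> \<open>The three sets cover the interval whatever the order of \<alpha> and \<beta>;
      if they overlap, the sum merely counts twice.\<close>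
    have "(norm (u x))\<^sup>2 \<le> indicator {x. a < ereal x \<and> x \<le> \<alpha>} x *\<^sub>R (norm (u x))\<^sup>2 +
      (indicator {\<alpha>..<\<beta>} x *\<^sub>R (norm (u x))\<^sup>2 + indicator {x. \<beta> \<le> x \<and> ereal x < b} x *\<^sub>R (norm (u x))\<^sup>2)" for x
      using z[of x] by (cases "x \<in> ivl a b") (auto simp: ivl_def indicator_def)
    then show "AE x in \<rho>. norm ((norm (u x))\<^sup>2) \<le> norm (indicator {x. a < ereal x \<and> x \<le> \<alpha>} x *\<^sub>R (norm (u x))\<^sup>2 +
      (indicator {\<alpha>..<\<beta>} x *\<^sub>R (norm (u x))\<^sup>2 + indicator {x. \<beta> \<le> x \<and> ereal x < b} x *\<^sub>R (norm (u x))\<^sup>2))"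
      by (intro AE_I2) (simp only: real_norm_def abs_of_nonneg zero_le_power2, simp)
  qed
  then show ?thesis using u_meas by (simp add: L2_def cong: measurable_cong_sets)
qed

lemma exists_lc_measures:
  assumes hyps: "standing_hyps a b c \<rho> \<sigma>p \<sigma>n \<chi>p \<chi>n"
    and lc: "lc_left a b c \<rho> \<sigma>p \<sigma>n \<chi>p \<chi>n" "lc_right a b c \<rho> \<sigma>p \<sigma>n \<chi>p \<chi>n"
  shows "\<exists>u1 v1 u2 v2. lc_system m (ivl a b) s q r a b \<rho> u1 v1 u2 v2"
proof -
  obtain f1 g1 where f1: "solves (ivl a b) f1 g1 (\<lambda>_. 0)" "f1 c = 1" "g1 c = 0" using exists_solution[OF c] by metis
  obtain f2 g2 where f2: "solves (ivl a b) f2 g2 (\<lambda>_. 0)" "f2 c = 0" "g2 c = 1" using exists_solution[OF c] by metis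
  \<comment> \<open>Setting the solutions to zero outside the interval makes them Borel functions on
    the whole line, as \<open>L2\<close> demands.\<close>
  define u1 where "u1 = (\<lambda>x. if x \<in> ivl a b then f1 x else 0)"
  define u2 where "u2 = (\<lambda>x. if x \<in> ivl a b then f2 x else 0)"
  have u1: "solves (ivl a b) u1 g1 (\<lambda>_. 0)" by (rule solves_cong[OF f1(1)]) (simp_all add: u1_def)
  have u2: "solves (ivl a b) u2 g2 (\<lambda>_. 0)" by (rule solves_cong[OF f2(1)]) (simp_all add: u2_def)
  have W: "u1 x * g2 x - g1 x * u2 x = 1" if "x \<in> ivl a b" for x
    using wronskian_const[OF order_refl u1 u2 that c] f1 f2 c by (simp add: u1_def u2_def)
  have outside: "u1 x = 0" "u2 x = 0" if "x \<notin> ivl a b" for x using that by (simp_all add: u1_def u2_def)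
  have real: "cnj (u1 x) = u1 x" "cnj (u2 x) = u2 x" for x
    using real_solution[OF f1(1) c] real_solution[OF f2(1) c] f1 f2 by (auto simp: u1_def u2_def)
  have indep: "\<alpha> = 0 \<and> \<beta> = 0" if ae: "AE x in \<rho>. \<alpha> * u1 x + \<beta> * u2 x = 0" for \<alpha> \<beta>
  proof -
    define f where "f = (\<lambda>x. \<alpha> * u1 x + \<beta> * u2 x)"
    define f' where "f' = (\<lambda>x. \<alpha> * g1 x + \<beta> * g2 x)"
    have f: "solves (ivl a b) f f' (\<lambda>_. 0)" using solves_comb[OF u1 u2, of \<alpha> \<beta>] by (simp add: f_def f'_def)
    have D: "f \<in> Dtau a b c \<rho> \<sigma>p \<sigma>n \<chi>p \<chi>n"
      using solves_tau[OF f L2_loc_int[OF L2_zero]] unfolding Dtau_def by blast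
    obtain x0 y0 where xy: "x0 \<in> msupp a b \<rho>" "y0 \<in> msupp a b \<rho>" "x0 < y0"
      using hyps unfolding standing_hyps_def by (metis linorder_neqE)
    have gap: "\<forall>x\<in>{\<alpha><..<\<beta>}. f x = 0" if "\<alpha> \<in> msupp a b \<rho>" "\<beta> \<in> msupp a b \<rho>" "\<alpha> < \<beta>" "{\<alpha><..<\<beta>} \<inter> msupp a b \<rho> = {}"
      "(f \<longlongrightarrow> 0) (at_left \<alpha>)" "(f \<longlongrightarrow> 0) (at_right \<beta>)" for \<alpha> \<beta>
      using hyps D that unfolding standing_hyps_def by blast
    have f0: "f x = 0" if "x \<in> ivl a b" for x
      by (rule eq_zero_if_AE_zero[OF refl \<rho>_dens f _ gap xy that]) (use ae in \<open>simp_all add: f_def\<close>)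
    have "solves (ivl a b) (\<lambda>_. 0) f' (\<lambda>_. 0)" by (rule solves_cong[OF f]) (simp_all add: f0)
    moreover have "solves (ivl a b) (\<lambda>_. 0) (\<lambda>_. 0) (\<lambda>_. 0)" using solves_comb[OF u1 u2, of 0 0] by simp
    ultimately have "f' c = 0" using quasi_unique[OF _ _ c] by blast
    then show ?thesis using f0[OF c] f1 f2 c by (simp add: f_def f'_def u1_def u2_def)
  qed
  have out: "emeasure \<rho> (UNIV - ivl a b) = 0" using lf(1) by (simp add: pos_lf_measure_def)
  have L2: "L2 \<rho> u1" "L2 \<rho> u2"
    using lc_solution_L2[OF lc u1] lc_solution_L2[OF lc u2] outside by blast+
  have "lc_system m (ivl a b) s q r a b \<rho> u1 g1 u2 g2"
    by unfold_locales
      (rule ab refl \<rho>_dens out u1 u2 real L2 | erule W outside | rule indep, assumption)+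
  then show ?thesis by blast
qed

end

locale lc_measures = sl_measures a b m s q r c \<rho> \<sigma>p \<sigma>n \<chi>p \<chi>n sp sn qp qn + lc_system m "ivl a b" s q r a b \<rho> u1 v1 u2 v2
  for a b m s q r c \<rho> \<sigma>p \<sigma>n \<chi>p \<chi>n sp sn qp qn u1 v1 u2 v2
begin

lemma Tmax_eq: "Tmax a b c \<rho> \<sigma>p \<sigma>n \<chi>p \<chi>n = TM"
proof -
  have "(\<exists>f1. solves (ivl a b) f f1 g) \<and> L2 \<rho> f \<and> L2 \<rho> g \<longleftrightarrow> (\<exists>x. has_data f g x)" for f g
  proof
    assume "(\<exists>f1. solves (ivl a b) f f1 g) \<and> L2 \<rho> f \<and> L2 \<rho> g"
    then show "\<exists>x. has_data f g x" using solves_has_data by blast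
  next
    assume "\<exists>x. has_data f g x"
    then obtain x where x: "has_data f g x" by blast
    then show "(\<exists>f1. solves (ivl a b) f f1 g) \<and> L2 \<rho> f \<and> L2 \<rho> g"
      using has_data_solves[OF x] by (auto simp: has_data_def)
  qed
  then show ?thesis using Tmax_solves by (auto simp: TM_def)
qed

lemma T0_eq: "T0 a b c \<rho> \<sigma>p \<sigma>n \<chi>p \<chi>n = TC"
  unfolding T0_def TC_def Tmax_eq ..

lemma Tmin_eq: "Tmin a b c \<rho> \<sigma>p \<sigma>n \<chi>p \<chi>n = TMIN"
  unfolding Tmin_def TMIN_def T0_eq ..

text \<open>Since \<open>u1\<close> and \<open>u2\<close> are real, conjugating \<open>v\<close>
  conjugates its boundary data. \<open>qderiv_eq\<close> identifies the Wronskian in the definition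
  with one whose limits are known to exist.\<close>

lemma Wab_eq:
  assumes f: "has_data f g x" and v: "has_data v gv y"
  shows "Wab a b c \<rho> \<sigma>p \<sigma>n \<chi>p \<chi>n f (cnj \<circ> v) = bdry_form x y"
proof -
  have L: "L2 \<rho> g" "L2 \<rho> (\<lambda>t. cnj (gv t))" using f v by (auto simp: has_data_def intro: L2_cnj)
  have "solves (ivl a b) (sol (cnj (y$1)) (cnj (y$2)) (\<lambda>t. cnj (gv t))) (sol' (cnj (y$1)) (cnj (y$2)) (\<lambda>t. cnj (gv t))) (\<lambda>t. cnj (gv t))"
    by (rule sol_solves[OF L(2)])
  then have sv: "solves (ivl a b) (cnj \<circ> v) (sol' (cnj (y$1)) (cnj (y$2)) (\<lambda>t. cnj (gv t))) (\<lambda>t. cnj (gv t))"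
    by (rule solves_cong) (use v in \<open>auto simp: has_data_def sol_cnj\<close>)
  define w where "w = (\<lambda>t. sol (x$1) (x$2) g t * sol' (cnj (y$1)) (cnj (y$2)) (\<lambda>t. cnj (gv t)) t
     - sol' (x$1) (x$2) g t * sol (cnj (y$1)) (cnj (y$2)) (\<lambda>t. cnj (gv t)) t)"
  define W where "W = wronski a b c \<rho> \<sigma>p \<sigma>n \<chi>p \<chi>n f (cnj \<circ> v)"
  have W: "w t = W t" if t: "t \<in> ivl a b" for t
    using qderiv_eq[OF has_data_solves[OF f] L(1) t] qderiv_eq[OF sv L(2) t] f v t
    by (simp add: W_def w_def wronski_def has_data_def sol_cnj)
  have ev: "\<forall>\<^sub>F t in at_left_end a. w t = W t" "\<forall>\<^sub>F t in at_right_end b. w t = W t"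
    using eventually_at_left_end[OF c] eventually_at_right_end[OF c] W by (auto elim!: eventually_mono)
  note lim = wronskian_limits[OF L, of "x$1" "x$2" "cnj (y$1)" "cnj (y$2)", folded w_def]
  have "Lim (at_left_end a) W = x$1 * cnj (y$2) - x$2 * cnj (y$1)"
    by (rule tendsto_Lim[OF at_left_end_nontrivial[OF ab] Lim_transform_eventually[OF lim(1) ev(1)]])
  moreover have "Lim (at_right_end b) W = x$3 * cnj (y$4) - x$4 * cnj (y$3)"
    using tendsto_Lim[OF at_right_end_nontrivial Lim_transform_eventually[OF lim(2) ev(2)]] f v
    by (simp add: has_data_def integral_cnj_u)
  ultimately show ?thesis unfolding Wab_def W_def bdry_form_def by simp
qed

end

section \<open>Existence of the common measure and its densities\<close>

lemma (in borel_sigma_finite) measure_density_singleton: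
  assumes "d \<in> borel_measurable borel" "\<And>x. 0 \<le> d x"
  shows "measure (density m (\<lambda>x. ennreal (d x))) {t} = d t * measure m {t}"
  using assms(2)[of t] by (simp add: measure_def emeasure_density_singleton[OF assms(1)] enn2real_mult)

lemma density_loc_integrable:
  assumes N: "pos_lf_measure a b (density m (\<lambda>x. ennreal (d x)))" and d: "d \<in> borel_measurable borel" "\<And>x. 0 \<le> d x"
    and m: "sets m = sets borel" and xy: "x \<in> ivl a b" "y \<in> ivl a b"
  shows "set_integrable m {x..<y} d"
proof -
  note [measurable] = d(1) and [measurable_cong] = m
  have fin: "emeasure (density m (\<lambda>x. ennreal (d x))) {x..y} < \<infinity>"
    using N ivl_Icc_subset[OF xy] by (simp add: pos_lf_measure_def)
  have "(\<integral>\<^sup>+t. ennreal (norm (indicator {x..y} t *\<^sub>R d t)) \<partial>m) = (\<integral>\<^sup>+t. ennreal (d t) * indicator {x..y} t \<partial>m)"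
    by (rule nn_integral_cong) (use d(2) in \<open>auto simp: indicator_def\<close>)
  also have "\<dots> = emeasure (density m (\<lambda>x. ennreal (d x))) {x..y}"
    by (rule emeasure_density[symmetric]) auto
  finally have "set_integrable m {x..y} d" using fin unfolding set_integrable_def by (intro integrableI_bounded) auto
  then show ?thesis by (rule set_integrable_subset) (auto simp: m)
qed

lemma exists_sl_measures:
  assumes hyps: "standing_hyps a b c \<rho> \<sigma>p \<sigma>n \<chi>p \<chi>n"
  shows "\<exists>m s q r sp sn qp qn. sl_measures a b m s q r c \<rho> \<sigma>p \<sigma>n \<chi>p \<chi>n sp sn qp qn"
proof -
  have ab: "a < b" and c: "c \<in> ivl a b" and \<rho>: "pos_lf_measure a b \<rho>"
    and \<chi>: "signed_lf_measure a b \<chi>p \<chi>n" and \<sigma>: "signed_lf_measure a b \<sigma>p \<sigma>n" and full: "ssupp a b \<sigma>p \<sigma>n = ivl a b"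
    and at: "\<And>x. spt \<sigma>p \<sigma>n x * spt \<chi>p \<chi>n x = 0" "\<And>x. spt \<sigma>p \<sigma>n x * measure \<rho> {x} = 0"
    using hyps unfolding standing_hyps_def by blast+
  have lf: "pos_lf_measure a b N" if "N \<in> set [\<rho>, \<sigma>p, \<sigma>n, \<chi>p, \<chi>n]" for N
    using \<rho> \<chi> \<sigma> that by (auto simp: signed_lf_measure_def)
  define m where "m = sum_measure [\<rho>, \<sigma>p, \<sigma>n, \<chi>p, \<chi>n] borel"
  have sm: "sets m = sets borel" by (simp add: m_def)
  have em: "emeasure m A = (\<Sum>N\<leftarrow>[\<rho>, \<sigma>p, \<sigma>n, \<chi>p, \<chi>n]. emeasure N A)" if "A \<in> sets borel" for A
    unfolding m_def by (rule emeasure_sum_measure[OF _ that]) (use lf in \<open>simp add: pos_lf_measure_def\<close>)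
  have m: "pos_lf_measure a b m"
    unfolding pos_lf_measure_def
  proof (intro conjI allI impI)
    show "emeasure m (UNIV - ivl a b) = 0"
      using lf open_ivl[of a b] by (subst em) (auto simp: pos_lf_measure_def)
    fix K assume K: "compact K \<and> K \<subseteq> ivl a b"
    then have "K \<in> sets borel" by (auto intro: borel_compact)
    then show "emeasure m K < \<infinity>"
      using lf K by (subst em) (auto simp: pos_lf_measure_def less_top)
  qed (rule sm)
  have ac: "absolutely_continuous m N" if N: "N \<in> set [\<rho>, \<sigma>p, \<sigma>n, \<chi>p, \<chi>n]" for N
    unfolding absolutely_continuous_def
  proof
    fix A assume A: "A \<in> null_sets m"
    then have "A \<in> sets borel" "emeasure m A = 0" using sm by (auto simp: null_sets_def)
    then have "emeasure N A = 0" using em[of A] N by auto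
    then show "A \<in> null_sets N" using lf[OF N] \<open>A \<in> sets borel\<close> by (auto simp: null_sets_def pos_lf_measure_def)
  qed
  obtain r where r: "r \<in> borel_measurable borel" "\<And>x. 0 \<le> r x" "\<rho> = density m (\<lambda>x. ennreal (r x))"
    using real_density_exists[OF ab m \<rho> ac] by auto
  obtain sp sn where s: "sp \<in> borel_measurable borel" "sn \<in> borel_measurable borel" "\<And>x. 0 \<le> sp x" "\<And>x. 0 \<le> sn x"
    "\<And>x. sp x * sn x = 0" "\<sigma>p = density m (\<lambda>x. ennreal (sp x))" "\<sigma>n = density m (\<lambda>x. ennreal (sn x))"
    using signed_densities_exist[OF ab m \<sigma> ac ac] by auto
  obtain qp qn where q: "qp \<in> borel_measurable borel" "qn \<in> borel_measurable borel" "\<And>x. 0 \<le> qp x" "\<And>x. 0 \<le> qn x"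
    "\<chi>p = density m (\<lambda>x. ennreal (qp x))" "\<chi>n = density m (\<lambda>x. ennreal (qn x))"
    using signed_densities_exist[OF ab m \<chi> ac ac] by auto
  interpret sigma_finite_measure m by (rule pos_lf_sigma_finite[OF ab m])
  interpret borel_sigma_finite m by unfold_locales (rule sm)
  have int: "set_integrable m {x..<y} sp" "set_integrable m {x..<y} sn" "set_integrable m {x..<y} qp"
    "set_integrable m {x..<y} qn" if "x \<in> ivl a b" "y \<in> ivl a b" for x y
    using density_loc_integrable[OF _ s(1,3) sm that] density_loc_integrable[OF _ s(2,4) sm that]
      density_loc_integrable[OF _ q(1,3) sm that] density_loc_integrable[OF _ q(2,4) sm that]
      lf
    by (simp_all add: s(6,7)[symmetric] q(5,6)[symmetric])
  have spt: "spt \<sigma>p \<sigma>n t = (sp t - sn t) * measure m {t}" "spt \<chi>p \<chi>n t = (qp t - qn t) * measure m {t}"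
    "measure \<rho> {t} = r t * measure m {t}" for t
    unfolding spt_def s(6,7) q(5,6) r(3)
    using s q r by (simp_all add: measure_density_singleton left_diff_distrib)
  \<comment> \<open>If \<open>sp - sn\<close> were zero almost everywhere on an interval, both
    densities would be, as their product is zero; the midpoint would then lie outside the support of
    \<sigma>.\<close>
  have full': "\<not> (AE t in m. t \<in> {x<..<y} \<longrightarrow> sp t - sn t = 0)" if "x \<in> ivl a b" "y \<in> ivl a b" "x < y" for x y
  proof
    assume ae: "AE t in m. t \<in> {x<..<y} \<longrightarrow> sp t - sn t = 0"
    have zero: "emeasure (density m (\<lambda>x. ennreal (d x))) {x<..<y} = 0"
      if d: "d \<in> borel_measurable borel" "\<And>t. sp t - sn t = 0 \<Longrightarrow> d t = 0" for d
    proof -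
      have "emeasure (density m (\<lambda>x. ennreal (d x))) {x<..<y} = (\<integral>\<^sup>+t. ennreal (d t) * indicator {x<..<y} t \<partial>m)"
        by (rule emeasure_density) (use d in auto)
      also have "\<dots> = (\<integral>\<^sup>+t. 0 \<partial>m)"
        by (rule nn_integral_cong_AE) (use ae in \<open>eventually_elim, auto simp: indicator_def d(2)\<close>)
      finally show ?thesis by simp
    qed
    have "sp t = 0 \<and> sn t = 0" if "sp t - sn t = 0" for t using that s(5)[of t] by auto
    then have z: "emeasure \<sigma>p {x<..<y} = 0" "emeasure \<sigma>n {x<..<y} = 0" unfolding s(6,7) using zero s(1,2) by auto
    define w e where "w = (x + y) / 2" and "e = (y - x) / 2"
    have "ball w e = {x<..<y}" by (auto simp: ball_eq_greaterThanLessThan w_def e_def field_simps)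
    moreover have "x \<le> w" "w \<le> y" using that(3) by (auto simp: w_def field_simps)
    then have "w \<in> ivl a b" using is_interval_ivl[of a b] that(1,2) unfolding is_interval_1 by blast
    then have "w \<in> ssupp a b \<sigma>p \<sigma>n" using full by simp
    moreover have "e > 0" using that by (simp add: e_def)
    ultimately show False using z by (auto simp: ssupp_def)
  qed
  have "sl_measures a b m (\<lambda>t. sp t - sn t) (\<lambda>t. qp t - qn t) r c \<rho> \<sigma>p \<sigma>n \<chi>p \<chi>n sp sn qp qn"
  proof (unfold_locales)
    show "(sp t - sn t) * (qp t - qn t) * measure m {t} = 0" for t using at(1)[of t] unfolding spt by auto
    show "(sp t - sn t) * r t * measure m {t} = 0" for t using at(2)[of t] unfolding spt by auto
  qed (use full' int s q r ab c lf open_ivl is_interval_ivl in \<open>auto intro!: set_integral_diff(1)\<close>)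
  then show ?thesis by blast
qed

theorem theorem6p5:
  fixes a b :: ereal and c :: real and \<rho> \<sigma>p \<sigma>n \<chi>p \<chi>n :: "real measure"
    and S :: "(cfun \<times> cfun) set"
  assumes hyps: "standing_hyps a b c \<rho> \<sigma>p \<sigma>n \<chi>p \<chi>n"
    and lca: "lc_left a b c \<rho> \<sigma>p \<sigma>n \<chi>p \<chi>n"
    and lcb: "lc_right a b c \<rho> \<sigma>p \<sigma>n \<chi>p \<chi>n"
  shows "self_adjoint_restriction a b c \<rho> \<sigma>p \<sigma>n \<chi>p \<chi>n S \<longleftrightarrow>
    (\<exists>v gv w gw.
       (v, gv) \<in> Tmax a b c \<rho> \<sigma>p \<sigma>n \<chi>p \<chi>n \<and> (w, gw) \<in> Tmax a b c \<rho> \<sigma>p \<sigma>n \<chi>p \<chi>n \<and>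
       (\<forall>\<alpha> \<beta> :: complex.
          (\<lambda>x. \<alpha> * v x + \<beta> * w x, \<lambda>x. \<alpha> * gv x + \<beta> * gw x) \<in> Tmin a b c \<rho> \<sigma>p \<sigma>n \<chi>p \<chi>n
          \<longrightarrow> \<alpha> = 0 \<and> \<beta> = 0) \<and>
       Wab a b c \<rho> \<sigma>p \<sigma>n \<chi>p \<chi>n v (cnj \<circ> v) = 0 \<and>
       Wab a b c \<rho> \<sigma>p \<sigma>n \<chi>p \<chi>n w (cnj \<circ> w) = 0 \<and>
       Wab a b c \<rho> \<sigma>p \<sigma>n \<chi>p \<chi>n v (cnj \<circ> w) = 0 \<and>
       S = sat \<rho> {(f, g) \<in> Tmax a b c \<rho> \<sigma>p \<sigma>n \<chi>p \<chi>n.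
             Wab a b c \<rho> \<sigma>p \<sigma>n \<chi>p \<chi>n f (cnj \<circ> v) = 0 \<and>
             Wab a b c \<rho> \<sigma>p \<sigma>n \<chi>p \<chi>n f (cnj \<circ> w) = 0})"
proof -
  obtain m s q r sp sn qp qn where "sl_measures a b m s q r c \<rho> \<sigma>p \<sigma>n \<chi>p \<chi>n sp sn qp qn"
    using exists_sl_measures[OF hyps] by blast
  then interpret sl_measures a b m s q r c \<rho> \<sigma>p \<sigma>n \<chi>p \<chi>n sp sn qp qn .
  obtain u1 v1 u2 v2 where "lc_system m (ivl a b) s q r a b \<rho> u1 v1 u2 v2"
    using exists_lc_measures[OF hyps lca lcb] by blast
  then interpret lc_system m "ivl a b" s q r a b \<rho> u1 v1 u2 v2 .
  interpret lc_measures a b m s q r c \<rho> \<sigma>p \<sigma>n \<chi>p \<chi>n sp sn qp qn u1 v1 u2 v2 ..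
  \<comment> \<open>Turns the boundary conditions for functions into linear conditions on data
    vectors, after which \<open>self_adjoint_iff\<close> is the claim.\<close>
  have B: "{(f, g) \<in> TM. Wab a b c \<rho> \<sigma>p \<sigma>n \<chi>p \<chi>n f (cnj \<circ> v) = 0 \<and> Wab a b c \<rho> \<sigma>p \<sigma>n \<chi>p \<chi>n f (cnj \<circ> w) = 0}
    = {(f, g). \<exists>z. has_data f g z \<and> bdry_form z x = 0 \<and> bdry_form z y = 0}"
    if v: "has_data v gv x" and w: "has_data w gw y" for v gv w gw x y
    using Wab_eq[OF _ v] Wab_eq[OF _ w] by (auto simp: TM_data)
  show ?thesis
    unfolding self_adjoint_restriction_def Tmax_eq Tmin_eq self_adjoint_iff
  proof (intro iffI; elim exE conjE)
    fix v gv w gw x y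
    assume vw: "has_data v gv x" "has_data w gw y" and "bdry_form x x = 0" "bdry_form y y = 0" "bdry_form x y = 0"
      and "\<forall>\<alpha> \<beta>. (\<lambda>t. \<alpha> * v t + \<beta> * w t, \<lambda>t. \<alpha> * gv t + \<beta> * gw t) \<in> TMIN \<longrightarrow> \<alpha> = 0 \<and> \<beta> = 0"
      and "S = sat \<rho> {(f, g). \<exists>z. has_data f g z \<and> bdry_form z x = 0 \<and> bdry_form z y = 0}"
    then show "\<exists>v gv w gw. (v, gv) \<in> TM \<and> (w, gw) \<in> TM \<and>
       (\<forall>\<alpha> \<beta>. (\<lambda>x. \<alpha> * v x + \<beta> * w x, \<lambda>x. \<alpha> * gv x + \<beta> * gw x) \<in> TMIN \<longrightarrow> \<alpha> = 0 \<and> \<beta> = 0) \<and>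
       Wab a b c \<rho> \<sigma>p \<sigma>n \<chi>p \<chi>n v (cnj \<circ> v) = 0 \<and> Wab a b c \<rho> \<sigma>p \<sigma>n \<chi>p \<chi>n w (cnj \<circ> w) = 0 \<and>
       Wab a b c \<rho> \<sigma>p \<sigma>n \<chi>p \<chi>n v (cnj \<circ> w) = 0 \<and>
       S = sat \<rho> {(f, g) \<in> TM. Wab a b c \<rho> \<sigma>p \<sigma>n \<chi>p \<chi>n f (cnj \<circ> v) = 0 \<and> Wab a b c \<rho> \<sigma>p \<sigma>n \<chi>p \<chi>n f (cnj \<circ> w) = 0}"
      unfolding TM_data
      by (intro exI[of _ v] exI[of _ gv] exI[of _ w] exI[of _ gw])
        (simp add: B[OF vw, unfolded TM_data] Wab_eq[OF vw(1) vw(1)] Wab_eq[OF vw(2) vw(2)] Wab_eq[OF vw(1) vw(2)], blast)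
  next
    fix v gv w gw
    assume "(v, gv) \<in> TM" "(w, gw) \<in> TM"
      and W: "Wab a b c \<rho> \<sigma>p \<sigma>n \<chi>p \<chi>n v (cnj \<circ> v) = 0" "Wab a b c \<rho> \<sigma>p \<sigma>n \<chi>p \<chi>n w (cnj \<circ> w) = 0"
        "Wab a b c \<rho> \<sigma>p \<sigma>n \<chi>p \<chi>n v (cnj \<circ> w) = 0"
      and min: "\<forall>\<alpha> \<beta>. (\<lambda>x. \<alpha> * v x + \<beta> * w x, \<lambda>x. \<alpha> * gv x + \<beta> * gw x) \<in> TMIN \<longrightarrow> \<alpha> = 0 \<and> \<beta> = 0"
      and S: "S = sat \<rho> {(f, g) \<in> TM. Wab a b c \<rho> \<sigma>p \<sigma>n \<chi>p \<chi>n f (cnj \<circ> v) = 0 \<and> Wab a b c \<rho> \<sigma>p \<sigma>n \<chi>p \<chi>n f (cnj \<circ> w) = 0}"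
    then obtain x y where vw: "has_data v gv x" "has_data w gw y" by (auto simp: TM_data)
    note W' = W[unfolded Wab_eq[OF vw(1) vw(1)] Wab_eq[OF vw(2) vw(2)] Wab_eq[OF vw(1) vw(2)]]
    show "\<exists>v gv w gw x y. has_data v gv x \<and> has_data w gw y \<and>
       (\<forall>\<alpha> \<beta>. (\<lambda>t. \<alpha> * v t + \<beta> * w t, \<lambda>t. \<alpha> * gv t + \<beta> * gw t) \<in> TMIN \<longrightarrow> \<alpha> = 0 \<and> \<beta> = 0) \<and>
       bdry_form x x = 0 \<and> bdry_form y y = 0 \<and> bdry_form x y = 0 \<and>
       S = sat \<rho> {(f, g). \<exists>z. has_data f g z \<and> bdry_form z x = 0 \<and> bdry_form z y = 0}"
      using vw min W' S[unfolded B[OF vw]] by blast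
  qed
qed

end
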